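(* Let $d\geq3$ be an integer, and let $\nu_{d-1}$ be the surface measure on the truncated cone $C^{d-1}=\{(t,|t|):t\in\mathbb{R}^{d-1},\ |t|\leq1\}\subseteq\mathbb{R}^d$. Then $$\dim^\theta_{\mathrm F}\nu_{d-1}=\min\big\{2+(d-1)\theta,\ (d-2)+\theta\big\}$$ for all $\theta\in[0,1]$. As a function of $\theta$ this has a phase transition at $\theta=\frac{d-4}{d-2}$ whenever $d\geq5$, but for $d=3,4$ it is affine. Moreover, the Fourier dimension of $\nu_{d-1}$ is $\min\{2,d-2\}$ and the Sobolev dimension and the Frostman dimension of $\nu_{d-1}$ are both equal to $d-1$.
   Context: For a finite compactly supported Borel measure $\mu$ on $\mathbb{R}^d$, $\widehat\mu(\xi)=\int e^{-2\pi i\xi\cdot x}\,d\mu(x)$. Fourier spectrum: for $\theta\in(0,1]$ let $\mathcal{J}_{s,\theta}(\mu)=\Big(\int_{\mathbb{R}^d}|\widehat\mu(\xi)|^{2/\theta}|\xi|^{s/\theta-d}\,d\xi\Big)^\theta$ and for $\theta=0$ let $\mathcal{J}_{s,0}(\mu)=\sup_{\xi\in\mathbb{R}^d}|\widehat\mu(\xi)|^2|\xi|^s$. Then $\dim^\theta_{\mathrm F}\mu=\sup\{s\in\mathbb{R}:\mathcal{J}_{s,\theta}(\mu)<\infty\}$. The Fourier dimension is $\dim_{\mathrm F}\mu=\dim^0_{\mathrm F}\mu$ and the Sobolev dimension is $\dim_{\mathrm S}\mu=\dim^1_{\mathrm F}\mu$. The Frostman dimension is $\dim_{\mathrm{Fr}}\mu=\sup\{\alpha\in\mathbb{R}:\exists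 C>0,\ \mu(B(x,r))\leq Cr^\alpha\ \forall r>0,\ x\in\mathbb{R}^d\}$. A phase transition is a point where the function $\theta\mapsto\dim^\theta_{\mathrm F}\mu$ is not differentiable. *)

theory Defs
  imports "HOL-Analysis.Analysis"
begin

section \<open>Fourier transform, Fourier spectrum and Frostman dimension of a measure\<close>

definition measure_fourier :: "'a::euclidean_space measure \<Rightarrow> 'a \<Rightarrow> complex"
  where "measure_fourier \<mu> \<xi> = (LINT x|\<mu>. exp (- (2 * of_real pi * \<i> * of_real (\<xi> \<bullet> x))))"

text \<open>Only used for exponents \<^term>\<open>p > 0\<close>.\<close>

definition ennreal_powr :: "ennreal \<Rightarrow> real \<Rightarrow> ennreal"
  where "ennreal_powr x p = (if x = \<infinity> then \<infinity> else ennreal (enn2real x powr p))"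

text \<open>
  Library convention: \<^term>\<open>(0::real) powr a = 0\<close> for every \<^term>\<open>a\<close>. For \<open>\<theta> > 0\<close> the only
  affected frequency \<open>\<xi> = 0\<close> is Lebesgue null. For \<open>\<theta> = 0\<close> and a nonzero finite measure, finiteness
  of the supremum is not affected either: the Fourier transform is continuous and nonzero at the
  origin, so for \<open>s < 0\<close> the supremum over \<open>\<xi> \<noteq> 0\<close> is already infinite, and for \<open>s = 0\<close> the value at
  the origin is the limit of the values at \<open>\<xi> \<noteq> 0\<close>.
\<close>

definition fourier_energy :: "real \<Rightarrow> real \<Rightarrow> 'a::euclidean_space measure \<Rightarrow> ennreal"
  where "fourier_energy s \<theta> \<mu> =
    (if \<theta> = 0
     then (SUP \<xi>. ennreal ((cmod (measure_fourier \<mu> \<xi>))\<^sup>2 * norm \<xi> powr s))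
     else ennreal_powr
       (\<integral>\<^sup>+ \<xi>. ennreal (cmod (measure_fourier \<mu> \<xi>) powr (2 / \<theta>)
              * norm \<xi> powr (s / \<theta> - real DIM('a))) \<partial>lborel) \<theta>)"

definition fourier_spectrum :: "'a::euclidean_space measure \<Rightarrow> real \<Rightarrow> ereal"
  where "fourier_spectrum \<mu> \<theta> = Sup (ereal ` {s. fourier_energy s \<theta> \<mu> < \<infinity>})"

definition fourier_dim :: "'a::euclidean_space measure \<Rightarrow> ereal"
  where "fourier_dim \<mu> = fourier_spectrum \<mu> 0"

definition sobolev_dim :: "'a::euclidean_space measure \<Rightarrow> ereal"
  where "sobolev_dim \<mu> = fourier_spectrum \<mu> 1"

definition frostman_dim :: "'a::euclidean_space measure \<Rightarrow> ereal"
  where "frostman_dim \<mu> = Sup (ereal ` {\<alpha>. \<exists>C>0. \<forall>r>0. \<forall>x.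
    emeasure \<mu> (cball x r) \<le> ennreal (C * r powr \<alpha>)})"

text \<open>
  The spectrum is a function on \<open>[0,1]\<close>, so differentiability is relative to that interval
  (one-sided at the endpoints). It is meant for measures with finite spectrum.
\<close>

definition phase_transition :: "'a::euclidean_space measure \<Rightarrow> real \<Rightarrow> bool"
  where "phase_transition \<mu> \<theta> \<longleftrightarrow> \<theta> \<in> {0..1} \<and>
    \<not> (\<lambda>t. real_of_ereal (fourier_spectrum \<mu> t)) differentiable (at \<theta> within {0..1})"

section \<open>Surface measure on the truncated cone\<close>

text \<open>
  Surface measure on a subset \<open>S\<close> of the graph of \<open>f\<close>: the image under \<open>t \<mapsto> (t, f t)\<close> of the
  area element \<open>sqrt (1 + |\<nabla>f(t)|\<^sup>2) dt\<close>, where \<open>|\<nabla>f(t)|\<^sup>2\<close> is the sum of the squared partial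
  derivatives. Points of nondifferentiability, such as the apex of the cone, are assumed Lebesgue
  null. The product type carries the Euclidean norm.
\<close>

definition graph_area_element :: "('a::euclidean_space \<Rightarrow> real) \<Rightarrow> 'a \<Rightarrow> real"
  where "graph_area_element f t = sqrt (1 + (\<Sum>b\<in>Basis. (frechet_derivative f (at t) b)\<^sup>2))"

definition graph_surface_measure ::
    "('a::euclidean_space \<Rightarrow> real) \<Rightarrow> ('a \<times> real) set \<Rightarrow> ('a \<times> real) measure"
  where "graph_surface_measure f S =
    distr (density lborel (\<lambda>t. ennreal (graph_area_element f t) * indicator S (t, f t)))
      borel (\<lambda>t. (t, f t))"

definition truncated_cone :: "('a::euclidean_space \<times> real) set"
  where "truncated_cone = {(t, norm t) | t. norm t \<le> 1}"

definition cone_measure :: "('a::euclidean_space \<times> real) measure"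
  where "cone_measure = graph_surface_measure norm truncated_cone"

lemma graph_area_element_norm:
  fixes t :: "'a::euclidean_space"
  assumes "t \<noteq> 0"
  shows "graph_area_element norm t = sqrt 2"
proof -
  have "(norm has_derivative (\<lambda>h. h \<bullet> sgn t)) (at t)"
    using has_derivative_norm[OF assms] by (simp add: inner_commute)
  then have "frechet_derivative norm (at t) = (\<lambda>h. h \<bullet> sgn t)"
    by (metis frechet_derivative_at)
  moreover have "(\<Sum>b\<in>Basis. (b \<bullet> sgn t)\<^sup>2) = (norm (sgn t))\<^sup>2"
    by (simp add: norm_eq_sqrt_inner euclidean_inner[of "sgn t" "sgn t"] power2_eq_square
        inner_commute sum_nonneg)
  ultimately show ?thesis
    using assms by (simp add: graph_area_element_def norm_sgn)
qed

lemma cone_measure_eq: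
  "(cone_measure :: ('a::euclidean_space \<times> real) measure) =
    distr (density lborel (\<lambda>t. ennreal (sqrt 2) * indicator (cball 0 1) t)) borel (\<lambda>t. (t, norm t))"
proof -
  have *: "(\<lambda>t::'a. ennreal (graph_area_element norm t) * indicator truncated_cone (t, norm t)) =
    (\<lambda>t. if t = 0 then ennreal (graph_area_element norm (0::'a))
         else ennreal (sqrt 2) * indicator (cball 0 1) t)"
    by (rule ext) (auto simp: graph_area_element_norm truncated_cone_def indicator_def)
  have "density lborel (\<lambda>t::'a. ennreal (graph_area_element norm t) * indicator truncated_cone (t, norm t))
     = density lborel (\<lambda>t. ennreal (sqrt 2) * indicator (cball 0 1) t)"
    unfolding *
  proof (rule density_cong)
    show meas: "(\<lambda>t::'a. ennreal (sqrt 2) * indicator (cball 0 1) t) \<in> borel_measurable lborel"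
      by (intro borel_measurable_times_ennreal borel_measurable_const borel_measurable_indicator) simp
    show "(\<lambda>t::'a. if t = 0 then ennreal (graph_area_element norm (0::'a))
        else ennreal (sqrt 2) * indicator (cball 0 1) t) \<in> borel_measurable lborel"
      by (rule measurable_If[OF borel_measurable_const meas]) simp
    show "AE x::'a in lborel. (if x = 0 then ennreal (graph_area_element norm (0::'a))
        else ennreal (sqrt 2) * indicator (cball 0 1) x) = ennreal (sqrt 2) * indicator (cball 0 1) x"
      using AE_lborel_singleton[of "0::'a"] by (rule AE_mp) (rule AE_I2, simp)
  qed
  then show ?thesis
    by (simp add: cone_measure_def graph_surface_measure_def)
qed

end

(*
  Write the Fourier transform at (\<xi>, \<tau>) as sqrt 2 times the integral of exp(-2 pi i (\<xi>.t + \<tau>|t|)) over the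
  unit ball of R^n, n = d - 1, and put \<rho> = |\<xi>|. Slicing the ball by the variables r = |t| and the angle
  to \<xi> gives the integral over 0 < r < 1 of r^(n-1) exp(-2 pi i \<tau> r) S(\<rho> r), where S is the Fourier
  transform of the unit sphere. Shifting the contour of S to the two vertical half-lines at 1 and -1
  turns it into exp(-2 pi i x) a(x) plus its conjugate, with a an explicit Laplace integral. One integration by
  parts in r then bounds the transform by
    (1 + \<rho>)^(-(n-1)/2) (1 / (1 + |\<rho> + \<tau>|) + 1 / (1 + |\<rho> - \<tau>|)),
  which is attained up to constants on the ridge |\<rho> - \<tau>| <= c for large \<rho>, and for large \<tau> near the
  axis \<rho> <= c. Integrating the upper bound gives finite energy below the threshold. The ridge forces
  s <= n - 1 + \<theta> and the axis forces s <= 2 + n \<theta>.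
*)
theory Submission
  imports Defs "HOL-Complex_Analysis.Cauchy_Integral_Theorem"
begin

text \<open>The contour is shifted at frequency \<rho> r for each radius r, and the half-line
  variable is then rescaled by \<rho> r. This leaves the amplitude r (t/\<rho> + 2ir)^((n-3)/2),
  which for large \<rho> tends to a positive function times the constant (2i)^((n-3)/2). Domination
  gives bounds uniform in \<rho> >= 1; the nonzero limit gives the lower bound on the ridge. The
  delicate case is n = 2: the exponent is -1/2 and the sphere density blows up at the endpoints.
  This is the origin of the recurring majorant x^(-1/2) + polynomial. One integration by parts
  suffices because the rim |t| = 1 leaves a boundary term of the size of the bound. That term is
  also what survives near the axis, where the transform has size 1/\<tau>. The thresholds are power
  counting. The ridge is a tube over R^n with integrand \<rho>^(-(n-1)/\<theta> + s/\<theta> - n -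
  1), integrable exactly if the exponent is below -n. The axis is a tube over a half-line with
  integrand \<tau>^(-2/\<theta> + s/\<theta> - n - 1), integrable exactly if the exponent is below
  -1.\<close>

abbreviation jb :: "real \<Rightarrow> real"
  where "jb y \<equiv> sqrt (1 + y\<^sup>2)"

abbreviation wave :: "real \<Rightarrow> complex"
  where "wave x \<equiv> cis (- (2 * pi * x))"

text \<open>The exponent of \<open>1 - v^2\<close> in the density of one coordinate on the unit
  sphere of R^n. Among \<open>n \<ge> 2\<close> it is negative only for \<open>n = 2\<close>, where
  it equals -1/2.\<close>

abbreviation slice_exp :: "nat \<Rightarrow> real"
  where "slice_exp n \<equiv> (real n - 3) / 2"

text \<open>On the half-line z = 1 - \<i> s one has 1 - z^2 = s (s + 2 \<i>). With s = t / (\<rho>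
  r) the second factor is \<open>ray (t / \<rho>) r\<close> divided by r.\<close>

abbreviation ray :: "real \<Rightarrow> real \<Rightarrow> complex"
  where "ray a r \<equiv> of_real a + 2 * \<i> * of_real r"

abbreviation lborel2 :: "('a::euclidean_space \<times> 'b::euclidean_space) measure"
  where "lborel2 \<equiv> lborel \<Otimes>\<^sub>M lborel"

abbreviation slice_map :: "real \<Rightarrow> real \<times> real \<Rightarrow> real \<times> real"
  where "slice_map \<rho> \<equiv> \<lambda>(y, r). (\<rho> * (r * (y / jb y)), r)"

section \<open>Invariances of Lebesgue measure and the slope-radius coordinates\<close>

lemma nn_integral_lborel_translate:
  fixes c :: "'a::euclidean_space"
  assumes [measurable]: "f \<in> borel_measurable borel"
  shows "(\<integral>\<^sup>+x. f (c + x) \<partial>lborel) = (\<integral>\<^sup>+x. f x \<partial>lborel)"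
  by (subst (2) lborel_distr_plus[of c, symmetric]) (simp add: nn_integral_distr)

lemma nn_integral_lborel_reflect:
  fixes c :: "'a::euclidean_space"
  assumes [measurable]: "f \<in> borel_measurable borel"
  shows "(\<integral>\<^sup>+x. f (c - x) \<partial>lborel) = (\<integral>\<^sup>+x. f x \<partial>lborel)"
  by (subst (2) lborel_affine[of "-1" c], simp)
     (simp add: nn_integral_density nn_integral_distr)

text \<open>Both measures are invariant under translations, so Fubini gives
  \<open>\<lambda>(B) \<mu>(A) = \<mu>(-B) \<lambda>(A)\<close>; the unit ball fixes the constant.\<close>
lemma distr_lborel_orthogonal_transformation:
  fixes T :: "'a::euclidean_space \<Rightarrow> 'a"
  assumes T: "orthogonal_transformation T"
  shows "distr lborel borel T = lborel"
proof (rule measure_eqI)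
  have lin: "linear T" using T by (simp add: orthogonal_transformation_linear)
  have [measurable]: "T \<in> borel_measurable borel"
    by (intro borel_measurable_continuous_onI linear_continuous_on linear_conv_bounded_linear[THEN iffD1] lin)
  have surjT: "surj T" using T by (rule orthogonal_transformation_surj)
  let ?\<mu> = "distr lborel borel T"
  have trans\<mu>: "(\<integral>\<^sup>+x. f (y + x) \<partial>?\<mu>) = (\<integral>\<^sup>+x. f x \<partial>?\<mu>)"
    if [measurable]: "f \<in> borel_measurable borel" for f y
  proof -
    obtain z where z: "y = T z" using surjT by auto
    have "(\<integral>\<^sup>+x. f (y + x) \<partial>?\<mu>) = (\<integral>\<^sup>+x. f (T (z + x)) \<partial>lborel)"
      by (subst nn_integral_distr) (auto simp: z linear_add[OF lin])
    also have "\<dots> = (\<integral>\<^sup>+x. f (T x) \<partial>lborel)"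
      by (rule nn_integral_lborel_translate[of "\<lambda>x. f (T x)"]) measurable
    also have "\<dots> = (\<integral>\<^sup>+x. f x \<partial>?\<mu>)" by (subst nn_integral_distr) auto
    finally show ?thesis .
  qed
  show "sets ?\<mu> = sets lborel" by simp
  fix A assume "A \<in> sets ?\<mu>"
  then have A[measurable]: "A \<in> sets borel" by simp
  define B where "B = (cball 0 1 :: 'a set)"
  have [measurable]: "B \<in> sets borel" by (simp add: B_def)
  \<comment> \<open>Fubini between \<open>?\<mu>\<close> and Lebesgue measure rests on this. Centred
    balls are invariant under \<open>T\<close>, so they exhaust the space with finite mass.\<close>
  have sf: "sigma_finite_measure ?\<mu>"
  proof
    show "\<exists>S. countable S \<and> S \<subseteq> sets ?\<mu> \<and> \<Union> S = space ?\<mu> \<and> (\<forall>a\<in>S. emeasure ?\<mu> a \<noteq> \<infinity>)"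
    proof (intro exI[of _ "range (\<lambda>n::nat. cball 0 (real n))"] conjI ballI)
      show "\<Union> (range (\<lambda>n::nat. cball 0 (real n))) = space ?\<mu>"
        by (auto simp: real_arch_simple)
      fix a assume "a \<in> range (\<lambda>n::nat. cball (0::'a) (real n))"
      then obtain n :: nat where a: "a = cball 0 (real n)" by auto
      have "T -` a = a" using T by (auto simp: a orthogonal_transformation_norm)
      then show "emeasure ?\<mu> a \<noteq> \<infinity>"
        using a by (simp add: emeasure_distr emeasure_cball)
    qed auto
  qed
  interpret \<mu>: sigma_finite_measure ?\<mu> by (rule sf)
  interpret P: pair_sigma_finite ?\<mu> lborel ..
  have TB: "T -` B = B" using T by (auto simp: B_def orthogonal_transformation_norm)
  have \<mu>B: "emeasure ?\<mu> B = emeasure lborel B" by (simp add: emeasure_distr TB)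
  have "emeasure lborel B * emeasure ?\<mu> A = (\<integral>\<^sup>+x. indicator A x * emeasure lborel B \<partial>?\<mu>)"
    by (simp add: nn_integral_multc nn_integral_indicator mult.commute)
  also have "\<dots> = (\<integral>\<^sup>+x. (\<integral>\<^sup>+y. indicator A x * indicator B (- x + y) \<partial>lborel) \<partial>?\<mu>)"
    by (subst nn_integral_cmult, measurable)
       (subst nn_integral_lborel_translate, measurable)
  also have "\<dots> = (\<integral>\<^sup>+y. (\<integral>\<^sup>+x. indicator A x * indicator B (- x + y) \<partial>?\<mu>) \<partial>lborel)"
    by (rule P.Fubini'[symmetric]) measurable
  \<comment> \<open>Translating \<open>x\<close> by \<open>y\<close> cancels \<open>y\<close> in the
    second indicator, and \<open>B\<close> is symmetric about the origin.\<close>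
  also have "\<dots> = (\<integral>\<^sup>+y. (\<integral>\<^sup>+x. indicator A (y + x) * indicator B (- (y + x) + y) \<partial>?\<mu>) \<partial>lborel)"
    by (intro nn_integral_cong trans\<mu>[symmetric]) measurable
  also have "\<dots> = (\<integral>\<^sup>+y. (\<integral>\<^sup>+x. indicator A (x + y) * indicator B x \<partial>?\<mu>) \<partial>lborel)"
    by (intro nn_integral_cong) (auto simp: B_def indicator_def add.commute)
  also have "\<dots> = (\<integral>\<^sup>+x. (\<integral>\<^sup>+y. indicator A (x + y) * indicator B x \<partial>lborel) \<partial>?\<mu>)"
    by (rule P.Fubini') measurable
  also have "\<dots> = (\<integral>\<^sup>+x. emeasure lborel A * indicator B x \<partial>?\<mu>)"
    by (intro nn_integral_cong, subst nn_integral_multc, measurable)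
       (subst nn_integral_lborel_translate, auto)
  also have "\<dots> = emeasure lborel A * emeasure lborel B"
    by (simp add: nn_integral_cmult \<mu>B)
  finally have eq: "emeasure lborel B * emeasure ?\<mu> A = emeasure lborel B * emeasure lborel A"
    by (simp add: mult.commute)
  have "emeasure lborel B = ennreal (unit_ball_vol DIM('a))"
    by (simp add: B_def emeasure_cball)
  then have "emeasure lborel B \<noteq> 0" "emeasure lborel B \<noteq> top"
    using unit_ball_vol_pos[of "real DIM('a)"] by (auto simp: ennreal_eq_0_iff not_le[symmetric] simp del: unit_ball_vol_pos)
  with eq show "emeasure ?\<mu> A = emeasure lborel A"
    by (simp add: ennreal_mult_cancel_left)
qed

text \<open>Both sides integrate \<open>g\<close> against measures on the line with the same
  distribution function, and half-lines form an intersection-stable generator. The space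
  \<open>M\<close> is left general because the lemma serves both for the norm on a Euclidean space
  and for the length of finitely many coordinates under a product measure.\<close>

lemma nn_integral_radial:
  fixes f :: "'b \<Rightarrow> real" and g :: "real \<Rightarrow> ennreal"
  assumes [measurable]: "f \<in> borel_measurable M"
    and d: "d \<ge> 1" and c: "c \<ge> 0"
    and em: "\<And>r. r > 0 \<Longrightarrow> emeasure M {x\<in>space M. f x \<le> r} = ennreal (c * r ^ d)"
    and g[measurable]: "g \<in> borel_measurable borel"
  shows "(\<integral>\<^sup>+x. g (f x) \<partial>M) =
    (\<integral>\<^sup>+r. ennreal (c * d * r ^ (d - 1)) * indicator {0<..} r * g r \<partial>lborel)"
proof -
  let ?D = "density lborel (\<lambda>r. ennreal (c * d * r ^ (d - 1)) * indicator {0<..} r)"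
  have emD: "emeasure ?D {..a} = (if a > 0 then ennreal (c * a ^ d) else 0)" for a :: real
  proof (cases "a > 0")
    case True
    have "emeasure ?D {..a} = (\<integral>\<^sup>+r. ennreal (c * d * r ^ (d - 1)) * indicator {0<..} r * indicator {..a} r \<partial>lborel)"
      by (subst emeasure_density) auto
    also have "\<dots> = (\<integral>\<^sup>+r. ennreal (c * d * r ^ (d - 1)) * indicator {0..a} r \<partial>lborel)"
      by (rule nn_integral_cong_AE, rule AE_I[where N="{0}"]) (auto simp: indicator_def)
    also have "\<dots> = ennreal (c * a ^ d - c * 0 ^ d)"
      using d c True
      by (intro nn_integral_FTC_Icc) (auto intro!: derivative_eq_intros)
    finally show ?thesis using True d by (simp add: power_0_left)
  next
    case False
    have "emeasure ?D {..a} = (\<integral>\<^sup>+r. ennreal (c * d * r ^ (d - 1)) * indicator {0<..} r * indicator {..a} r \<partial>lborel)"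
      by (subst emeasure_density) auto
    also have "\<dots> = (\<integral>\<^sup>+(r::real). 0 \<partial>lborel)"
      using False by (intro nn_integral_cong) (auto simp: indicator_def)
    finally show ?thesis using False by simp
  qed
  have emM: "emeasure (distr M borel f) {..a} = (if a > 0 then ennreal (c * a ^ d) else 0)" for a :: real
  proof -
    have *: "emeasure (distr M borel f) {..a} = emeasure M {x\<in>space M. f x \<le> a}"
      by (subst emeasure_distr) (auto intro!: arg_cong[where f="emeasure M"])
    show ?thesis
    proof (cases "a > 0")
      case False
      \<comment> \<open>For \<open>a \<le> 0\<close> the mass is at most \<open>c * r ^ d\<close>
        for every \<open>r > 0\<close>; now \<open>r\<close> tends to 0.\<close>
      have "emeasure M {x\<in>space M. f x \<le> a} \<le> ennreal (c * r ^ d)" if "r > 0" for r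
        unfolding em[OF that, symmetric] using False that by (intro emeasure_mono) auto
      moreover have "((\<lambda>r. ennreal (c * r ^ d)) \<longlongrightarrow> ennreal (c * 0 ^ d)) (at_right 0)"
        by (intro tendsto_intros)
      ultimately have "emeasure M {x\<in>space M. f x \<le> a} \<le> ennreal (c * 0 ^ d)"
        by (intro tendsto_lowerbound[where F="at_right 0"])
           (auto simp: eventually_at_right_less intro: eventually_mono[OF eventually_at_right_less])
      then show ?thesis using * False d by (simp add: power_0_left)
    qed (use * em in auto)
  qed
  have "distr M borel f = ?D"
  proof (rule measure_eqI_generator_eq[where E="range atMost" and \<Omega>=UNIV and A="\<lambda>n. {..real n}"])
    show "Int_stable (range (atMost :: real \<Rightarrow> real set))"
      by (auto simp: Int_stable_def min_def[symmetric])
    show "sets (distr M borel f) = sigma_sets UNIV (range atMost)"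
      by (simp add: borel_eq_atMost)
    show "sets ?D = sigma_sets UNIV (range atMost)"
      by (simp add: borel_eq_atMost)
    show "(\<Union>i. {..real i}) = UNIV" by (auto simp: real_arch_simple)
    show "emeasure (distr M borel f) {..real i} \<noteq> \<infinity>" for i
      unfolding emM by auto
  qed (auto simp: emM emD simp del: One_nat_def)
  then have "(\<integral>\<^sup>+x. g x \<partial>distr M borel f) = (\<integral>\<^sup>+x. g x \<partial>?D)" by simp
  then show ?thesis by (simp add: nn_integral_distr nn_integral_density)
qed


text \<open>With \<open>t = (x, x')\<close> and \<open>x = t \<bullet> b\<close>, the slope \<open>y = x / |x'|\<close> replaces the usual cosine
  \<open>y / sqrt (1 + y\<^sup>2)\<close>: only linear substitutions occur, and the weight has no endpoint
  singularity, not even in dimension 2.\<close>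
lemma nn_integral_coordinate_norm_Basis:
  fixes b :: "'a::euclidean_space" and h :: "real \<times> real \<Rightarrow> ennreal"
  assumes b: "b \<in> Basis" and n: "DIM('a) \<ge> 2"
    and h[measurable]: "h \<in> borel_measurable borel"
  defines "K \<equiv> unit_ball_vol (real (DIM('a) - 1)) * real (DIM('a) - 1)"
  shows "(\<integral>\<^sup>+t. h (t \<bullet> b, norm (t::'a)) \<partial>lborel) =
    (\<integral>\<^sup>+y. (\<integral>\<^sup>+r. ennreal (K * r ^ (DIM('a) - 1) / jb y ^ DIM('a)) * indicator {0<..} r
        * h (r * (y / jb y), r) \<partial>lborel) \<partial>lborel)"
proof -
  interpret product_sigma_finite "\<lambda>_::'a. lborel :: real measure" ..
  define B where "B = (Basis - {b} :: 'a set)"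
  have B: "finite B" "b \<notin> B" "Basis = insert b B" "card B = DIM('a) - 1"
    using b by (auto simp: B_def)
  let ?n = "DIM('a)"
  obtain m where m: "?n = Suc (Suc m)" using le_Suc_ex[OF n] by auto
  let ?F = "\<lambda>x s. ennreal (K * s ^ m) * indicator {0<..} s * h (x, sqrt (x\<^sup>2 + s\<^sup>2))"
  let ?G = "\<lambda>s y. ennreal (K * s ^ Suc m) * indicator {0<..} s * h (s * y, s * jb y)"
  let ?R = "\<lambda>y r. ennreal (K * r ^ (?n - 1) / jb y ^ ?n) * indicator {0<..} r
        * h (r * (y / jb y), r)"
  have K: "K \<ge> 0" by (simp add: K_def)
  have "(\<integral>\<^sup>+t. h (t \<bullet> b, norm (t::'a)) \<partial>lborel)
      = (\<integral>\<^sup>+f. h (f b, sqrt (\<Sum>c\<in>Basis. (f c)\<^sup>2)) \<partial>(Pi\<^sub>M Basis (\<lambda>_. lborel)))"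
  proof -
    have *: "(\<Sum>c\<in>Basis. f c *\<^sub>R c) \<bullet> b = f b"
      "norm (\<Sum>c\<in>Basis. f c *\<^sub>R c :: 'a) = sqrt (\<Sum>c\<in>Basis. (f c)\<^sup>2)" for f :: "'a \<Rightarrow> real"
      using b by (simp_all add: norm_eq_sqrt_inner power2_eq_square
          euclidean_inner[of "\<Sum>c\<in>Basis. f c *\<^sub>R c" "\<Sum>c\<in>Basis. f c *\<^sub>R c"])
    show ?thesis
      unfolding lborel_def[where 'a='a]
      by (subst nn_integral_distr) (simp_all add: * lborel_eq_real)
  qed
  also have "\<dots> = (\<integral>\<^sup>+x. (\<integral>\<^sup>+f. h (x, sqrt (x\<^sup>2 + (sqrt (\<Sum>c\<in>B. (f c)\<^sup>2))\<^sup>2)) \<partial>(Pi\<^sub>M B (\<lambda>_. lborel))) \<partial>lborel)"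
  proof -
    have "(\<integral>\<^sup>+f. h (f b, sqrt (\<Sum>c\<in>Basis. (f c)\<^sup>2)) \<partial>(Pi\<^sub>M Basis (\<lambda>_. lborel)))
       = (\<integral>\<^sup>+f. h (f b, sqrt ((f b)\<^sup>2 + (\<Sum>c\<in>B. (f c)\<^sup>2))) \<partial>(Pi\<^sub>M (insert b B) (\<lambda>_. lborel)))"
      by (simp add: B(1,2) B(3))
    also have "\<dots> = (\<integral>\<^sup>+x. (\<integral>\<^sup>+f. h ((f(b := x)) b, sqrt (((f(b := x)) b)\<^sup>2 + (\<Sum>c\<in>B. ((f(b := x)) c)\<^sup>2)))
        \<partial>(Pi\<^sub>M B (\<lambda>_. lborel))) \<partial>lborel)"
      using B(1,2) by (rule product_nn_integral_insert_rev) measurable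
    also have "\<dots> = (\<integral>\<^sup>+x. (\<integral>\<^sup>+f. h (x, sqrt (x\<^sup>2 + (sqrt (\<Sum>c\<in>B. (f c)\<^sup>2))\<^sup>2)) \<partial>(Pi\<^sub>M B (\<lambda>_. lborel))) \<partial>lborel)"
    proof (intro nn_integral_cong)
      fix x :: real and f :: "'a \<Rightarrow> real"
      have "(\<Sum>c\<in>B. ((f(b := x)) c)\<^sup>2) = (\<Sum>c\<in>B. (f c)\<^sup>2)"
        using B(2) by (intro sum.cong) auto
      then show "h ((f(b := x)) b, sqrt (((f(b := x)) b)\<^sup>2 + (\<Sum>c\<in>B. ((f(b := x)) c)\<^sup>2)))
          = h (x, sqrt (x\<^sup>2 + (sqrt (\<Sum>c\<in>B. (f c)\<^sup>2))\<^sup>2))"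
        by (simp add: sum_nonneg)
    qed
    finally show ?thesis .
  qed
  also have "\<dots> = (\<integral>\<^sup>+x. (\<integral>\<^sup>+s. ?F x s \<partial>lborel) \<partial>lborel)"
  proof (intro nn_integral_cong)
    fix x :: real
    show "(\<integral>\<^sup>+f. h (x, sqrt (x\<^sup>2 + (sqrt (\<Sum>c\<in>B. (f c)\<^sup>2))\<^sup>2)) \<partial>(Pi\<^sub>M B (\<lambda>_. lborel)))
      = (\<integral>\<^sup>+s. ?F x s \<partial>lborel)"
    proof (subst nn_integral_radial[where d="card B" and c="unit_ball_vol (real (card B))"
          and f="\<lambda>f. sqrt (\<Sum>c\<in>B. (f c)\<^sup>2)" and g="\<lambda>s. h (x, sqrt (x\<^sup>2 + s\<^sup>2))"])
      fix r :: real assume "r > 0"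
      show "emeasure (Pi\<^sub>M B (\<lambda>_. lborel)) {f \<in> space (Pi\<^sub>M B (\<lambda>_. lborel)). sqrt (\<Sum>c\<in>B. (f c)\<^sup>2) \<le> r} =
        ennreal (unit_ball_vol (real (card B)) * r ^ card B)"
        using emeasure_cball_aux[OF B(1) \<open>r > 0\<close>]
        by (simp add: Int_def conj_commute)
    qed (use B(4) m in \<open>auto simp: sum_nonneg K_def intro!: nn_integral_cong\<close>)
  qed
  also have "\<dots> = (\<integral>\<^sup>+s. (\<integral>\<^sup>+x. ?F x s \<partial>lborel) \<partial>lborel)"
    by (rule lborel_pair.Fubini') measurable
  \<comment> \<open>Substitution \<open>x = s * y\<close> at fixed \<open>s\<close>; its Jacobian
    raises \<open>s ^ m\<close> to \<open>s ^ Suc m\<close>.\<close>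
  also have "\<dots> = (\<integral>\<^sup>+s. (\<integral>\<^sup>+y. ?G s y \<partial>lborel) \<partial>lborel)"
  proof (rule nn_integral_cong)
    fix s :: real
    show "(\<integral>\<^sup>+x. ?F x s \<partial>lborel) =
       (\<integral>\<^sup>+y. ?G s y \<partial>lborel)"
    proof (cases "s > 0")
      case True
      have sq: "sqrt ((s * y)\<^sup>2 + s\<^sup>2) = s * jb y" for y
      proof -
        have "(s * y)\<^sup>2 + s\<^sup>2 = s\<^sup>2 * (1 + y\<^sup>2)" by (simp add: power2_eq_square algebra_simps)
        then show ?thesis using True by (simp add: real_sqrt_mult)
      qed
      have "(\<integral>\<^sup>+x. ?F x s \<partial>lborel)
        = ennreal s * (\<integral>\<^sup>+y. ennreal (K * s ^ m) * indicator {0<..} s * h (s * y, s * jb y) \<partial>lborel)"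
        using True by (subst nn_integral_real_affine[where c=s and t=0]) (auto simp: sq)
      also have "\<dots> = (\<integral>\<^sup>+y. ennreal s * (ennreal (K * s ^ m) * indicator {0<..} s * h (s * y, s * jb y)) \<partial>lborel)"
        by (rule nn_integral_cmult[symmetric]) measurable
      also have "\<dots> = (\<integral>\<^sup>+y. ?G s y \<partial>lborel)"
        using True K by (intro nn_integral_cong) (auto simp: ennreal_mult' mult_ac)
      finally show ?thesis .
    qed simp
  qed
  also have "\<dots> = (\<integral>\<^sup>+y. (\<integral>\<^sup>+s. ?G s y \<partial>lborel) \<partial>lborel)"
    by (rule lborel_pair.Fubini') measurable
  \<comment> \<open>Substitution \<open>s = r / jb y\<close> at fixed \<open>y\<close>, so that
    \<open>r\<close> becomes the full norm.\<close>
  also have "\<dots> = (\<integral>\<^sup>+y. (\<integral>\<^sup>+r. ?R y r \<partial>lborel) \<partial>lborel)"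
  proof (rule nn_integral_cong)
    fix y :: real
    define w where "w = jb y"
    let ?W = "\<lambda>r. ennreal (K * (1 / w * r) ^ Suc m) * indicator {0<..} (1 / w * r) * h (1 / w * r * y, 1 / w * r * w)"
    have w: "w > 0" unfolding w_def using zero_le_power2[of y] by (simp add: add_pos_nonneg)
    have "(\<integral>\<^sup>+s. ennreal (K * s ^ Suc m) * indicator {0<..} s * h (s * y, s * w) \<partial>lborel)
      = ennreal (1 / w) * (\<integral>\<^sup>+r. ?W r \<partial>lborel)"
      using w by (subst nn_integral_real_affine[where c="1 / w" and t=0]) auto
    also have "\<dots> = (\<integral>\<^sup>+r. ennreal (1 / w) * (?W r) \<partial>lborel)"
      by (rule nn_integral_cmult[symmetric]) measurable
    also have "\<dots> = (\<integral>\<^sup>+r. ennreal (K * r ^ (?n - 1) / w ^ ?n) * indicator {0<..} r * h (r * (y / w), r) \<partial>lborel)"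
    proof (intro nn_integral_cong)
      fix r :: real
      have "ennreal (1 / w) * ennreal (K * (1 / w * r) ^ Suc m) = ennreal (K * r ^ (?n - 1) / w ^ ?n)"
        if "r > 0"
        using w K that by (simp add: ennreal_mult'[symmetric] m power_divide)
      moreover have "1 / w * r * w = r" "1 / w * r * y = r * (y / w)" using w by auto
      moreover have "indicator {0<..} (1 / w * r) = (indicator {0<..} r :: ennreal)"
        using w by (auto simp: indicator_def zero_less_divide_iff)
      ultimately show "ennreal (1 / w) * (?W r)
        = ennreal (K * r ^ (?n - 1) / w ^ ?n) * indicator {0<..} r * h (r * (y / w), r)"
        by (cases "r > 0") (simp_all add: mult.assoc[symmetric])
    qed
    finally show "(\<integral>\<^sup>+s. ?G s y \<partial>lborel) =
      (\<integral>\<^sup>+r. ?R y r \<partial>lborel)"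
      by (simp only: w_def)
  qed
  finally show ?thesis .
qed


text \<open>The surface area of the unit sphere of R^(n-1), in which the directions orthogonal to
  the frequency vary.\<close>

definition slice_const :: "nat \<Rightarrow> real"
  where "slice_const n = unit_ball_vol (real (n - 1)) * real (n - 1)"

lemma slice_const_pos: "n \<ge> 2 \<Longrightarrow> slice_const n > 0"
  by (simp add: slice_const_def)

text \<open>An orthogonal map that carries a multiple of a basis vector to \<open>\<xi>\<close>
  preserves Lebesgue measure and \<open>norm t\<close>, which reduces the claim to a coordinate
  direction.\<close>

lemma nn_integral_inner_norm:
  fixes \<xi> :: "real ^ 'n" and h :: "real \<times> real \<Rightarrow> ennreal"
  assumes n: "CARD('n) \<ge> 2" and h[measurable]: "h \<in> borel_measurable borel"
  shows "(\<integral>\<^sup>+t. h (\<xi> \<bullet> t, norm t) \<partial>lborel) =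
    (\<integral>\<^sup>+y. (\<integral>\<^sup>+r. ennreal (slice_const CARD('n) * r ^ (CARD('n) - 1) / jb y ^ CARD('n)) * indicator {0<..} r
        * h (norm \<xi> * (r * (y / jb y)), r) \<partial>lborel) \<partial>lborel)"
proof -
  obtain b :: "real ^ 'n" where b: "b \<in> Basis" using nonempty_Basis by blast
  obtain T where T: "orthogonal_transformation T" "T (norm \<xi> *\<^sub>R b) = \<xi>"
    using orthogonal_transformation_exists[of "norm \<xi> *\<^sub>R b" \<xi>] b by auto
  have lin: "linear T" using T by (simp add: orthogonal_transformation_linear)
  have [measurable]: "T \<in> borel_measurable borel"
    by (intro borel_measurable_continuous_onI linear_continuous_on linear_conv_bounded_linear[THEN iffD1] lin)
  have [measurable]: "h \<in> borel_measurable (borel \<Otimes>\<^sub>M borel)" using h unfolding borel_prod .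
  have in_T: "\<xi> \<bullet> T t = norm \<xi> * (t \<bullet> b)" for t
  proof -
    have "\<xi> \<bullet> T t = T (norm \<xi> *\<^sub>R b) \<bullet> T t" using T(2) by simp
    also have "\<dots> = (norm \<xi> *\<^sub>R b) \<bullet> t" using T(1) by (simp add: orthogonal_transformation_def del: inner_scaleR_left)
    finally show ?thesis by (simp add: inner_commute)
  qed
  have "(\<integral>\<^sup>+t. h (\<xi> \<bullet> t, norm t) \<partial>lborel) = (\<integral>\<^sup>+t. h (\<xi> \<bullet> t, norm t) \<partial>distr lborel borel T)"
    by (simp add: distr_lborel_orthogonal_transformation[OF T(1)])
  also have "\<dots> = (\<integral>\<^sup>+t. h (norm \<xi> * (t \<bullet> b), norm t) \<partial>lborel)"
    by (subst nn_integral_distr) (auto simp: in_T orthogonal_transformation_norm[OF T(1)])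
  also have "\<dots> = (\<integral>\<^sup>+t. (\<lambda>(x, r). h (norm \<xi> * x, r)) (t \<bullet> b, norm t) \<partial>lborel)"
    by simp
  also have "\<dots> = (\<integral>\<^sup>+y. (\<integral>\<^sup>+r. ennreal (slice_const CARD('n) * r ^ (CARD('n) - 1) / jb y ^ CARD('n)) * indicator {0<..} r
        * (\<lambda>(x, r). h (norm \<xi> * x, r)) (r * (y / jb y), r) \<partial>lborel) \<partial>lborel)"
    using n by (subst nn_integral_coordinate_norm_Basis[OF b]) (auto simp: slice_const_def borel_prod[symmetric])
  finally show ?thesis by simp
qed

definition slice_density :: "nat \<Rightarrow> real \<times> real \<Rightarrow> real"
  where "slice_density n = (\<lambda>(y, r). indicator {0<..} r * slice_const n * r ^ (n - 1) / jb y ^ n)"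

lemma measurable_slice_density[measurable]: "slice_density n \<in> borel_measurable lborel2"
  unfolding slice_density_def by measurable

lemma slice_density_nonneg: "n \<ge> 2 \<Longrightarrow> slice_density n z \<ge> 0"
  using slice_const_pos[of n] by (auto simp: slice_density_def indicator_def split: prod.split)

text \<open>The formula for nonnegative integrands, tested on indicators. As an identity of image
  measures it also transports complex integrands.\<close>

lemma distr_inner_norm:
  fixes \<xi> :: "real ^ 'n"
  assumes n: "CARD('n) \<ge> 2"
  shows "distr lborel borel (\<lambda>t. (\<xi> \<bullet> t, norm t)) =
    distr (density lborel2 (\<lambda>z. ennreal (slice_density CARD('n) z))) borel
      (slice_map (norm \<xi>))"
proof (rule measure_eqI)
  fix A assume "A \<in> sets (distr lborel borel (\<lambda>t. (\<xi> \<bullet> t, norm t)))"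
  then have A: "A \<in> sets borel" by simp
  then have [measurable]: "A \<in> sets (borel \<Otimes>\<^sub>M borel)" unfolding borel_prod .
  have "emeasure (distr lborel borel (\<lambda>t. (\<xi> \<bullet> t, norm t))) A = (\<integral>\<^sup>+t. indicator A (\<xi> \<bullet> t, norm t) \<partial>lborel)"
    using A by (subst nn_integral_indicator[symmetric], simp, subst nn_integral_distr) (simp_all add: borel_prod[symmetric])
  also have "\<dots> = (\<integral>\<^sup>+y. (\<integral>\<^sup>+r. ennreal (slice_density CARD('n) (y, r)) *
      indicator A (norm \<xi> * (r * (y / jb y)), r) \<partial>lborel) \<partial>lborel)"
    using n A by (subst nn_integral_inner_norm) (auto simp: slice_density_def indicator_def intro!: nn_integral_cong)
  also have "\<dots> = (\<integral>\<^sup>+z. ennreal (slice_density CARD('n) z) *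
      indicator A ((slice_map (norm \<xi>)) z) \<partial>lborel2)"
    by (subst lborel.nn_integral_fst[symmetric]) (simp_all add: borel_prod[symmetric])
  also have "\<dots> = emeasure (distr (density lborel2 (\<lambda>z. ennreal (slice_density CARD('n) z))) borel
      (slice_map (norm \<xi>))) A"
    using A by (subst nn_integral_indicator[symmetric], simp, subst nn_integral_distr)
       (simp_all add: nn_integral_density borel_prod[symmetric])
  finally show "emeasure (distr lborel borel (\<lambda>t. (\<xi> \<bullet> t, norm t))) A = \<dots>" .
qed simp

section \<open>The transform as an integral over slopes and radii\<close>

lemma exp_minus_2pi_eq_cis: "exp (- (2 * of_real pi * \<i> * of_real x)) = wave x"
  by (simp add: cis_conv_exp algebra_simps)

text \<open>The phase times the Jacobian \<open>r ^ (n - 1) / jb y ^ n\<close>, with the constant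
  \<open>sqrt 2 * slice_const n\<close> kept outside. The interval \<open>{0..1}\<close> is the
  truncation of the cone.\<close>

definition cone_kernel :: "nat \<Rightarrow> real \<Rightarrow> real \<Rightarrow> real \<times> real \<Rightarrow> complex"
  where "cone_kernel n \<rho> \<tau> = (\<lambda>(y, r). (indicator {0..1} r * r ^ (n - 1) / jb y ^ n) *\<^sub>R
     wave (r * (\<rho> * (y / jb y) + \<tau>)))"

lemma measurable_cone_kernel[measurable]: "cone_kernel n \<rho> \<tau> \<in> borel_measurable lborel2"
  unfolding cone_kernel_def cis_conv_exp by measurable

lemma integrable_one_div_one_plus_square: "integrable lborel (\<lambda>y::real. 1 / (1 + y\<^sup>2))"
proof (rule integrableI_nonneg)
  let ?f = "\<lambda>y::real. ennreal (1 / (1 + y\<^sup>2)) * indicator {0..} y"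
  have fin: "(\<integral>\<^sup>+y. ?f y \<partial>lborel) = ennreal (pi / 2 - arctan 0)"
  proof (rule nn_integral_FTC_atLeast[where F=arctan])
    show "(arctan has_real_derivative 1 / (1 + x\<^sup>2)) (at x)" for x
      using DERIV_arctan[of x] by (simp add: divide_inverse)
    show "0 \<le> 1 / (1 + x\<^sup>2)" for x :: real by (simp add: add_nonneg_nonneg)
  qed (auto intro: tendsto_arctan_at_top)
  \<comment> \<open>Each half-line is covered by \<open>?f\<close> or by its reflection, and
    reflection preserves the integral.\<close>
  have "(\<integral>\<^sup>+y. ennreal (1 / (1 + y\<^sup>2)) \<partial>lborel) \<le> (\<integral>\<^sup>+y. ?f y + ?f (0 - y) \<partial>lborel)"
    by (intro nn_integral_mono) (auto simp: indicator_def)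
  also have "\<dots> = (\<integral>\<^sup>+y. ?f y \<partial>lborel) + (\<integral>\<^sup>+y. ?f (0 - y) \<partial>lborel)"
    by (rule nn_integral_add) auto
  also have "(\<integral>\<^sup>+y. ?f (0 - y) \<partial>lborel) = (\<integral>\<^sup>+y. ?f y \<partial>lborel)"
    by (rule nn_integral_lborel_reflect) measurable
  finally show "(\<integral>\<^sup>+y. ennreal (1 / (1 + y\<^sup>2)) \<partial>lborel) < \<infinity>"
    unfolding fin by (auto simp: top_unique less_top[symmetric] ennreal_plus[symmetric] simp del: ennreal_plus)
qed (auto simp: add_nonneg_nonneg)

lemma integrable_inverse_sqrt_power:
  assumes "n \<ge> 2"
  shows "integrable lborel (\<lambda>y::real. 1 / jb y ^ n)"
proof (rule Bochner_Integration.integrable_bound)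
  show "integrable lborel (\<lambda>y::real. 1 / (1 + y\<^sup>2))"
    by (rule integrable_one_div_one_plus_square)
  show "AE y::real in lborel. norm (1 / jb y ^ n) \<le> norm (1 / (1 + y\<^sup>2))"
  proof (rule AE_I2)
    fix y :: real
    have "(1 + y\<^sup>2) = jb y ^ 2" by (simp add: add_nonneg_nonneg)
    also have "\<dots> \<le> jb y ^ n" using assms by (intro power_increasing) auto
    finally show "norm (1 / jb y ^ n) \<le> norm (1 / (1 + y\<^sup>2))"
      using zero_le_power2[of y]
      by (auto simp: abs_mult add_nonneg_nonneg intro!: divide_left_mono mult_pos_pos add_pos_nonneg zero_less_power)
  qed
qed measurable

lemma integrable_cone_kernel:
  assumes "n \<ge> 2"
  shows "integrable lborel2 (cone_kernel n \<rho> \<tau>)"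
proof (rule Bochner_Integration.integrable_bound)
  show "integrable lborel2 (\<lambda>(y::real, r::real). 1 / jb y ^ n * indicator {0..1} r)"
    using integrable_inverse_sqrt_power[OF assms] by (intro lborel_pair.Fubini_integrable) (auto simp: abs_mult)
  show "AE z in lborel2. norm (cone_kernel n \<rho> \<tau> z) \<le> norm ((\<lambda>(y::real, r::real). 1 / jb y ^ n * indicator {0..1} r :: real) z)"
    by (rule AE_I2) (auto simp: cone_kernel_def indicator_def abs_mult power_le_one intro!: divide_right_mono)
qed measurable

text \<open>The integrand sees \<open>t\<close> only through \<open>\<xi> \<bullet> t\<close> and
  \<open>norm t\<close>, so the joint image measure of this pair determines the transform. The
  factor \<open>sqrt 2\<close> is the area element of the cone.\<close>

lemma measure_fourier_cone_eq:
  fixes \<xi> :: "real ^ 'n"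
  assumes n: "CARD('n) \<ge> 2"
  shows "measure_fourier cone_measure (\<xi>, \<tau>) =
    of_real (sqrt 2 * slice_const CARD('n)) *
    (LINT z|lborel2. cone_kernel CARD('n) (norm \<xi>) \<tau> z)"
proof -
  let ?f = "\<lambda>(x, r). (sqrt 2 * indicator {..1} r) *\<^sub>R wave (x + \<tau> * r) :: complex"
  have "measure_fourier cone_measure (\<xi>, \<tau>) =
    (LINT t|density lborel (\<lambda>t::real^'n. ennreal (sqrt 2) * indicator (cball 0 1) t). wave (\<xi> \<bullet> t + \<tau> * norm t))"
    unfolding measure_fourier_def cone_measure_eq exp_minus_2pi_eq_cis
    by (subst integral_distr)
       (auto simp: cis_conv_exp intro!: borel_measurable_continuous_onI continuous_intros)
  also have "(\<lambda>t::real^'n. ennreal (sqrt 2) * indicator (cball 0 1) t) = (\<lambda>t. ennreal (sqrt 2 * indicator (cball 0 1) t))"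
    by (auto simp: indicator_def)
  also have "(LINT t|density lborel (\<lambda>t::real^'n. ennreal (sqrt 2 * indicator (cball 0 1) t)). wave (\<xi> \<bullet> t + \<tau> * norm t))
    = (LINT t|lborel. (sqrt 2 * indicator (cball 0 1) t) *\<^sub>R wave (\<xi> \<bullet> t + \<tau> * norm t))"
    by (subst integral_density)
       (auto simp: cis_conv_exp intro!: borel_measurable_times borel_measurable_indicator)
  also have "\<dots> = (LINT t|lborel. ?f (\<xi> \<bullet> t, norm t))"
    by (intro Bochner_Integration.integral_cong) (auto simp: indicator_def)
  also have "\<dots> = (LINT z|distr lborel borel (\<lambda>t. (\<xi> \<bullet> t, norm t)). ?f z)"
    by (subst integral_distr) (auto simp: cis_conv_exp borel_prod[symmetric])
  also have "\<dots> = (LINT z|density lborel2 (\<lambda>z. ennreal (slice_density CARD('n) z)).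
      ?f ((slice_map (norm \<xi>)) z))"
    unfolding distr_inner_norm[OF n]
    by (subst integral_distr) (auto simp: cis_conv_exp borel_prod[symmetric])
  also have "\<dots> = (LINT z|lborel2. slice_density CARD('n) z *\<^sub>R
      ?f ((slice_map (norm \<xi>)) z))"
    by (subst integral_density) (use n in \<open>auto simp: slice_density_nonneg cis_conv_exp borel_prod[symmetric]\<close>)
  also have "\<dots> = (LINT z|lborel2. of_real (sqrt 2 * slice_const CARD('n)) * cone_kernel CARD('n) (norm \<xi>) \<tau> z)"
    using n
    by (intro Bochner_Integration.integral_cong)
       (auto simp: slice_density_def cone_kernel_def indicator_def scaleR_conv_of_real algebra_simps
         minus_add_distrib[symmetric] simp del: minus_add_distrib intro!: arg_cong[where f=cis])
  finally show ?thesis by simp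
qed


section \<open>Shifting the contour of the sphere transform\<close>

lemma integrable_powr_times_exp:
  fixes a c :: real
  assumes a: "a > -1" and c: "c > 0"
  shows "integrable lborel (\<lambda>s. indicator {0<..} s * (s powr a * exp (- (c * s))))"
proof -
  let ?f = "\<lambda>s::real. indicator {0..} s * s powr a / exp s"
  have "integrable lborel ?f"
  proof (rule integrableI_nonneg)
    show "(\<integral>\<^sup>+s. ennreal (?f s) \<partial>lborel) < \<infinity>"
      using Gamma_conv_nn_integral_real[of "a + 1"] a ennreal_less_top[of "Gamma (a + 1)"] by simp
  qed auto
  then have "integrable lborel (\<lambda>s. ?f (0 + c * s))"
    using c by (intro lborel_integrable_real_affine) auto
  then have "integrable lborel (\<lambda>s. c powr (- a) * ?f (0 + c * s))" by (rule integrable_mult_right)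
  also have "(\<lambda>s. c powr (- a) * ?f (0 + c * s)) = (\<lambda>s. indicator {0<..} s * (s powr a * exp (- (c * s))))"
    using c by (auto simp: indicator_def powr_mult powr_minus exp_minus field_simps zero_le_mult_iff)
  finally show ?thesis .
qed

text \<open>A single term of the exponential series.\<close>

lemma power_le_fact_mult_exp:
  fixes x :: real
  assumes "x \<ge> 0"
  shows "x ^ N \<le> fact N * exp x"
proof -
  have s: "(\<lambda>n. x ^ n /\<^sub>R fact n) sums exp x" by (rule exp_converges)
  have "(\<Sum>n\<in>{N}. x ^ n /\<^sub>R fact n) \<le> exp x"
    using s assms by (subst sums_unique[OF s]) (intro sum_le_suminf, auto simp: sums_iff)
  then show ?thesis by (simp add: field_simps)
qed

lemma power_le_const_mult_exp:
  fixes c b :: real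
  assumes c: "c > 0" and b: "b \<ge> 0"
  obtains C where "C > 0" "\<And>s. s \<ge> 0 \<Longrightarrow> (b + s) ^ N \<le> C * exp (c * s)"
proof
  show "fact N * exp (c * b) / c ^ N > 0" using c by simp
  fix s :: real assume s: "s \<ge> 0"
  have "(c * (b + s)) ^ N \<le> fact N * exp (c * (b + s))"
    using c b s by (intro power_le_fact_mult_exp) auto
  then show "(b + s) ^ N \<le> fact N * exp (c * b) / c ^ N * exp (c * s)"
    using c by (simp only: power_mult_distrib) (simp add: distrib_left exp_add field_simps)
qed

text \<open>A negative exponent is controlled by the lower bound \<open>a\<close>, a nonnegative one
  by the upper bound \<open>b\<close>. Adding the two bounds lets later estimates treat
  \<open>n = 2\<close> and \<open>n \<ge> 3\<close> together.\<close>

lemma powr_between_le: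
  fixes t k a b :: real and N :: nat
  assumes t: "a \<le> t" "t \<le> b" and a: "0 < a" and b: "1 \<le> b" and k: "- (1/2) \<le> k" "k \<le> real N" "k < 0 \<Longrightarrow> k = -(1/2)"
  shows "t powr k \<le> a powr (-(1/2)) + b ^ N"
proof (cases "k < 0")
  case True
  then have "t powr k \<le> a powr k" using t a by (intro powr_mono2') auto
  with True k show ?thesis using b by (simp add: add_increasing2)
next
  case False
  have "t powr k \<le> b powr k" using False t a by (intro powr_mono2) auto
  also have "\<dots> \<le> b powr real N" using b k by (intro powr_mono) auto
  also have "\<dots> = b ^ N" using b by (intro powr_realpow) auto
  finally show ?thesis by (simp add: add_increasing)
qed

text \<open>The real part of 1 - z^2 is 1 - (Re z)^2 + (Im z)^2 > 0, so the principal power is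
  holomorphic on the strip.\<close>

lemma one_minus_square_strip:
  fixes z :: complex
  assumes "\<bar>Re z\<bar> < 1"
  shows "1 - z\<^sup>2 \<notin> \<real>\<^sub>\<le>\<^sub>0"
proof -
  have "(Re z)\<^sup>2 < 1" using assms by (simp add: abs_square_less_1)
  then have "Re (1 - z\<^sup>2) > 0" using zero_le_power2[of "Im z"] unfolding minus_complex.sel Re_power2 one_complex.sel by linarith
  then show ?thesis by (auto simp: complex_nonpos_Reals_iff)
qed

text \<open>The modulus is the product of the distances of the point to 1 and to -1. Uniformity in
  \<open>a\<close> up to the endpoints lets one majorant serve while the vertical sides move to 1
  and -1.\<close>

lemma norm_one_minus_square_bounds:
  fixes a s :: real
  assumes a: "\<bar>a\<bar> \<le> 1" and s: "0 \<le> s"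
  shows "s \<le> cmod (1 - (of_real a - \<i> * of_real s)\<^sup>2)"
    and "cmod (1 - (of_real a - \<i> * of_real s)\<^sup>2) \<le> 2 + s\<^sup>2"
proof -
  let ?z = "of_real a - \<i> * of_real s :: complex"
  have a2: "a\<^sup>2 \<le> 1" using a by (simp add: abs_square_le_1)
  have n1: "(cmod (1 - ?z))\<^sup>2 = (1 - a)\<^sup>2 + s\<^sup>2" and n2: "(cmod (1 + ?z))\<^sup>2 = (1 + a)\<^sup>2 + s\<^sup>2"
    and nz: "(cmod ?z)\<^sup>2 = a\<^sup>2 + s\<^sup>2"
    by (simp_all add: cmod_power2)
  have "(cmod (1 - ?z\<^sup>2))\<^sup>2 = ((1 - a)\<^sup>2 + s\<^sup>2) * ((1 + a)\<^sup>2 + s\<^sup>2)"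
    unfolding n1[symmetric] n2[symmetric] norm_mult[symmetric] power_mult_distrib[symmetric]
    by (simp add: algebra_simps power2_eq_square)
  also have "\<dots> = (1 - a\<^sup>2)\<^sup>2 + 2 * s\<^sup>2 * (1 + a\<^sup>2) + s\<^sup>2 * s\<^sup>2"
    by (simp add: power2_eq_square algebra_simps)
  also have "\<dots> \<ge> s\<^sup>2"
  proof -
    have "0 \<le> (1 - a\<^sup>2)\<^sup>2" "0 \<le> s\<^sup>2 * a\<^sup>2" "0 \<le> s\<^sup>2 * s\<^sup>2" "0 \<le> s\<^sup>2" by auto
    then show ?thesis by (simp add: algebra_simps)
  qed
  finally show "s \<le> cmod (1 - ?z\<^sup>2)" by (rule power2_le_imp_le) simp
  have "cmod (1 - ?z\<^sup>2) \<le> 1 + (cmod ?z)\<^sup>2"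
    by (metis norm_triangle_ineq4 norm_one norm_power)
  then show "cmod (1 - ?z\<^sup>2) \<le> 2 + s\<^sup>2" using nz a2 by linarith
qed

lemma abs_slice_map_less_1: "\<bar>y / jb y\<bar> < (1::real)"
proof -
  have "\<bar>y\<bar> = sqrt (y\<^sup>2)" by simp
  also have "\<dots> < jb y" by (subst real_sqrt_less_iff) simp
  finally have "\<bar>y\<bar> < jb y" .
  moreover have "jb y > 0" by (simp add: add_pos_nonneg)
  ultimately show ?thesis by (simp add: abs_divide divide_less_eq_1_pos)
qed

lemma has_vector_derivative_slice_map:
  "((\<lambda>y. y / jb y) has_vector_derivative 1 / jb y ^ 3) (at y within S)"
proof -
  have pos: "1 + y\<^sup>2 > 0" by (simp add: add_pos_nonneg)
  have w2: "jb y ^ 2 = 1 + y\<^sup>2" using pos by simp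
  have "((\<lambda>y. y / jb y) has_field_derivative
     (1 * jb y - y * (inverse (jb y) / 2 * (2 * y))) / (jb y * jb y)) (at y within S)"
    using pos by (auto intro!: derivative_eq_intros)
  also have "(1 * jb y - y * (inverse (jb y) / 2 * (2 * y))) / (jb y * jb y)
     = 1 / jb y ^ 3"
  proof -
    define w where "w = jb y"
    have w: "w > 0" "w ^ 2 = 1 + y ^ 2" using pos w2 by (auto simp: w_def)
    then have "y ^ 2 = w ^ 2 - 1" by simp
    then have "w - y * (inverse w / 2 * (2 * y)) = 1 / w"
      using w(1) by (simp add: field_simps power2_eq_square)
    then show ?thesis using w(1) unfolding w_def[symmetric] by (simp add: field_simps power3_eq_cube)
  qed
  finally show ?thesis by (simp add: has_real_derivative_iff_has_vector_derivative)
qed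


text \<open>The substitution \<open>v = y / sqrt (1 + y\<^sup>2)\<close> makes the left-hand side the integral of
  \<open>exp (-2 \<pi> \<i> x v) (1 - v\<^sup>2) powr ((n - 3) / 2)\<close> over \<open>-1 < v < 1\<close>. A primitive on the strip
  \<open>|Re z| < 1\<close> is evaluated around the rectangle with corners \<open>\<plusminus>\<delta>\<close> and \<open>\<plusminus>\<delta> - \<i> j\<close>, where
  \<open>\<delta> = j / sqrt (1 + j\<^sup>2)\<close>, and \<open>j\<close> tends to infinity.\<close>
lemma sphere_slice_contour:
  fixes x :: real and n :: nat
  assumes n: "n \<ge> 2" and x: "x > 0"
  defines "A \<equiv> \<i> * wave x *
    (LINT s|lborel. (indicator {0<..} s * exp (- (2 * pi * x * s))) *\<^sub>R (of_real s * (of_real s + 2 * \<i>)) powr of_real (slice_exp n))"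
  shows "(LINT y|lborel. (1 / jb y ^ n) *\<^sub>R wave (x * (y / jb y))) = A + cnj A"
proof -
  define k where "k = slice_exp n"
  have k: "- (1/2) \<le> k" "k \<le> real n" "k < 0 \<Longrightarrow> k = -(1/2)"
    using n by (auto simp: k_def)
  define f where "f z = exp (- (2 * of_real pi * \<i> * of_real x * z)) * (1 - z\<^sup>2) powr of_real k" for z :: complex
  \<comment> \<open>Besides the strip, \<open>W\<close> contains the open half-line below 1, where
    the limit of the vertical sides is taken.\<close>
  define W where "W = {z::complex. 1 - z\<^sup>2 \<notin> \<real>\<^sub>\<le>\<^sub>0}"
  define U where "U = {z::complex. \<bar>Re z\<bar> < 1}"
  have U: "open U" "convex U"
  proof -
    have eq: "U = {z. Re z < 1} \<inter> {z. Re z > -1}" by (auto simp: U_def)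
    show "open U" "convex U" unfolding eq
      by (auto intro!: open_Int open_halfspace_Re_lt open_halfspace_Re_gt convex_Int convex_halfspace_Re_lt convex_halfspace_Re_gt)
  qed
  have UW: "U \<subseteq> W" by (auto simp: U_def W_def one_minus_square_strip)
  have holW: "f holomorphic_on W"
    unfolding f_def by (intro holomorphic_intros) (auto simp: W_def)
  then have hol: "f holomorphic_on U" using UW by (rule holomorphic_on_subset)
  have contW: "continuous_on W f" using holW by (rule holomorphic_on_imp_continuous_on)
  obtain G where "\<And>z. z \<in> U \<Longrightarrow> (G has_field_derivative f z) (at z within U)"
    using holomorphic_convex_primitive'[OF U(2,1) hol] by blast
  then have G: "(G has_field_derivative f z) (at z)" if "z \<in> U" for z
    using that U(1) at_within_open by metis
  have contf: "continuous_on U f" using hol by (rule holomorphic_on_imp_continuous_on)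
  define v :: "real \<Rightarrow> real" where "v y = y / jb y" for y
  have vlt: "\<bar>v y\<bar> < 1" for y unfolding v_def by (rule abs_slice_map_less_1)
  define g where "g y = (1 / jb y ^ n) *\<^sub>R wave (x * v y)" for y :: real
  \<comment> \<open>\<open>1 - (v y)^2\<close> is \<open>jb y\<close> to the power -2, so its power
    \<open>k\<close> is \<open>jb y\<close> to the power 3 - n; the derivative of \<open>v\<close>
    supplies the remaining -3.\<close>
  have fv: "(1 / jb y ^ 3) *\<^sub>R f (of_real (v y)) = g y" for y
  proof -
    define w where "w = jb y"
    have pos: "1 + y\<^sup>2 > 0" by (simp add: add_pos_nonneg)
    have w: "w > 0" "w ^ 2 = 1 + y ^ 2" using pos by (auto simp: w_def)
    have v2: "1 - (v y)\<^sup>2 = w powr (-2)"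
    proof -
      have "1 - (v y)\<^sup>2 = 1 - y ^ 2 / w ^ 2" by (simp add: v_def w_def power_divide)
      also have "\<dots> = (w ^ 2 - y ^ 2) / w ^ 2" using w(1) by (simp add: diff_divide_distrib)
      also have "\<dots> = 1 / w ^ 2" unfolding w(2) by simp
      also have "\<dots> = w powr (-2)" using w by (simp add: powr_minus divide_inverse)
      finally show ?thesis .
    qed
    have "1 - (of_real (v y))\<^sup>2 = (of_real (w powr (-2)) :: complex)"
      unfolding v2[symmetric] by simp
    then have "(1 - (of_real (v y))\<^sup>2) powr of_real k = (of_real ((w powr (-2)) powr k) :: complex)"
      by (simp only: powr_of_real[OF powr_ge_zero])
    also have "(w powr (-2)) powr k = w powr (3 - real n)"
      unfolding powr_powr by (rule arg_cong[where f="\<lambda>e. w powr e"]) (simp add: k_def field_simps)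
    also have "\<dots> = w ^ 3 / w ^ n"
      using w by (simp add: powr_diff powr_realpow)
    finally show ?thesis
      using w(1) unfolding f_def g_def w_def[symmetric]
      by (simp add: cis_conv_exp scaleR_conv_of_real mult_ac)
  qed
  define \<delta> :: "nat \<Rightarrow> real" where "\<delta> j = v (real j)" for j
  have \<delta>: "0 \<le> \<delta> j" "\<bar>\<delta> j\<bar> < 1" for j using vlt[of "real j"] by (auto simp: \<delta>_def v_def)
  \<comment> \<open>A majorant for \<open>f\<close> on every vertical side, independent of its
    abscissa. The first summand covers the exponent -1/2, the second the nonnegative
    exponents.\<close>
  define D where "D s = indicator {0<..} s * (exp (- (2 * pi * x * s)) * (s powr (-(1/2)) + (2 + s\<^sup>2) ^ n))" for s :: real
  have nf: "cmod (f (of_real a - \<i> * of_real s)) \<le> exp (- (2 * pi * x * s)) * (s powr (-(1/2)) + (2 + s\<^sup>2) ^ n)"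
    if "\<bar>a\<bar> \<le> 1" "s > 0" for a s :: real
  proof -
    have "cmod (f (of_real a - \<i> * of_real s)) =
      exp (- (2 * pi * x * s)) * cmod (1 - (of_real a - \<i> * of_real s)\<^sup>2) powr k"
      by (simp add: f_def norm_mult norm_powr_real_powr' norm_exp_eq_Re mult_ac)
    also have "cmod (1 - (of_real a - \<i> * of_real s)\<^sup>2) powr k \<le> s powr (-(1/2)) + (2 + s\<^sup>2) ^ n"
      using norm_one_minus_square_bounds[of a s] that k
      by (intro powr_between_le) auto
    finally show ?thesis by (simp add: mult_left_mono)
  qed
  obtain C where C: "C > 0" "\<And>s. s \<ge> 0 \<Longrightarrow> (2 + s) ^ (2 * n) \<le> C * exp (pi * x * s)"
    using power_le_const_mult_exp[of "pi * x" 2 "2 * n"] x by auto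
  \<comment> \<open>Half of the exponential decay absorbs the polynomial.\<close>
  have polyexp: "exp (- (2 * pi * x * s)) * (2 + s\<^sup>2) ^ n \<le> C * exp (- (pi * x * s))" if "s \<ge> 0" for s
  proof -
    have "(2 + s\<^sup>2) ^ n \<le> ((2 + s)\<^sup>2) ^ n"
      using that by (intro power_mono) (auto simp: power2_eq_square algebra_simps)
    also have "\<dots> = (2 + s) ^ (2 * n)" by (simp add: power_mult)
    also have "\<dots> \<le> C * exp (pi * x * s)" using C that by auto
    finally have "exp (- (2 * pi * x * s)) * (2 + s\<^sup>2) ^ n \<le> exp (- (2 * pi * x * s)) * (C * exp (pi * x * s))"
      by (rule mult_left_mono) simp
    also have "\<dots> = C * exp (- (pi * x * s))"
      by (simp add: exp_add[symmetric] mult_ac)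
    finally show ?thesis .
  qed
  have intD: "integrable lborel D"
  proof (rule Bochner_Integration.integrable_bound)
    show "integrable lborel (\<lambda>s. indicator {0<..} s * (s powr (-(1/2)) * exp (- ((2 * pi * x) * s)))
       + C * (indicator {0<..} s * (s powr 0 * exp (- ((pi * x) * s)))))"
      using x by (intro Bochner_Integration.integrable_add integrable_powr_times_exp integrable_mult_right) auto
    show "D \<in> borel_measurable lborel" unfolding D_def by measurable
    show "AE s in lborel. norm (D s) \<le> norm (indicator {0<..} s * (s powr (-(1/2)) * exp (- ((2 * pi * x) * s)))
       + C * (indicator {0<..} s * (s powr 0 * exp (- ((pi * x) * s)))))"
    proof (rule AE_I2)
      fix s :: real
      show "norm (D s) \<le> norm (indicator {0<..} s * (s powr (-(1/2)) * exp (- ((2 * pi * x) * s)))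
         + C * (indicator {0<..} s * (s powr 0 * exp (- ((pi * x) * s)))))"
        using polyexp[of s] C(1)
        by (cases "s > 0") (auto simp: D_def indicator_def distrib_left mult_ac abs_of_nonneg add_nonneg_nonneg)
    qed
  qed
  \<comment> \<open>\<open>?J j\<close> is the integral along the real side, in the slope variable;
    \<open>?B j\<close> is the increment of the primitive \<open>G\<close> along the bottom
    side.\<close>
  let ?J = "\<lambda>j. LINT y|lborel. indicator {- real j..real j} y *\<^sub>R g y"
  let ?B = "\<lambda>j. G (of_real (\<delta> j) - \<i> * of_real (real j)) - G (of_real (- \<delta> j) - \<i> * of_real (real j))"
  define h where "h j s = indicator {0..real j} s *\<^sub>R f (of_real (\<delta> j) - \<i> * of_real s)" for j and s :: real
  define h1 where "h1 s = indicator {0<..} s *\<^sub>R f (1 - \<i> * of_real s)" for s :: real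
  define A0 where "A0 = (LINT s|lborel. h1 s)"
  have side: "(LINT s|lborel. indicator {0..real j} s *\<^sub>R f (of_real a - \<i> * of_real s))
     = \<i> * (G (of_real a - \<i> * of_real (real j)) - G (of_real a))" if a: "\<bar>a\<bar> < 1" for a and j
  proof -
    have inU: "of_real a - \<i> * of_real s \<in> U" for s using a by (simp add: U_def)
    have "(LINT s|lborel. indicator {0..real j} s *\<^sub>R f (of_real a - \<i> * of_real s))
      = \<i> * G (of_real a - \<i> * of_real (real j)) - \<i> * G (of_real a - \<i> * of_real 0)"
    proof (rule integral_FTC_Icc)
      show "continuous_on {0..real j} (\<lambda>s. f (of_real a - \<i> * of_real s))"
        by (rule continuous_on_compose2[OF contf]) (auto intro!: continuous_intros inU)
      fix s :: real
      have "((\<lambda>z. G (of_real a - \<i> * z)) has_field_derivative f (of_real a - \<i> * of_real s) * (- \<i>)) (at (of_real s))"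
        by (rule DERIV_chain2[where f=G and g="\<lambda>z. of_real a - \<i> * z", OF G[OF inU[of s]]])
           (auto intro!: derivative_eq_intros)
      then have "((\<lambda>s. G (of_real a - \<i> * of_real s)) has_vector_derivative f (of_real a - \<i> * of_real s) * (- \<i>)) (at s)"
        by (rule has_vector_derivative_real_field)
      then have "((\<lambda>s. \<i> * G (of_real a - \<i> * of_real s)) has_vector_derivative \<i> * (f (of_real a - \<i> * of_real s) * (- \<i>))) (at s)"
        by (rule has_vector_derivative_mult_right)
      then show "((\<lambda>s. \<i> * G (of_real a - \<i> * of_real s)) has_vector_derivative f (of_real a - \<i> * of_real s)) (at s within {0..real j})"
        by (auto simp: mult_ac intro: has_vector_derivative_at_within)
    qed simp
    then show ?thesis by (simp add: algebra_simps)
  qed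
  have top: "?J j = G (of_real (\<delta> j)) - G (of_real (- \<delta> j))" for j
  proof -
    have inU: "of_real (v y) \<in> U" for y using vlt[of y] by (simp add: U_def)
    have "?J j = G (of_real (v (real j))) - G (of_real (v (- real j)))"
    proof (rule integral_FTC_Icc)
      show "continuous_on {- real j..real j} g"
        unfolding g_def v_def cis_conv_exp
        by (intro continuous_intros) (auto simp: add_nonneg_eq_0_iff)
      fix y :: real
      have "((\<lambda>y. G (of_real (v y))) has_vector_derivative (1 / jb y ^ 3) *\<^sub>R f (of_real (v y))) (at y)"
      proof -
        have 1: "((\<lambda>r. G (of_real r)) has_vector_derivative f (of_real (v y))) (at (v y))"
          by (rule has_vector_derivative_real_field) (rule G[OF inU])
        have 2: "(v has_vector_derivative 1 / jb y ^ 3) (at y)"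
          using has_vector_derivative_slice_map[of y UNIV] by (simp add: v_def[abs_def])
        show ?thesis using vector_diff_chain_at[OF 2 1] by (simp add: o_def)
      qed
      then show "((\<lambda>y. G (of_real (v y))) has_vector_derivative g y) (at y within {- real j..real j})"
        unfolding fv by (rule has_vector_derivative_at_within)
    qed simp
    also have "v (- real j) = - \<delta> j" by (simp add: v_def \<delta>_def)
    finally show ?thesis by (simp add: \<delta>_def)
  qed
  \<comment> \<open>The reflection \<open>- cnj z\<close> exchanges the two vertical sides and
    conjugates \<open>f\<close>; this is why the half-line at -1 contributes the conjugate of the
    one at 1.\<close>
  have f_neg_cnj: "f (- cnj z) = cnj (f z)" if "z \<in> U" for z
  proof -
    have "1 - z\<^sup>2 \<notin> \<real>\<^sub>\<le>\<^sub>0" using that UW by (auto simp: W_def)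
    then have "cnj ((1 - z\<^sup>2) powr of_real k) = cnj (1 - z\<^sup>2) powr cnj (of_real k)"
      by (intro cnj_powr) (auto simp: complex_nonpos_Reals_iff)
    then show ?thesis unfolding f_def by (simp add: exp_cnj)
  qed
  have fcnj: "f (of_real (- a) - \<i> * of_real s) = cnj (f (of_real a - \<i> * of_real s))" if a: "\<bar>a\<bar> < 1" for a s
  proof -
    have "of_real (- a) - \<i> * of_real s = - cnj (of_real a - \<i> * of_real s)" by simp
    moreover have "of_real a - \<i> * of_real s \<in> U" using a by (simp add: U_def)
    ultimately show ?thesis using f_neg_cnj by presburger
  qed
  \<comment> \<open>The increments of \<open>G\<close> around the rectangle sum to zero; this is
    solved for the real side.\<close>
  have eq: "?J j =
     (?B j)
      + (\<i> * (LINT s|lborel. h j s) + cnj (\<i> * (LINT s|lborel. h j s)))" for j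
  proof -
    have "cnj (LINT s|lborel. h j s) = (LINT s|lborel. indicator {0..real j} s *\<^sub>R f (of_real (- \<delta> j) - \<i> * of_real s))"
      unfolding h_def fcnj[OF \<delta>(2)]
      by (subst Bochner_Integration.integral_cnj[symmetric], rule Bochner_Integration.integral_cong) auto
    also have "\<dots> = \<i> * (G (of_real (- \<delta> j) - \<i> * of_real (real j)) - G (of_real (- \<delta> j)))"
      using \<delta>[of j] by (intro side) simp
    finally have 1: "cnj (LINT s|lborel. h j s) = \<i> * (G (of_real (- \<delta> j) - \<i> * of_real (real j)) - G (of_real (- \<delta> j)))" .
    have 2: "(LINT s|lborel. h j s) = \<i> * (G (of_real (\<delta> j) - \<i> * of_real (real j)) - G (of_real (\<delta> j)))"
      unfolding h_def using \<delta>[of j] by (intro side) simp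
    have "cnj (\<i> * (LINT s|lborel. h j s)) = - \<i> * cnj (LINT s|lborel. h j s)" by simp
    then show ?thesis unfolding top 1 unfolding 2 by (simp add: algebra_simps)
  qed
  have lim1: "?J \<longlonglongrightarrow> (LINT y|lborel. g y)"
  proof (rule integral_dominated_convergence)
    show "integrable lborel (\<lambda>y::real. 1 / jb y ^ n)" by (rule integrable_inverse_sqrt_power[OF n])
    show "AE y in lborel. (\<lambda>j. indicator {- real j..real j} y *\<^sub>R g y) \<longlonglongrightarrow> g y"
    proof (rule AE_I2)
      fix y :: real
      have "eventually (\<lambda>j. real j \<ge> \<bar>y\<bar>) sequentially"
        by (metis eventually_sequentially nat_ceiling_le_eq)
      then have "eventually (\<lambda>j. g y = indicator {- real j..real j} y *\<^sub>R g y) sequentially"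
        by eventually_elim (auto simp: indicator_def)
      then show "(\<lambda>j. indicator {- real j..real j} y *\<^sub>R g y) \<longlonglongrightarrow> g y"
        by (rule Lim_transform_eventually[OF tendsto_const])
    qed
    show "AE y in lborel. norm (indicator {- real j..real j} y *\<^sub>R g y) \<le> 1 / jb y ^ n" for j
      by (rule AE_I2) (auto simp: g_def indicator_def abs_mult)
  qed (auto simp: g_def v_def cis_conv_exp)
  have h_lim: "(\<lambda>j. LINT s|lborel. h j s) \<longlonglongrightarrow> A0"
    unfolding A0_def
  proof (rule integral_dominated_convergence[OF _ _ intD])
    have inW: "1 - \<i> * of_real s \<in> W" if "s > 0" for s :: real
    proof -
      have "1 - (1 - \<i> * of_real s)\<^sup>2 = of_real s * (of_real s + 2 * \<i>)"
        by (simp add: power2_eq_square algebra_simps)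
      moreover have "of_real s * (of_real s + 2 * \<i>) \<notin> \<real>\<^sub>\<le>\<^sub>0"
        using that by (simp add: complex_nonpos_Reals_iff)
      ultimately show ?thesis by (simp only: W_def mem_Collect_eq simp_thms)
    qed
    show "h1 \<in> borel_measurable lborel"
      unfolding h1_def measurable_lborel2
      by (intro borel_measurable_continuous_on_indicator continuous_on_compose2[OF contW] continuous_intros)
         (auto simp: inW)
    show "h j \<in> borel_measurable lborel" for j
      unfolding h_def measurable_lborel2 using \<delta>(2)[of j] UW
      by (intro borel_measurable_continuous_on_indicator continuous_on_compose2[OF contf] continuous_intros)
         (auto simp: U_def)
    show "AE s in lborel. norm (h j s) \<le> D s" for j
    \<comment> \<open>At \<open>s = 0\<close> the majorant \<open>D\<close> vanishes but
      \<open>h j\<close> does not, so this point is discarded as a null set.\<close>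
    proof (rule AE_mp[OF AE_lborel_singleton[of 0]], rule AE_I2, rule impI)
      fix s :: real assume "s \<noteq> 0"
      then show "norm (h j s) \<le> D s"
        using nf[of "\<delta> j" s] \<delta>(2)[of j] by (auto simp: h_def D_def indicator_def add_nonneg_nonneg)
    qed
    have "(\<lambda>j. 1 / (1 + (real j)\<^sup>2)) \<longlonglongrightarrow> 0"
    proof (rule tendsto_sandwich[OF _ _ tendsto_const LIMSEQ_inverse_real_of_nat])
      show "\<forall>\<^sub>F j in sequentially. 1 / (1 + (real j)\<^sup>2) \<le> inverse (real (Suc j))"
      proof (rule always_eventually, rule allI)
        fix j :: nat
        have "j \<le> j\<^sup>2" by (simp add: power2_nat_le_imp_le power2_eq_square)
        then have "real j \<le> (real j)\<^sup>2" by (metis of_nat_le_iff of_nat_power)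
        then show "1 / (1 + (real j)\<^sup>2) \<le> inverse (real (Suc j))"
          using le_imp_inverse_le[of "1 + real j" "1 + (real j)\<^sup>2"] unfolding divide_inverse of_nat_Suc
          by linarith
      qed
    qed (simp add: add_nonneg_nonneg)
    then have "(\<lambda>j. sqrt (1 - 1 / (1 + (real j)\<^sup>2))) \<longlonglongrightarrow> sqrt (1 - 0)"
      by (intro tendsto_intros)
    moreover have "sqrt (1 - 1 / (1 + (real j)\<^sup>2)) = \<delta> j" for j
    proof -
      have pos: "1 + (real j)\<^sup>2 > 0" by (simp add: add_pos_nonneg)
      then have "1 - 1 / (1 + (real j)\<^sup>2) = (real j)\<^sup>2 / (1 + (real j)\<^sup>2)" by (simp add: field_simps)
      then show ?thesis by (simp add: \<delta>_def v_def real_sqrt_divide)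
    qed
    ultimately have \<delta>1: "\<delta> \<longlonglongrightarrow> 1" by simp
    show "AE s in lborel. (\<lambda>j. h j s) \<longlonglongrightarrow> h1 s"
    proof (rule AE_mp[OF AE_lborel_singleton[of 0]], rule AE_I2, rule impI)
      fix s :: real assume s0: "s \<noteq> 0"
      show "(\<lambda>j. h j s) \<longlonglongrightarrow> h1 s"
      proof (cases "s > 0")
        case True
        have "(\<lambda>j. of_real (\<delta> j) - \<i> * of_real s) \<longlonglongrightarrow> of_real 1 - \<i> * of_real s"
          by (intro tendsto_intros \<delta>1)
        then have "(\<lambda>j. f (of_real (\<delta> j) - \<i> * of_real s)) \<longlonglongrightarrow> f (1 - \<i> * of_real s)"
          using \<delta>(2) UW True
          by (intro continuous_on_tendsto_compose[OF contW]) (auto simp: U_def inW intro!: always_eventually)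
        moreover have "eventually (\<lambda>j. real j \<ge> s) sequentially"
          by (metis eventually_sequentially nat_ceiling_le_eq)
        then have "eventually (\<lambda>j. f (of_real (\<delta> j) - \<i> * of_real s) = h j s) sequentially"
          by eventually_elim (use True in \<open>auto simp: h_def\<close>)
        ultimately have "(\<lambda>j. h j s) \<longlonglongrightarrow> f (1 - \<i> * of_real s)"
          by (rule Lim_transform_eventually)
        then show ?thesis using True by (simp add: h1_def)
      qed (use s0 in \<open>auto simp: h_def h1_def\<close>)
    qed
  qed
  \<comment> \<open>The bottom side has length less than 2, and \<open>f\<close> is exponentially
    small in \<open>j\<close> along it.\<close>
  have bot_lim: "(\<lambda>j. ?B j) \<longlonglongrightarrow> 0"
  proof (rule Lim_null_comparison)
    show "\<forall>\<^sub>F j in sequentially. norm (?B j)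
      \<le> 4 * C * exp (- (pi * x)) ^ j"
      using eventually_ge_at_top[of 1]
    proof eventually_elim
      fix j :: nat assume j: "1 \<le> j"
      define B where "B = 2 * (C * exp (- (pi * x * real j)))"
      \<comment> \<open>The segment of the strip at height -j, written with half-planes so that
        convexity is immediate.\<close>
      define S where "S = U \<inter> {z. Im z \<le> - real j} \<inter> {z. Im z \<ge> - real j}"
      have "norm (?B j)
        \<le> B * norm ((of_real (\<delta> j) - \<i> * of_real (real j)) - (of_real (- \<delta> j) - \<i> * of_real (real j)))"
      proof (rule field_differentiable_bound[of S])
        show "convex S" unfolding S_def
          by (intro convex_Int U(2) convex_halfspace_Im_le convex_halfspace_Im_ge)
        fix z assume z: "z \<in> S"
        then show "(G has_field_derivative f z) (at z within S)"
          by (intro has_field_derivative_at_within[OF G]) (simp add: S_def)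
        have ze: "z = of_real (Re z) - \<i> * of_real (real j)"
          using z by (auto simp: S_def complex_eq_iff)
        have "real j powr (- (1/2)) \<le> 1" using powr_mono2'[of "-(1/2)" 1 "real j"] j by simp
        also have "1 \<le> (2 + (real j)\<^sup>2) ^ n" by (intro one_le_power) (simp add: add_increasing2)
        finally have 1: "real j powr (- (1/2)) + (2 + (real j)\<^sup>2) ^ n \<le> 2 * (2 + (real j)\<^sup>2) ^ n" by simp
        have "norm (f z) \<le> exp (- (2 * pi * x * real j)) * (real j powr (- (1/2)) + (2 + (real j)\<^sup>2) ^ n)"
          using z j by (subst ze, intro nf) (auto simp: S_def U_def)
        also have "\<dots> \<le> exp (- (2 * pi * x * real j)) * (2 * (2 + (real j)\<^sup>2) ^ n)"
          using 1 by (intro mult_left_mono) auto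
        also have "\<dots> \<le> B" using polyexp[of "real j"] by (simp add: B_def)
        finally show "norm (f z) \<le> B" .
      qed (use \<delta>[of j] in \<open>auto simp: S_def U_def\<close>)
      also have "(of_real (\<delta> j) - \<i> * of_real (real j)) - (of_real (- \<delta> j) - \<i> * of_real (real j)) = of_real (2 * \<delta> j)"
        by simp
      also have "B * norm (of_real (2 * \<delta> j) :: complex) \<le> B * 2"
        using \<delta>[of j] C(1) by (intro mult_left_mono) (auto simp: B_def norm_of_real abs_mult)
      also have "\<dots> = 4 * C * exp (- (pi * x)) ^ j"
        by (simp add: B_def exp_of_nat_mult[symmetric] mult_ac)
      finally show "norm (?B j)
         \<le> 4 * C * exp (- (pi * x)) ^ j" .
    qed
    have "(\<lambda>j. exp (- (pi * x)) ^ j) \<longlonglongrightarrow> 0" using x by (intro LIMSEQ_realpow_zero) auto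
    then show "(\<lambda>j. 4 * C * exp (- (pi * x)) ^ j) \<longlonglongrightarrow> 0" by (rule tendsto_mult_right_zero)
  qed
  have "?J \<longlonglongrightarrow> 0 + (\<i> * A0 + cnj (\<i> * A0))"
    unfolding eq by (intro tendsto_intros h_lim bot_lim)
  with lim1 have main: "(LINT y|lborel. g y) = \<i> * A0 + cnj (\<i> * A0)"
    using LIMSEQ_unique by force
  have "A = \<i> * A0"
  proof -
    have "h1 s = wave x * ((indicator {0<..} s * exp (- (2 * pi * x * s))) *\<^sub>R (of_real s * (of_real s + 2 * \<i>)) powr of_real k)" for s
    proof -
      have 1: "1 - (1 - \<i> * of_real s)\<^sup>2 = of_real s * (of_real s + 2 * \<i>)"
        by (simp add: power2_eq_square algebra_simps)
      have 2: "exp (- (2 * of_real pi * \<i> * of_real x * (1 - \<i> * of_real s))) = wave x * of_real (exp (- (2 * pi * x * s)))"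
        by (simp add: cis_conv_exp exp_of_real[symmetric] exp_add[symmetric] algebra_simps)
      show ?thesis unfolding h1_def f_def 1 2 by (simp add: scaleR_conv_of_real)
    qed
    then have "h1 = (\<lambda>s. wave x * ((indicator {0<..} s * exp (- (2 * pi * x * s))) *\<^sub>R (of_real s * (of_real s + 2 * \<i>)) powr of_real k))"
      by (rule ext)
    then show ?thesis unfolding A_def A0_def k_def
      by (simp only: mult.assoc integral_mult_right_zero)
  qed
  then show ?thesis using main by (simp add: g_def v_def)
qed


section \<open>The oscillatory integral in the radius after rescaling\<close>

text \<open>The contour integral at \<open>x = \<rho> r\<close> after the substitution \<open>s = t / (\<rho> r)\<close>, with
  \<open>eps = 1 / \<rho>\<close>; all powers of \<open>r\<close> outside the complex power combine to the factor \<open>r\<close>.\<close>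
definition osc_kernel :: "nat \<Rightarrow> real \<Rightarrow> real \<Rightarrow> real \<times> real \<Rightarrow> complex"
  where "osc_kernel n eps w = (\<lambda>(r, t). (indicator {0<..1} r * indicator {0<..} t * r * (t powr (slice_exp n) * exp (- (2 * pi * t)))) *\<^sub>R
     (ray (eps * t) r powr of_real (slice_exp n) * wave (w * r)))"

definition osc_int :: "nat \<Rightarrow> real \<Rightarrow> real \<Rightarrow> complex"
  where "osc_int n eps w = (LINT z|lborel2. osc_kernel n eps w z)"

lemma quarter_plane_notin_nonpos:
  "r > 0 \<Longrightarrow> of_real eps + 2 * \<i> * of_real r \<notin> \<real>\<^sub>\<le>\<^sub>0"
  by (simp add: complex_nonpos_Reals_iff)

lemma continuous_on_quarter_plane_powr:
  assumes "continuous_on A f" "continuous_on A g" "\<And>z. z \<in> A \<Longrightarrow> g z > 0"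
  shows "continuous_on A (\<lambda>z. ray (f z) (g z) powr of_real k :: complex)"
proof (rule continuous_on_powr_complex)
  have Im: "Im (ray (f z) (g z)) > 0" if "z \<in> A" for z
    using assms(3)[OF that] by simp
  show "A \<subseteq> {z. 0 \<le> Re (ray (f z) (g z)) \<or> Im (ray (f z) (g z)) \<noteq> 0}"
    using Im by force
  show "0 < Re (of_real k)" if "z \<in> A" "of_real (f z) + 2 * \<i> * of_real (g z) = 0" for z
    using Im[OF that(1)] unfolding that(2) by simp
qed (intro continuous_intros assms)+

lemma measurable_osc_kernel[measurable]: "osc_kernel n eps w \<in> borel_measurable lborel2"
proof -
  let ?B = "{0<..1::real} \<times> {0::real<..}"
  let ?\<phi> = "\<lambda>z::real\<times>real. (fst z * (snd z powr (slice_exp n) * exp (- (2 * pi * snd z)))) *\<^sub>R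
     (ray (eps * snd z) (fst z) powr of_real (slice_exp n) * wave (w * fst z))"
  have "continuous_on ?B ?\<phi>"
    unfolding cis_conv_exp
    by (intro continuous_on_scaleR continuous_on_mult continuous_on_quarter_plane_powr continuous_intros) auto
  moreover have "?B \<in> sets borel" by (intro borel_Times) auto
  ultimately have "(\<lambda>z. indicator ?B z *\<^sub>R ?\<phi> z) \<in> borel_measurable borel"
    by (intro borel_measurable_continuous_on_indicator)
  also have "(\<lambda>z. indicator ?B z *\<^sub>R ?\<phi> z) = osc_kernel n eps w"
    by (auto simp: osc_kernel_def indicator_def fun_eq_iff)
  finally show ?thesis by (simp add: lborel_prod)
qed

lemma norm_quarter_plane_powr_le:
  fixes r eps :: real
  assumes n: "n \<ge> 2" and r: "0 < r" "r \<le> 1" and eps: "0 \<le> eps" "eps \<le> t"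
  shows "cmod (ray eps r powr of_real (slice_exp n)) \<le> r powr (-(1/2)) + (3 + t) ^ n"
proof -
  let ?z = "of_real eps + 2 * \<i> * of_real r :: complex"
  have k: "slice_exp n < 0 \<Longrightarrow> slice_exp n = -(1/2)" using n by auto
  have "r \<le> cmod ?z" using abs_Im_le_cmod[of ?z] r by simp
  moreover have "cmod ?z \<le> 3 + t"
    using norm_triangle_ineq[of "of_real eps" "2 * \<i> * of_real r :: complex"] r eps by (simp add: norm_mult)
  ultimately show ?thesis
    using n r eps k by (simp only: norm_powr_real_powr'[OF Reals_of_real] Re_complex_of_real)
      (rule powr_between_le, auto)
qed

text \<open>The endpoint 1 carries the phase of \<open>\<rho> * r\<close>, which joins that of
  \<open>\<tau> * r\<close> to give \<open>\<rho> + \<tau>\<close>. The endpoint -1 carries the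
  opposite phase; written as a conjugate, its frequency is \<open>\<rho> - \<tau>\<close>.\<close>

abbreviation osc_sum :: "nat \<Rightarrow> real \<Rightarrow> real \<Rightarrow> complex"
  where "osc_sum n \<rho> \<tau> \<equiv> \<i> * osc_int n (1 / \<rho>) (\<rho> + \<tau>) + cnj (\<i> * osc_int n (1 / \<rho>) (\<rho> - \<tau>))"

text \<open>Up to a factor 2, a majorant for the kernel in \<open>t\<close> alone, uniform over
  \<open>0 \<le> eps \<le> 1\<close>, all frequencies and all radii. The quantity
  \<open>3 + t\<close> bounds the modulus of \<open>ray (eps * t) r\<close>.\<close>

definition osc_bound :: "nat \<Rightarrow> real \<Rightarrow> real"
  where "osc_bound n t = indicator {0<..} t * (t powr (slice_exp n) * exp (- (2 * pi * t))) * (3 + t) ^ n"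

lemma measurable_osc_bound[measurable]: "osc_bound n \<in> borel_measurable borel"
  unfolding osc_bound_def by measurable

lemma osc_bound_nonneg: "osc_bound n t \<ge> 0"
  by (auto simp: osc_bound_def indicator_def)

lemma integrable_osc_bound:
  assumes n: "n \<ge> 2"
  shows "integrable lborel (osc_bound n)"
proof -
  obtain C where C: "C > 0" "\<And>s. s \<ge> 0 \<Longrightarrow> (3 + s) ^ n \<le> C * exp (pi * s)"
    using power_le_const_mult_exp[of pi 3 n] by auto
  show ?thesis
  proof (rule Bochner_Integration.integrable_bound)
    show "integrable lborel (\<lambda>t. C * (indicator {0<..} t * (t powr (slice_exp n) * exp (- (pi * t)))))"
      using n by (intro integrable_mult_right integrable_powr_times_exp) auto
    show "AE t in lborel. norm (osc_bound n t) \<le> norm (C * (indicator {0<..} t * (t powr (slice_exp n) * exp (- (pi * t)))))"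
    proof (rule AE_I2)
      fix t :: real
      have "t powr (slice_exp n) * exp (- (2 * pi * t)) * (3 + t) ^ n \<le>
         t powr (slice_exp n) * exp (- (2 * pi * t)) * (C * exp (pi * t))" if "t > 0"
        using C(2)[of t] that by (intro mult_left_mono) auto
      also have "t powr (slice_exp n) * exp (- (2 * pi * t)) * (C * exp (pi * t)) =
         C * (t powr (slice_exp n) * exp (- (pi * t)))"
        by (simp add: mult_ac exp_add[symmetric])
      finally show "norm (osc_bound n t) \<le> norm (C * (indicator {0<..} t * (t powr (slice_exp n) * exp (- (pi * t)))))"
        using C(1) by (cases "t > 0") (auto simp: osc_bound_def abs_mult)
    qed
  qed (unfold osc_bound_def, measurable)
qed

text \<open>The leftover factor \<open>r\<close> turns the singularity
  \<open>r powr (-(1/2))\<close> into \<open>r powr (1/2) \<le> 1\<close>. Both summands are then at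
  most \<open>(3 + t) ^ n\<close>, whence the factor 2.\<close>

lemma norm_osc_kernel_le:
  assumes n: "n \<ge> 2" and eps: "0 \<le> eps" "eps \<le> 1"
  shows "norm (osc_kernel n eps w (r, t)) \<le> indicator {0..1} r * (2 * osc_bound n t)"
proof (cases "0 < r \<and> r \<le> 1 \<and> 0 < t")
  case True
  then have t: "eps * t \<le> t" using eps by (simp add: mult_left_le_one_le)
  let ?P = "t powr (slice_exp n) * exp (- (2 * pi * t))"
  have "r * cmod (ray (eps * t) r powr of_real (slice_exp n))
     \<le> r * (r powr (-(1/2)) + (3 + t) ^ n)"
    using n True eps t by (intro mult_left_mono norm_quarter_plane_powr_le) auto
  also have "\<dots> = r powr (1/2) + r * (3 + t) ^ n"
    using True powr_add[of r 1 "-(1/2)"] by (simp add: distrib_left)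
  also have "\<dots> \<le> (3 + t) ^ n + (3 + t) ^ n"
  proof (rule add_mono)
    have "r powr (1/2) \<le> 1" using True by (intro powr_le1) auto
    also have "1 \<le> (3 + t) ^ n" using True by (intro one_le_power) auto
    finally show "r powr (1/2) \<le> (3 + t) ^ n" .
    show "r * (3 + t) ^ n \<le> (3 + t) ^ n" using True by (intro mult_left_le_one_le) auto
  qed
  finally have "?P * (r * cmod (ray (eps * t) r powr of_real (slice_exp n))) \<le> ?P * ((3 + t) ^ n + (3 + t) ^ n)"
    by (rule mult_left_mono) simp
  moreover have "norm (osc_kernel n eps w (r, t)) = ?P * (r * cmod (ray (eps * t) r powr of_real (slice_exp n)))"
    using True by (simp add: osc_kernel_def norm_mult abs_mult del: of_real_mult of_real_divide)
  ultimately show ?thesis using True by (simp add: osc_bound_def mult_ac)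
next
  case False
  then have "osc_kernel n eps w (r, t) = 0" by (auto simp: osc_kernel_def)
  then show ?thesis using osc_bound_nonneg[of n t] by simp
qed

lemma integrable_osc_dominant:
  assumes n: "n \<ge> 2"
  shows "integrable lborel2 (\<lambda>(r, t). indicator {0..1::real} r * (2 * osc_bound n t) :: real)"
  using integrable_osc_bound[OF n]
  by (intro lborel_pair.Fubini_integrable) (auto simp: abs_mult)

lemma integrable_osc_kernel:
  assumes n: "n \<ge> 2" and eps: "0 \<le> eps" "eps \<le> 1"
  shows "integrable lborel2 (osc_kernel n eps w)"
proof (rule Bochner_Integration.integrable_bound[OF integrable_osc_dominant[OF n]])
  show "AE z in lborel2. norm (osc_kernel n eps w z) \<le> norm ((\<lambda>(r, t). indicator {0..1::real} r * (2 * osc_bound n t) :: real) z)"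
  proof (rule AE_I2)
    fix z :: "real \<times> real"
    obtain r t where "z = (r, t)" by force
    then show "norm (osc_kernel n eps w z) \<le> norm ((\<lambda>(r, t). indicator {0..1::real} r * (2 * osc_bound n t) :: real) z)"
      using norm_osc_kernel_le[OF n eps, of w r t] by simp
  qed
qed measurable

text \<open>Homogeneity: with s = t / (\<rho> r), the base s (s + 2 \<i>) is the positive number t /
  (\<rho> r^2) times \<open>ray (t / \<rho>) r\<close>, so the complex power splits. Together with
  the Jacobian 1 / (\<rho> r) this extracts \<rho> to the power -(n-1)/2, the decay rate of the
  sphere transform.\<close>

lemma sphere_slice_osc:
  fixes \<rho> r :: real
  assumes n: "n \<ge> 2" and \<rho>: "\<rho> \<ge> 1" and r: "0 < r" "r \<le> 1"
  shows "of_real (r ^ (n - 1)) * (\<i> * wave (\<rho> * r) *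
    (LINT s|lborel. (indicator {0<..} s * exp (- (2 * pi * (\<rho> * r) * s))) *\<^sub>R (of_real s * (of_real s + 2 * \<i>)) powr of_real (slice_exp n)))
    = of_real (\<rho> powr (- (real n - 1) / 2)) * (\<i> * (LINT t|lborel. osc_kernel n (1 / \<rho>) \<rho> (r, t)))"
proof -
  define k where "k = slice_exp n"
  define x where "x = \<rho> * r"
  have x: "x > 0" using \<rho> r by (simp add: x_def)
  let ?f = "\<lambda>s::real. (indicator {0<..} s * exp (- (2 * pi * x * s))) *\<^sub>R (of_real s * (of_real s + 2 * \<i>)) powr of_real k"
  have key: "(1 / x) *\<^sub>R ?f (0 + (1 / x) * t) = (\<rho> powr (-1-k) * r powr (-1 - 2 * k)) *\<^sub>R
     ((indicator {0<..} t * (t powr k * exp (- (2 * pi * t)))) *\<^sub>R ray (1 / \<rho> * t) r powr of_real k)" for t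
  proof (cases "t > 0")
    case True
    have "of_real (1 / x * t) * (of_real (1 / x * t) + 2 * \<i>) = (of_real (t / (x * r)) :: complex) * ray (1 / \<rho> * t) r"
      using \<rho> r by (simp add: x_def field_simps)
    then have "(of_real (1 / x * t) * (of_real (1 / x * t) + 2 * \<i>)) powr of_real k
       = of_real (t / (x * r)) powr of_real k * ray (1 / \<rho> * t) r powr (of_real k :: complex)"
      using True x r by (simp only:) (rule powr_times_real_left, auto)
    also have "of_real (t / (x * r)) powr (of_real k :: complex) = of_real ((t / (x * r)) powr k)"
      using True x r by (intro powr_of_real) auto
    also have "(t / (x * r)) powr k = t powr k * (\<rho> powr (-k) * r powr (- 2 * k))"
    proof -
      have "x * r = \<rho> * (r powr 2)" using r by (simp add: x_def power2_eq_square)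
      then have "(t / (x * r)) powr k = t powr k / (\<rho> powr k * (r powr 2) powr k)"
        using True \<rho> r by (simp add: powr_divide powr_mult)
      then show ?thesis by (simp add: powr_powr powr_minus divide_inverse)
    qed
    finally have 1: "(of_real (1 / x * t) * (of_real (1 / x * t) + 2 * \<i>)) powr of_real k
       = of_real (t powr k * (\<rho> powr (-k) * r powr (- 2 * k))) * ray (1 / \<rho> * t) r powr (of_real k :: complex)" .
    have 2: "1 / x * (\<rho> powr (-k) * r powr (- 2 * k)) = \<rho> powr (-1-k) * r powr (-1 - 2 * k)"
      using \<rho> r by (simp add: x_def powr_diff powr_minus divide_inverse mult_ac)
    have "(1 / x) *\<^sub>R ?f (0 + (1 / x) * t) = (1 / x * exp (- (2 * pi * t))) *\<^sub>R (of_real (1 / x * t) * (of_real (1 / x * t) + 2 * \<i>)) powr of_real k"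
      using True x by simp
    also have "\<dots> = (1 / x * (\<rho> powr (-k) * r powr (- 2 * k))) *\<^sub>R ((t powr k * exp (- (2 * pi * t))) *\<^sub>R ray (1 / \<rho> * t) r powr of_real k)"
      unfolding 1 by (simp add: scaleR_conv_of_real mult_ac)
    finally show ?thesis unfolding 2 using True by simp
  next
    case False
    then have "\<not> 1 / x * t > 0" using x by (simp add: zero_less_divide_iff not_less)
    then show ?thesis using False by simp
  qed
  have "(LINT s|lborel. ?f s) = (LINT t|lborel. (1 / x) *\<^sub>R ?f (0 + (1 / x) * t))"
    using lborel_integral_real_affine[of "1 / x" ?f 0] x
    by (simp only: Bochner_Integration.integral_scaleR_right) simp
  also have "\<dots> = (\<rho> powr (-1-k) * r powr (-1 - 2 * k)) *\<^sub>R
     (LINT t|lborel. (indicator {0<..} t * (t powr k * exp (- (2 * pi * t)))) *\<^sub>R ray (1 / \<rho> * t) r powr of_real k)"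
    (is "_ = _ *\<^sub>R ?J")
    unfolding key by (rule Bochner_Integration.integral_scaleR_right)
  finally have 1: "(LINT s|lborel. ?f s) = (\<rho> powr (-1-k) * r powr (-1 - 2 * k)) *\<^sub>R ?J" .
  have 2: "(LINT t|lborel. osc_kernel n (1 / \<rho>) \<rho> (r, t)) = of_real r * wave x * ?J"
  proof -
    have "(LINT t|lborel. osc_kernel n (1 / \<rho>) \<rho> (r, t)) = (LINT t|lborel. (of_real r * wave x) *
      ((indicator {0<..} t * (t powr k * exp (- (2 * pi * t)))) *\<^sub>R ray (1 / \<rho> * t) r powr of_real k))"
      using r by (intro Bochner_Integration.integral_cong)
        (simp_all add: osc_kernel_def k_def x_def scaleR_conv_of_real mult_ac del: of_real_diff of_real_divide)
    then show ?thesis by (simp only: integral_mult_right_zero)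
  qed
  have "r ^ (n - 1) * r powr (-1 - 2 * k) = r powr (real (n - 1) + (-1 - 2 * k))"
    using r by (simp add: powr_add powr_realpow)
  also have "real (n - 1) + (-1 - 2 * k) = 1" using n by (simp add: k_def of_nat_diff field_simps)
  finally have 3: "r ^ (n - 1) * r powr (-1 - 2 * k) = r" using r by simp
  have 4: "-1 - k = - (real n - 1) / 2" by (simp add: k_def field_simps)
  have "of_real (r ^ (n - 1)) * (\<i> * wave x * (LINT s|lborel. ?f s))
     = of_real (\<rho> powr (-1-k) * (r ^ (n - 1) * r powr (-1 - 2 * k))) * (\<i> * wave x * ?J)"
    unfolding 1 by (simp add: scaleR_conv_of_real mult_ac)
  also have "\<dots> = of_real (\<rho> powr (- (real n - 1) / 2)) * (\<i> * (LINT t|lborel. osc_kernel n (1 / \<rho>) \<rho> (r, t)))"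
    unfolding 2 3 4 by (simp add: mult_ac)
  finally show ?thesis by (simp add: x_def k_def)
qed

lemma cone_kernel_integral_osc:
  assumes n: "n \<ge> 2" and \<rho>: "\<rho> \<ge> 1"
  shows "(LINT z|lborel2. cone_kernel n \<rho> \<tau> z) =
    of_real (\<rho> powr (- (real n - 1) / 2)) *
      (osc_sum n \<rho> \<tau>)"
proof -
  let ?R = "of_real (\<rho> powr (- (real n - 1) / 2)) :: complex"
  let ?O = "\<lambda>w r. LINT t|lborel. osc_kernel n (1 / \<rho>) w (r, t)"
  have eps: "0 \<le> 1 / \<rho>" "1 / \<rho> \<le> 1" using \<rho> by auto
  \<comment> \<open>The phase is constant in \<open>t\<close> at fixed \<open>r\<close>, so
    multiplying by it only moves the frequency parameter.\<close>
  have shift: "wave (u * r) * ?O w r = ?O (w + u) r" for u w r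
  proof -
    have "wave (u * r) * ?O w r = (LINT t|lborel. wave (u * r) * osc_kernel n (1 / \<rho>) w (r, t))"
      by simp
    also have "\<dots> = ?O (w + u) r"
    proof (rule Bochner_Integration.integral_cong[OF refl])
      fix t
      have "wave ((w + u) * r) = wave (w * r) * wave (u * r)"
        by (simp add: cis_mult algebra_simps)
      then show "wave (u * r) * osc_kernel n (1 / \<rho>) w (r, t) = osc_kernel n (1 / \<rho>) (w + u) (r, t)"
        by (simp add: osc_kernel_def mult_ac)
    qed
    finally show ?thesis .
  qed
  have iter: "(LINT r|lborel. ?O w r) = osc_int n (1 / \<rho>) w" for w
    unfolding osc_int_def by (rule lborel_pair.integral_fst'[OF integrable_osc_kernel[OF n eps]])
  have "(LINT z|lborel2. cone_kernel n \<rho> \<tau> z) = (LINT r|lborel. LINT y|lborel. cone_kernel n \<rho> \<tau> (y, r))"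
    using lborel_pair.integral_snd[of "\<lambda>y r. cone_kernel n \<rho> \<tau> (y, r)"] integrable_cone_kernel[OF n, of \<rho> \<tau>]
    by simp
  also have "\<dots> = (LINT r|lborel. ?R * (\<i> * ?O (\<rho> + \<tau>) r + cnj (\<i> * ?O (\<rho> - \<tau>) r)))"
  proof (rule Bochner_Integration.integral_cong[OF refl])
    fix r :: real
    show "(LINT y|lborel. cone_kernel n \<rho> \<tau> (y, r)) = ?R * (\<i> * ?O (\<rho> + \<tau>) r + cnj (\<i> * ?O (\<rho> - \<tau>) r))"
    proof (cases "0 < r \<and> r \<le> 1")
      case True
      define A where "A = \<i> * wave (\<rho> * r) *
        (LINT s|lborel. (indicator {0<..} s * exp (- (2 * pi * (\<rho> * r) * s))) *\<^sub>R (of_real s * (of_real s + 2 * \<i>)) powr of_real (slice_exp n))"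
      have A: "of_real (r ^ (n - 1)) * A = ?R * (\<i> * ?O \<rho> r)"
        unfolding A_def using True by (intro sphere_slice_osc n \<rho>) auto
      have "(LINT y|lborel. cone_kernel n \<rho> \<tau> (y, r)) = (LINT y|lborel. (of_real (r ^ (n - 1)) * wave (\<tau> * r)) *
          ((1 / jb y ^ n) *\<^sub>R wave ((\<rho> * r) * (y / jb y))))"
        using True by (intro Bochner_Integration.integral_cong)
          (auto simp: cone_kernel_def scaleR_conv_of_real cis_mult distrib_left mult_ac intro!: arg_cong[where f=cis])
      also have "\<dots> = (of_real (r ^ (n - 1)) * wave (\<tau> * r)) * (A + cnj A)"
      proof -
        have "0 < \<rho> * r" using True \<rho> by simp
        from sphere_slice_contour[OF n this] show ?thesis
          unfolding A_def[symmetric] by (simp only: integral_mult_right_zero)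
      qed
      \<comment> \<open>Moved inside the conjugation, the phase of \<open>\<tau>\<close> changes
        sign; this produces the frequency \<open>\<rho> - \<tau>\<close> in the second term.\<close>
      also have "\<dots> = wave (\<tau> * r) * (of_real (r ^ (n - 1)) * A) + cnj (wave (- \<tau> * r) * (of_real (r ^ (n - 1)) * A))"
        by (simp add: algebra_simps cis_cnj)
      also have "\<dots> = ?R * (\<i> * (wave (\<tau> * r) * ?O \<rho> r)) + cnj (?R * (\<i> * (wave (- \<tau> * r) * ?O \<rho> r)))"
        unfolding A by (simp only: mult_ac)
      also have "\<dots> = ?R * (\<i> * ?O (\<rho> + \<tau>) r + cnj (\<i> * ?O (\<rho> - \<tau>) r))"
        unfolding shift by (simp add: algebra_simps)
      finally show ?thesis .
    next
      case False
      \<comment> \<open>At \<open>r = 0\<close> the Jacobian vanishes because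
        \<open>n \<ge> 2\<close>, so the contour formula is invoked only at positive frequency
        \<open>\<rho> * r\<close>.\<close>
      have "cone_kernel n \<rho> \<tau> (y, r) = 0" for y
        using False n by (cases "r = 0") (auto simp: cone_kernel_def power_0_left)
      moreover have "osc_kernel n (1 / \<rho>) w (r, t) = 0" for w t
        using False by (auto simp: osc_kernel_def)
      ultimately show ?thesis by simp
    qed
  qed
  also have "\<dots> = ?R * (\<i> * (LINT r|lborel. ?O (\<rho> + \<tau>) r) + cnj (\<i> * (LINT r|lborel. ?O (\<rho> - \<tau>) r)))"
  proof -
    have int: "integrable lborel (\<lambda>r. ?O w r)" for w
      using lborel_pair.integrable_fst'[OF integrable_osc_kernel[OF n eps]] by simp
    have "integrable lborel (\<lambda>r. \<i> * ?O w r)" for w using int by simp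
    moreover from this have "integrable lborel (\<lambda>r. cnj (\<i> * ?O w r))" for w by (simp del: complex_cnj_mult)
    ultimately show ?thesis
      by (subst integral_mult_right_zero, subst Bochner_Integration.integral_add)
         (simp_all del: complex_cnj_mult add: complex_cnj_mult[symmetric])
  qed
  finally show ?thesis unfolding iter .
qed


section \<open>Decay of the oscillatory integral and its lower bound at small frequency\<close>

lemma integrable_powr_minus_half: "integrable lborel (\<lambda>r::real. indicator {0<..1} r * r powr (-(1/2)))"
proof (rule Bochner_Integration.integrable_bound)
  show "integrable lborel (\<lambda>r::real. exp 1 * (indicator {0<..} r * (r powr (-(1/2)) * exp (- (1 * r)))))"
    by (intro integrable_mult_right integrable_powr_times_exp) auto
  show "AE r::real in lborel. norm (indicator {0<..1} r * r powr (-(1/2))) \<le> norm (exp 1 * (indicator {0<..} r * (r powr (-(1/2)) * exp (- (1 * r)))))"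
  proof (rule AE_I2)
    fix r :: real
    have "r powr (-(1/2)) * 1 \<le> r powr (-(1/2)) * (exp 1 * exp (- r))" if "r \<le> 1"
      using that by (intro mult_left_mono) (auto simp: exp_add[symmetric])
    then show "norm (indicator {0<..1} r * r powr (-(1/2))) \<le> norm (exp 1 * (indicator {0<..} r * (r powr (-(1/2)) * exp (- (1 * r)))))"
      by (auto simp: indicator_def mult_ac)
  qed
qed measurable

text \<open>One integration by parts against the phase. Differentiating the power costs a factor
  \<open>1 / ray eps r\<close>, which the factor \<open>r\<close> repays, since
  \<open>2 * r \<le> cmod (ray eps r)\<close>; the new integrand is again at most a multiple of
  \<open>r powr (-(1/2)) + (3 + t) ^ n\<close>. A positive \<open>eps\<close> keeps the base off the
  branch cut down to \<open>r = 0\<close>, while the constant is independent of it.\<close>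

lemma osc_inner_bound:
  fixes n :: nat
  assumes n: "n \<ge> 2"
  obtains C where "C > 0" "\<And>eps t w. 0 < eps \<Longrightarrow> eps \<le> t \<Longrightarrow>
    (1 + \<bar>w\<bar>) * cmod (LINT r|lborel. indicator {0<..1} r *\<^sub>R (of_real r * ray eps r powr of_real (slice_exp n) * wave (w * r)))
      \<le> C * (3 + t) ^ n"
proof -
  define k where "k = slice_exp n"
  define I0 where "I0 = (LINT r|lborel. indicator {0<..1::real} r * r powr (-(1/2)))"
  have I0: "I0 \<ge> 0" unfolding I0_def by (intro integral_nonneg_AE AE_I2) auto
  \<comment> \<open>The three summands pay for the trivial bound, the integral of the derivative and
    the boundary term at \<open>r = 1\<close>; the boundary term at 0 vanishes.\<close>
  define C where "C = (I0 + 1) + (1 + real n) * (I0 + 1) + 2"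
  have C: "C > 0" using I0 by (simp add: C_def add_pos_nonneg)
  have "(1 + \<bar>w\<bar>) * cmod (LINT r|lborel. indicator {0<..1} r *\<^sub>R (of_real r * ray eps r powr of_real k * wave (w * r)))
      \<le> C * (3 + t) ^ n" if eps: "0 < eps" "eps \<le> t" for eps t w
  proof -
    define P where "P r = ray eps r powr (of_real k :: complex)" for r :: real
    define e where "e r = wave (w * r)" for r :: real
    define h where "h r = of_real r * P r" for r :: real
    define h' where "h' r = P r + of_real r * (of_real k * (P r / ray eps r) * (2 * \<i>))" for r :: real
    let ?a = "2 * of_real pi * \<i> * of_real w :: complex"
    let ?I = "LINT r|lborel. indicator {0<..1} r *\<^sub>R (h r * e r)"
    let ?I' = "LINT r|lborel. indicator {0<..1} r *\<^sub>R (h' r * e r)"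
    let ?Q = "(3 + t) ^ n"
    have Q1: "1 \<le> ?Q" using eps by (intro one_le_power) auto
    have nz: "of_real eps + 2 * \<i> * of_real r \<noteq> 0" for r :: real
      using eps by (simp add: complex_eq_iff)
    have np: "of_real eps + 2 * \<i> * of_real r \<notin> \<real>\<^sub>\<le>\<^sub>0" for r :: real
      using eps by (simp add: complex_nonpos_Reals_iff)
    have dP: "(P has_vector_derivative of_real k * (P r / ray eps r) * (2 * \<i>)) (at r)" for r
    proof -
      have "((\<lambda>z. (of_real eps + 2 * \<i> * z) powr of_real k) has_field_derivative
          of_real k * ray eps r powr (of_real k - 1) * (2 * \<i>)) (at (of_real r))"
        by (rule DERIV_chain2[where f="\<lambda>z. z powr of_real k" and g="\<lambda>z. of_real eps + 2 * \<i> * z", OF has_field_derivative_powr[OF np]])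
           (auto intro!: derivative_eq_intros)
      moreover have "ray eps r powr (of_real k - 1) = P r / ray eps r"
        using nz[of r] by (simp add: P_def powr_diff)
      ultimately show ?thesis
        unfolding P_def[abs_def] by (auto dest: has_vector_derivative_real_field)
    qed
    have dh: "(h has_vector_derivative h' r) (at r)" for r
    proof -
      have "((\<lambda>r. of_real r * P r) has_vector_derivative
         of_real r * (of_real k * (P r / ray eps r) * (2 * \<i>)) + 1 * P r) (at r)"
        by (rule has_vector_derivative_mult[OF _ dP])
           (use has_vector_derivative_of_real[of "\<lambda>x. x" 1] in \<open>auto intro!: derivative_eq_intros\<close>)
      then show ?thesis by (simp add: h_def[abs_def] h'_def add.commute)
    qed
    have de: "(e has_vector_derivative - ?a * e r) (at r)" for r
    proof -
      have "((\<lambda>z. exp (- ?a * z)) has_field_derivative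
          exp (- ?a * of_real r) * (- ?a)) (at (of_real r))"
        by (auto intro!: derivative_eq_intros)
      then have "((\<lambda>r. exp (- ?a * of_real r)) has_vector_derivative
          exp (- ?a * of_real r) * (- ?a)) (at r)"
        by (rule has_vector_derivative_real_field)
      moreover have "e = (\<lambda>r. exp (- ?a * of_real r))"
        by (simp add: e_def[abs_def] cis_conv_exp mult_ac)
      ultimately show ?thesis by (simp add: mult.commute)
    qed
    have cP: "continuous_on S P" and ce: "continuous_on S e" and ch: "continuous_on S h" for S
      using dP de dh
      by (auto intro!: continuous_at_imp_continuous_on dest: has_vector_derivative_continuous)
    have ch': "continuous_on S h'" for S
      unfolding h'_def by (intro continuous_intros cP) (use nz in auto)
    have Pb: "cmod (P r) \<le> r powr (-(1/2)) + ?Q" if "0 < r" "r \<le> 1" for r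
      unfolding P_def k_def using n that eps by (intro norm_quarter_plane_powr_le) auto
    have hb: "cmod (h r) \<le> r powr (-(1/2)) + ?Q" if "0 < r" "r \<le> 1" for r
    proof -
      have "cmod (h r) = r * cmod (P r)" using that by (simp add: h_def norm_mult)
      also have "\<dots> \<le> cmod (P r)" using that by (intro mult_left_le_one_le) auto
      finally show ?thesis using Pb[OF that] by simp
    qed
    have h'b: "cmod (h' r) \<le> (1 + real n) * (r powr (-(1/2)) + ?Q)" if r: "0 < r" "r \<le> 1" for r
    proof -
      have z: "2 * r \<le> cmod (ray eps r)"
        using abs_Im_le_cmod[of "of_real eps + 2 * \<i> * of_real r"] r by simp
      have "cmod (h' r) \<le> cmod (P r) + cmod (of_real r * (of_real k * (P r / ray eps r) * (2 * \<i>)))"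
        unfolding h'_def by (rule norm_triangle_ineq)
      also have "cmod (of_real r * (of_real k * (P r / ray eps r) * (2 * \<i>)))
         = \<bar>k\<bar> * cmod (P r) * (2 * r / cmod (ray eps r))"
        using r by (simp add: norm_mult norm_divide)
      also have "\<dots> \<le> \<bar>k\<bar> * cmod (P r) * 1"
        using z r by (intro mult_left_mono) (auto simp: divide_le_eq_1)
      also have "\<dots> \<le> real n * cmod (P r)"
      proof -
        have "\<bar>k\<bar> \<le> real n" using n by (simp add: k_def)
        then show ?thesis by (simp add: mult_right_mono)
      qed
      finally have "cmod (h' r) \<le> (1 + real n) * cmod (P r)" by (simp add: distrib_right)
      also have "\<dots> \<le> (1 + real n) * (r powr (-(1/2)) + ?Q)"
        using Pb[OF r] by (intro mult_left_mono) auto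
      finally show ?thesis .
    qed
    \<comment> \<open>Applied to \<open>h\<close> with \<open>B = 1\<close> and to \<open>h'\<close>
      with \<open>B = 1 + real n\<close>.\<close>
    have bnd: "integrable lborel (\<lambda>r. indicator {0<..1} r *\<^sub>R (f r * e r)) \<and>
       cmod (LINT r|lborel. indicator {0<..1} r *\<^sub>R (f r * e r)) \<le> B * ((I0 + 1) * ?Q)"
      if cf: "continuous_on {0..1} f" and fb: "\<And>r. 0 < r \<Longrightarrow> r \<le> 1 \<Longrightarrow> cmod (f r) \<le> B * (r powr (-(1/2)) + ?Q)" and B: "B \<ge> 0"
      for f B
    proof -
      have intb: "integrable lborel (\<lambda>r. B * (indicator {0<..1} r * r powr (-(1/2)) + ?Q * indicator {0<..1::real} r))"
        by (intro integrable_mult_right Bochner_Integration.integrable_add integrable_powr_minus_half) auto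
      have ib: "(LINT r|lborel. B * (indicator {0<..1} r * r powr (-(1/2)) + ?Q * indicator {0<..1::real} r)) = B * (I0 + ?Q)"
        unfolding I0_def
        by (subst integral_mult_right_zero, subst Bochner_Integration.integral_add)
           (auto intro: integrable_powr_minus_half)
      have nb: "norm (indicator {0<..1} r *\<^sub>R (f r * e r)) \<le> B * (indicator {0<..1} r * r powr (-(1/2)) + ?Q * indicator {0<..1::real} r)" for r
        using fb[of r] B by (auto simp: indicator_def e_def norm_mult)
      have int: "integrable lborel (\<lambda>r. indicator {0<..1} r *\<^sub>R (f r * e r))"
      proof (rule Bochner_Integration.integrable_bound[OF intb])
        show "(\<lambda>r. indicator {0<..1} r *\<^sub>R (f r * e r)) \<in> borel_measurable lborel"
          unfolding measurable_lborel2
          by (intro borel_measurable_continuous_on_indicator continuous_on_mult ce continuous_on_subset[OF cf]) auto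
        show "AE r in lborel. norm (indicator {0<..1} r *\<^sub>R (f r * e r)) \<le> norm (B * (indicator {0<..1} r * r powr (-(1/2)) + ?Q * indicator {0<..1::real} r))"
          using nb by (intro AE_I2) (smt (verit) real_norm_def)
      qed
      have "cmod (LINT r|lborel. indicator {0<..1} r *\<^sub>R (f r * e r)) \<le> (LINT r|lborel. B * (indicator {0<..1} r * r powr (-(1/2)) + ?Q * indicator {0<..1::real} r))"
        by (rule Bochner_Integration.integral_norm_bound_integral[OF int intb]) (rule nb)
      also have "\<dots> \<le> B * ((I0 + 1) * ?Q)"
        unfolding ib using B I0 Q1 mult_left_mono[OF Q1 I0] by (intro mult_left_mono) (auto simp: distrib_right)
      finally show ?thesis using int by blast
    qed
    have b1: "integrable lborel (\<lambda>r. indicator {0<..1} r *\<^sub>R (h r * e r))"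
      "cmod ?I \<le> (I0 + 1) * ?Q"
      using bnd[OF ch, of 1] hb by auto
    have b2: "integrable lborel (\<lambda>r. indicator {0<..1} r *\<^sub>R (h' r * e r))"
      "cmod ?I' \<le> (1 + real n) * ((I0 + 1) * ?Q)"
      using bnd[OF ch', of "1 + real n"] h'b by auto
    have "(LINT r|lborel. indicator {0..1} r *\<^sub>R (h r * (- ?a * e r) + h' r * e r)) = h 1 * e 1 - h 0 * e 0"
    proof (rule integral_FTC_Icc)
      show "continuous_on {0..1} (\<lambda>r. h r * (- ?a * e r) + h' r * e r)"
        by (intro continuous_intros ce ch ch')
      show "((\<lambda>r. h r * e r) has_vector_derivative h r * (- ?a * e r) + h' r * e r) (at r within {0..1})" for r
        by (rule has_vector_derivative_at_within, rule has_vector_derivative_mult[OF dh de])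
    qed simp
    also have "(LINT r|lborel. indicator {0..1} r *\<^sub>R (h r * (- ?a * e r) + h' r * e r))
       = (LINT r|lborel. - ?a * (indicator {0<..1} r *\<^sub>R (h r * e r)) + indicator {0<..1} r *\<^sub>R (h' r * e r))"
    proof (rule integral_cong_AE)
      show "AE r in lborel. indicator {0..1} r *\<^sub>R (h r * (- ?a * e r) + h' r * e r)
         = - ?a * (indicator {0<..1} r *\<^sub>R (h r * e r)) + indicator {0<..1} r *\<^sub>R (h' r * e r)"
        using AE_lborel_singleton[of "0::real"]
        by eventually_elim (auto simp: indicator_def algebra_simps)
      show "(\<lambda>r. indicator {0..1} r *\<^sub>R (h r * (- ?a * e r) + h' r * e r)) \<in> borel_measurable lborel"
        unfolding measurable_lborel2
        by (intro borel_measurable_continuous_on_indicator continuous_intros ce ch ch') auto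
      show "(\<lambda>r. - ?a * (indicator {0<..1} r *\<^sub>R (h r * e r)) + indicator {0<..1} r *\<^sub>R (h' r * e r)) \<in> borel_measurable lborel"
        using b1(1) b2(1) by (intro borel_measurable_integrable Bochner_Integration.integrable_add integrable_mult_right) auto
    qed
    also have "\<dots> = - ?a * ?I + ?I'"
      using b1(1) b2(1)
      by (subst Bochner_Integration.integral_add)
         (auto simp only: integral_mult_right_zero intro!: integrable_mult_right)
    finally have "?a * ?I
       = ?I' - h 1 * e 1"
      by (simp add: h_def algebra_simps)
    then have "cmod (?a * ?I)
       \<le> cmod ?I' + cmod (h 1 * e 1)"
      by (simp only: norm_triangle_ineq4)
    also have "cmod (h 1 * e 1) \<le> 2 * ?Q" using hb[of 1] Q1 by (simp add: norm_mult e_def)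
    finally have "2 * pi * \<bar>w\<bar> * cmod ?I \<le> (1 + real n) * ((I0 + 1) * ?Q) + 2 * ?Q"
      using b2(2) by (simp add: norm_mult)
    moreover have "\<bar>w\<bar> * cmod ?I \<le> 2 * pi * \<bar>w\<bar> * cmod ?I"
      using pi_gt3 by (intro mult_right_mono) (auto simp: mult_le_cancel_right1)
    moreover have "C * ?Q = (I0 + 1) * ?Q + (1 + real n) * ((I0 + 1) * ?Q) + 2 * ?Q"
      by (simp add: C_def algebra_simps)
    ultimately have "(1 + \<bar>w\<bar>) * cmod ?I \<le> C * ?Q"
      using b1(2) unfolding distrib_right[of 1] mult_1_left by linarith
    then show ?thesis by (simp add: h_def P_def e_def)
  qed
  with C that show ?thesis unfolding k_def by blast
qed

text \<open>The previous bound with \<open>eps * t\<close> in place of \<open>eps\<close>,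
  integrated over \<open>t\<close>; \<open>eps \<le> 1\<close> ensures that this shift is at most
  \<open>t\<close>. The summand 1 in the final constant makes it visibly positive.\<close>

lemma osc_int_bound:
  assumes n: "n \<ge> 2"
  obtains C where "C > 0" "\<And>eps w. 0 < eps \<Longrightarrow> eps \<le> 1 \<Longrightarrow> cmod (osc_int n eps w) \<le> C / (1 + \<bar>w\<bar>)"
proof -
  obtain C1 where C1: "C1 > 0" "\<And>eps t w. 0 < eps \<Longrightarrow> eps \<le> t \<Longrightarrow>
    (1 + \<bar>w\<bar>) * cmod (LINT r|lborel. indicator {0<..1} r *\<^sub>R (of_real r * ray eps r powr of_real (slice_exp n) * wave (w * r)))
      \<le> C1 * (3 + t) ^ n"
    by (rule osc_inner_bound[OF n], rule that)
  define M where "M = (LINT t|lborel. osc_bound n t)"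
  have M: "M \<ge> 0" unfolding M_def by (intro integral_nonneg_AE AE_I2 osc_bound_nonneg)
  have "cmod (osc_int n eps w) \<le> (C1 * M + 1) / (1 + \<bar>w\<bar>)" if eps: "0 < eps" "eps \<le> 1" for eps w
  proof -
    have "osc_int n eps w = (LINT t|lborel. LINT r|lborel. osc_kernel n eps w (r, t))"
      unfolding osc_int_def using lborel_pair.integral_snd[of "\<lambda>r t. osc_kernel n eps w (r, t)"]
        integrable_osc_kernel[OF n, of eps w] eps by simp
    also have "cmod \<dots> \<le> (LINT t|lborel. C1 / (1 + \<bar>w\<bar>) * osc_bound n t)"
    proof (rule Bochner_Integration.integral_norm_bound_integral)
      show "integrable lborel (\<lambda>t. LINT r|lborel. osc_kernel n eps w (r, t))"
        using lborel_pair.integrable_snd[of "\<lambda>r t. osc_kernel n eps w (r, t)"] integrable_osc_kernel[OF n, of eps w] eps by simp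
      show "integrable lborel (\<lambda>t. C1 / (1 + \<bar>w\<bar>) * osc_bound n t)"
        by (intro integrable_mult_right integrable_osc_bound n)
      fix t :: real
      show "cmod (LINT r|lborel. osc_kernel n eps w (r, t)) \<le> C1 / (1 + \<bar>w\<bar>) * osc_bound n t"
      proof (cases "t > 0")
        case True
        let ?J = "LINT r|lborel. indicator {0<..1} r *\<^sub>R (of_real r * ray (eps * t) r powr of_real (slice_exp n) * wave (w * r))"
        let ?p = "t powr (slice_exp n) * exp (- (2 * pi * t))"
        have "(LINT r|lborel. osc_kernel n eps w (r, t)) = (LINT r|lborel. of_real ?p * (indicator {0<..1} r *\<^sub>R (of_real r * ray (eps * t) r powr of_real (slice_exp n) * wave (w * r))))"
          using True by (intro Bochner_Integration.integral_cong)
            (auto simp: osc_kernel_def scaleR_conv_of_real mult_ac)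
        also have "\<dots> = of_real ?p * ?J" by (simp only: integral_mult_right_zero)
        finally have eq: "cmod (LINT r|lborel. osc_kernel n eps w (r, t)) = ?p * cmod ?J"
          by (simp only: norm_mult norm_of_real) simp
        have "eps * t \<le> t" "0 < eps * t" using eps True by auto
        then have "cmod ?J \<le> C1 * (3 + t) ^ n / (1 + \<bar>w\<bar>)"
          using C1(2)[of "eps * t" t w] by (simp only: pos_le_divide_eq[of "1 + \<bar>w\<bar>"] mult.commute)
        then have "?p * cmod ?J \<le> ?p * (C1 * (3 + t) ^ n / (1 + \<bar>w\<bar>))"
          by (rule mult_left_mono) simp
        then show ?thesis unfolding eq using True by (simp add: osc_bound_def mult_ac)
      next
        case False
        then have "osc_kernel n eps w (r, t) = 0" for r by (auto simp: osc_kernel_def)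
        then show ?thesis using C1(1) osc_bound_nonneg[of n t] by simp
      qed
    qed
    also have "\<dots> = C1 * M / (1 + \<bar>w\<bar>)" by (simp add: M_def)
    also have "\<dots> \<le> (C1 * M + 1) / (1 + \<bar>w\<bar>)" by (intro divide_right_mono) auto
    finally show ?thesis .
  qed
  moreover have "C1 * M + 1 > 0" using C1(1) M by (simp add: add_nonneg_pos)
  ultimately show ?thesis using that by blast
qed


text \<open>The chord has length \<open>2 * \<bar>sin ((x - y) / 2)\<bar>\<close>.\<close>

lemma norm_cis_diff_le: "cmod (cis x - cis y) \<le> \<bar>x - y\<bar>"
proof -
  have "(cmod (cis x - cis y))\<^sup>2 = (cos x - cos y)\<^sup>2 + (sin x - sin y)\<^sup>2"
    by (simp add: cmod_power2)
  also have "\<dots> = (sin x ^ 2 + cos x ^ 2) + (sin y ^ 2 + cos y ^ 2) - 2 * (cos x * cos y + sin x * sin y)"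
    by (simp add: power2_eq_square algebra_simps)
  also have "\<dots> = 2 - 2 * cos (x - y)" by (simp add: cos_diff)
  also have "\<dots> = (2 * sin ((x - y) / 2))\<^sup>2"
  proof -
    have "2 * ((x - y) / 2) = x - y" by simp
    then have "cos (x - y) = 1 - 2 * (sin ((x - y) / 2))\<^sup>2"
      using cos_double_sin[of "(x - y) / 2"] by (simp only:)
    then show ?thesis by (simp add: power_mult_distrib)
  qed
  also have "\<dots> \<le> \<bar>x - y\<bar>\<^sup>2"
    using abs_sin_x_le_abs_x[of "(x - y) / 2"] by (intro abs_le_square_iff[THEN iffD1]) (simp add: abs_mult)
  finally show ?thesis by (rule power2_le_imp_le) simp
qed

text \<open>At \<open>eps = 0\<close> and \<open>w = 0\<close> the base is
  \<open>2 * \<i> * r\<close>, so the kernel is a nonnegative function times a fixed nonzero complex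
  number and nothing cancels. Dominated convergence in \<open>eps = 1 / \<rho>\<close> and a
  Lipschitz bound in \<open>w\<close> carry the nonvanishing to large \<rho> and small
  \<open>w\<close>.\<close>

lemma osc_int_lower:
  assumes n: "n \<ge> 2"
  obtains c \<rho>0 where "c > 0" "\<rho>0 \<ge> 1" "\<And>\<rho> w. \<rho> \<ge> \<rho>0 \<Longrightarrow> \<bar>w\<bar> \<le> c \<Longrightarrow> c \<le> cmod (osc_int n (1 / \<rho>) w)"
proof -
  let ?D = "\<lambda>(r, t). indicator {0..1::real} r * (2 * osc_bound n t) :: real"
  define k where "k = slice_exp n"
  define Pos where "Pos = (\<lambda>(r, t). indicator {0<..1} r * indicator {0<..} t * r * (t powr k * exp (- (2 * pi * t))) * r powr k :: real)"
  define a where "a = ((2 * \<i>) powr of_real k :: complex)"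
  have a: "a \<noteq> 0" by (simp add: a_def)
  have ker0: "osc_kernel n 0 0 z = of_real (Pos z) * a" for z
  proof -
    obtain r t where z: "z = (r, t)" by force
    have "(2 * \<i> * of_real r) powr of_real k = of_real (r powr k) * a" if "r > 0"
    proof -
      have "(2 * \<i> * of_real r) powr of_real k = (of_real r * (2 * \<i>)) powr (of_real k :: complex)" by (simp add: mult.commute)
      also have "\<dots> = of_real r powr of_real k * a" unfolding a_def using that by (intro powr_times_real_left) auto
      also have "of_real r powr of_real k = (of_real (r powr k) :: complex)" using that by (intro powr_of_real) auto
      finally show ?thesis .
    qed
    then show ?thesis
      by (cases "0 < r \<and> r \<le> 1 \<and> 0 < t")
         (auto simp: z osc_kernel_def Pos_def k_def[symmetric] scaleR_conv_of_real simp del: of_real_diff of_real_divide)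
  qed
  have [measurable]: "Pos \<in> borel_measurable lborel2" unfolding Pos_def by measurable
  have Pos0: "Pos z \<ge> 0" for z by (auto simp: Pos_def indicator_def split: prod.split)
  have int0: "integrable lborel2 (osc_kernel n 0 0)" by (rule integrable_osc_kernel[OF n]) auto
  have "integrable lborel2 Pos"
  proof (rule Bochner_Integration.integrable_bound[OF integrable_mult_right[OF int0, of "1 / a"]])
    show "AE z in lborel2. norm (Pos z) \<le> norm (1 / a * osc_kernel n 0 0 z)"
      using a by (intro AE_I2) (simp add: ker0 norm_mult norm_divide)
  qed measurable
  define L where "L = osc_int n 0 0"
  have "L = of_real (LINT z|lborel2. Pos z) * a"
    unfolding L_def osc_int_def ker0 by simp
  moreover have "(LINT z|lborel2. Pos z) \<noteq> 0"
  proof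
    assume "(LINT z|lborel2. Pos z) = 0"
    then have "AE z in lborel2. Pos z = 0"
      using integral_nonneg_eq_0_iff_AE[OF \<open>integrable lborel2 Pos\<close>] Pos0 by auto
    \<comment> \<open>\<open>Pos\<close> is strictly positive on this square, which has measure
      1.\<close>
    then have "AE z in lborel2. z \<notin> {0<..1::real} \<times> {0<..1::real}"
      by eventually_elim (auto simp: Pos_def)
    moreover have "{0<..1::real} \<times> {0<..1::real} \<in> sets lborel2" by measurable
    ultimately have "emeasure lborel2 ({0<..1::real} \<times> {0<..1::real}) = 0"
      using AE_iff_null_sets by blast
    then show False by (simp add: lborel.emeasure_pair_measure_Times)
  qed
  ultimately have L: "L \<noteq> 0" using a by simp
  have "((\<lambda>\<rho>. osc_int n (1 / \<rho>) 0) \<longlongrightarrow> L) at_top"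
    unfolding L_def osc_int_def
  proof (rule integral_dominated_convergence_at_top[OF _ _ integrable_osc_dominant[OF n]])
    show "AE z in lborel2. ((\<lambda>\<rho>. osc_kernel n (1 / \<rho>) 0 z) \<longlongrightarrow> osc_kernel n 0 0 z) at_top"
    proof (rule AE_I2)
      fix z :: "real \<times> real"
      obtain r t where z: "z = (r, t)" by force
      show "((\<lambda>\<rho>. osc_kernel n (1 / \<rho>) 0 z) \<longlongrightarrow> osc_kernel n 0 0 z) at_top"
      proof (cases "0 < r")
        case True
        have "((\<lambda>\<rho>. 1 / \<rho> * t) \<longlongrightarrow> 0 * t) at_top"
          by (intro tendsto_mult tendsto_const tendsto_divide_0[OF tendsto_const] filterlim_at_top_imp_at_infinity filterlim_ident)
        then have "((\<lambda>\<rho>. of_real (1 / \<rho> * t) + 2 * \<i> * of_real r) \<longlongrightarrow> (of_real (0 * t) + 2 * \<i> * of_real r :: complex)) at_top"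
          by (rule tendsto_add[OF tendsto_of_real tendsto_const])
        then have "((\<lambda>\<rho>. ray (1 / \<rho> * t) r powr of_real (slice_exp n)) \<longlongrightarrow>
           (ray (0 * t) r powr of_real (slice_exp n) :: complex)) at_top"
          by (rule tendsto_powr_complex[OF quarter_plane_notin_nonpos[OF True] _ tendsto_const])
        then show ?thesis unfolding z osc_kernel_def prod.case
          by (rule tendsto_scaleR[OF tendsto_const tendsto_mult[OF _ tendsto_const]])
      qed (auto simp: z osc_kernel_def)
    qed
    show "\<forall>\<^sub>F \<rho> in at_top. AE z in lborel2. norm (osc_kernel n (1 / \<rho>) 0 z) \<le> (case z of (r, t) \<Rightarrow> indicator {0..1} r * (2 * osc_bound n t))"
      using eventually_ge_at_top[of 1]
      by eventually_elim (auto intro!: AE_I2 norm_osc_kernel_le n)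
  qed measurable
  then have "((\<lambda>\<rho>. cmod (osc_int n (1 / \<rho>) 0)) \<longlongrightarrow> cmod L) at_top" by (rule tendsto_norm)
  then have "eventually (\<lambda>\<rho>. cmod (osc_int n (1 / \<rho>) 0) > cmod L / 2) at_top"
    using L by (intro order_tendstoD) auto
  then obtain \<rho>1 where \<rho>1: "\<And>\<rho>. \<rho> \<ge> \<rho>1 \<Longrightarrow> cmod (osc_int n (1 / \<rho>) 0) > cmod L / 2"
    by (auto simp: eventually_at_top_linorder)
  define M where "M = (LINT z|lborel2. ?D z)"
  have M: "M \<ge> 0" unfolding M_def
    by (intro integral_nonneg_AE AE_I2) (auto simp: osc_bound_nonneg)
  \<comment> \<open>The Lipschitz constant is independent of \<open>eps\<close>: the phase varies by
    at most \<open>2 * pi * \<bar>w\<bar>\<close> because \<open>r \<le> 1\<close>.\<close>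
  have diff: "cmod (osc_int n eps w - osc_int n eps 0) \<le> 2 * pi * \<bar>w\<bar> * M" if eps: "0 \<le> eps" "eps \<le> 1" for eps w
  proof -
    have "osc_int n eps w - osc_int n eps 0 = (LINT z|lborel2. osc_kernel n eps w z - osc_kernel n eps 0 z)"
      unfolding osc_int_def by (intro Bochner_Integration.integral_diff[symmetric] integrable_osc_kernel n eps)
    also have "cmod \<dots> \<le> (LINT z|lborel2. 2 * pi * \<bar>w\<bar> * ?D z)"
    proof (rule Bochner_Integration.integral_norm_bound_integral)
      show "integrable lborel2 (\<lambda>z. osc_kernel n eps w z - osc_kernel n eps 0 z)"
        by (intro Bochner_Integration.integrable_diff integrable_osc_kernel n eps)
      show "integrable lborel2 (\<lambda>z. 2 * pi * \<bar>w\<bar> * ?D z)"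
        by (intro integrable_mult_right integrable_osc_dominant n)
      fix z :: "real \<times> real"
      obtain r t where z: "z = (r, t)" by force
      have k0: "osc_kernel n eps w (r, t) - osc_kernel n eps 0 (r, t) = osc_kernel n eps 0 (r, t) * (wave (w * r) - cis 0)"
        by (simp add: osc_kernel_def algebra_simps)
      have "cmod (osc_kernel n eps w (r, t) - osc_kernel n eps 0 (r, t)) \<le> indicator {0..1} r * (2 * osc_bound n t) * (2 * pi * \<bar>w\<bar>)"
      proof (cases "0 \<le> r \<and> r \<le> 1")
        case True
        have "cmod (wave (w * r) - cis 0) \<le> \<bar>- (2 * pi * (w * r)) - 0\<bar>" by (rule norm_cis_diff_le)
        also have "\<dots> = (2 * pi * \<bar>w\<bar>) * r" using True by (simp add: abs_mult)
        also have "\<dots> \<le> 2 * pi * \<bar>w\<bar>" using True by (intro mult_right_le_one_le) auto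
        finally have "cmod (wave (w * r) - cis 0) \<le> 2 * pi * \<bar>w\<bar>" .
        then show ?thesis unfolding k0 norm_mult
          by (intro mult_mono norm_osc_kernel_le n eps) (auto simp: osc_bound_nonneg)
      next
        case False
        then have "osc_kernel n eps u (r, t) = 0" for u by (auto simp: osc_kernel_def)
        then show ?thesis using osc_bound_nonneg[of n t] by simp
      qed
      then show "cmod (osc_kernel n eps w z - osc_kernel n eps 0 z) \<le> 2 * pi * \<bar>w\<bar> * ?D z"
        by (simp add: z mult_ac)
    qed
    also have "\<dots> = 2 * pi * \<bar>w\<bar> * M" unfolding M_def by (rule integral_mult_right_zero)
    finally show ?thesis .
  qed
  \<comment> \<open>One half of the limit modulus goes to the convergence in \<open>\<rho>\<close>
    and one quarter to the change of \<open>w\<close>; \<open>M + 1\<close> keeps the denominator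
    positive.\<close>
  define c where "c = min (cmod L / 4) (cmod L / (8 * pi * (M + 1)))"
  have M1: "8 * pi * (M + 1) > 0" using M by simp
  have c: "c > 0" using L M1 by (simp add: c_def)
  show ?thesis
  proof (rule that[of c "max 1 \<rho>1"])
    fix \<rho> w assume \<rho>: "max 1 \<rho>1 \<le> \<rho>" and w: "\<bar>w\<bar> \<le> c"
    have "2 * pi * \<bar>w\<bar> * M \<le> 2 * pi * \<bar>w\<bar> * (M + 1)" using M by (intro mult_left_mono) auto
    also have "\<dots> = (8 * pi * (M + 1)) * \<bar>w\<bar> / 4" by simp
    also have "\<dots> \<le> (8 * pi * (M + 1)) * (cmod L / (8 * pi * (M + 1))) / 4"
      using w M1 by (intro divide_right_mono mult_left_mono) (auto simp: c_def)
    also have "\<dots> = cmod L / 4" using M by simp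
    finally have 1: "cmod (osc_int n (1 / \<rho>) w - osc_int n (1 / \<rho>) 0) \<le> cmod L / 4"
      using diff[of "1 / \<rho>" w] \<rho> by simp
    have "cmod (osc_int n (1 / \<rho>) 0) \<le> cmod (osc_int n (1 / \<rho>) w) + cmod (osc_int n (1 / \<rho>) w - osc_int n (1 / \<rho>) 0)"
      by (metis add.commute norm_minus_commute norm_triangle_sub)
    then show "c \<le> cmod (osc_int n (1 / \<rho>) w)"
      using \<rho>1[of \<rho>] \<rho> 1 by (simp add: c_def)
  qed (use c in auto)
qed

section \<open>Radial moments at a fixed slope, for frequencies near the axis\<close>

definition moment_int :: "nat \<Rightarrow> real \<Rightarrow> complex"
  where "moment_int m w = (LINT r|lborel. indicator {0..1} r *\<^sub>R (of_real (r ^ m) * wave (w * r)))"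

lemma integrable_moment:
  "integrable lborel (\<lambda>r. indicator {0..1} r *\<^sub>R (of_real (r ^ m) * wave (w * r)))"
proof -
  have "continuous_on {0..1} (\<lambda>r. of_real (r ^ m) * wave (w * r))"
    unfolding cis_conv_exp by (intro continuous_intros)
  then show ?thesis using borel_integrable_atLeastAtMost'[of 0 1] by (simp add: set_integrable_def)
qed

lemma norm_moment_int_le_1: "cmod (moment_int m w) \<le> 1"
proof -
  have "cmod (moment_int m w) \<le> (LINT r|lborel. indicator {0..1::real} r)"
    unfolding moment_int_def
  proof (rule Bochner_Integration.integral_norm_bound_integral[OF integrable_moment])
    fix r :: real
    show "cmod (indicator {0..1} r *\<^sub>R (of_real (r ^ m) * wave (w * r))) \<le> indicator {0..1} r"
      by (cases "r \<in> {0..1}") (auto simp: norm_mult norm_power power_le_one)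
  qed simp
  then show ?thesis by simp
qed

text \<open>Integration by parts. For \<open>m = 0\<close> the value at \<open>r = 0\<close>
  survives, since \<open>0 ^ 0 = 1\<close>, and the truncated \<open>m - 1\<close> is multiplied by
  0.\<close>

lemma moment_int_recursion:
  "2 * of_real pi * \<i> * of_real w * moment_int m w =
     of_nat m * moment_int (m - 1) w - wave w + (if m = 0 then 1 else 0)"
proof -
  let ?a = "2 * of_real pi * \<i> * of_real w :: complex"
  let ?e = "\<lambda>r::real. wave (w * r)"
  have e: "?e r = exp (- ?a * of_real r)" for r by (simp add: cis_conv_exp mult_ac)
  have "(LINT r|lborel. indicator {0..1} r *\<^sub>R (of_nat m * (of_real (r ^ (m - 1)) * ?e r) - ?a * (of_real (r ^ m) * ?e r)))
     = of_real (1 ^ m) * ?e 1 - of_real (0 ^ m) * ?e 0"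
  proof (rule integral_FTC_Icc)
    fix r :: real
    have "((\<lambda>z. z ^ m * exp (- ?a * z)) has_field_derivative
       of_nat m * (of_real r ^ (m - 1) * exp (- ?a * of_real r)) - ?a * (of_real r ^ m * exp (- ?a * of_real r))) (at (of_real r))"
      by (auto intro!: derivative_eq_intros simp: algebra_simps)
    then have "((\<lambda>r. of_real r ^ m * exp (- ?a * of_real r)) has_vector_derivative
       of_nat m * (of_real r ^ (m - 1) * exp (- ?a * of_real r)) - ?a * (of_real r ^ m * exp (- ?a * of_real r))) (at r within {0..1})"
      by (rule has_vector_derivative_real_field)
    then show "((\<lambda>r. of_real (r ^ m) * ?e r) has_vector_derivative
       of_nat m * (of_real (r ^ (m - 1)) * ?e r) - ?a * (of_real (r ^ m) * ?e r)) (at r within {0..1})"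
      unfolding e by simp
  next
    show "continuous_on {0..1} (\<lambda>r. of_nat m * (of_real (r ^ (m - 1)) * ?e r) - ?a * (of_real (r ^ m) * ?e r))"
      unfolding e by (intro continuous_intros)
  qed simp
  also have "(LINT r|lborel. indicator {0..1} r *\<^sub>R (of_nat m * (of_real (r ^ (m - 1)) * ?e r) - ?a * (of_real (r ^ m) * ?e r)))
    = (LINT r|lborel. of_nat m * (indicator {0..1} r *\<^sub>R (of_real (r ^ (m - 1)) * ?e r)) - ?a * (indicator {0..1} r *\<^sub>R (of_real (r ^ m) * ?e r)))"
    by (intro Bochner_Integration.integral_cong) (auto simp: indicator_def)
  also have "\<dots> = of_nat m * moment_int (m - 1) w - ?a * moment_int m w"
    unfolding moment_int_def
    by (subst Bochner_Integration.integral_diff)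
       (simp_all only: integral_mult_right_zero integrable_mult_right integrable_moment)
  finally have "of_nat m * moment_int (m - 1) w - ?a * moment_int m w = wave w - (if m = 0 then 1 else 0)"
    by (simp add: power_0_left)
  then show ?thesis by (simp add: algebra_simps split: if_splits)
qed

lemma moment_int_bound: "\<bar>w\<bar> * cmod (moment_int m w) \<le> real m + 2"
proof -
  have "\<bar>w\<bar> * cmod (moment_int m w) \<le> 2 * pi * (\<bar>w\<bar> * cmod (moment_int m w))"
    using mult_right_mono[of 1 "2 * pi" "\<bar>w\<bar> * cmod (moment_int m w)"] pi_gt3 by simp
  also have "\<dots> = cmod (2 * of_real pi * \<i> * of_real w * moment_int m w)" by (simp add: norm_mult)
  also have "\<dots> \<le> cmod (of_nat m * moment_int (m - 1) w) + cmod (wave w) + cmod (if m = 0 then 1 else 0)"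
    unfolding moment_int_recursion by (intro order_trans[OF norm_triangle_ineq] add_mono norm_triangle_ineq4 order_refl)
  also have "\<dots> \<le> real m * 1 + 1 + 1"
    using norm_moment_int_le_1[of "m - 1" w] by (intro add_mono) (auto simp: norm_mult mult_left_le)
  finally show ?thesis by simp
qed

text \<open>The main term is the boundary value at \<open>r = 1\<close>, that is, at the rim of the
  cone. What remains is a lower moment, which itself decays like 1/w.\<close>

lemma moment_int_asymp:
  assumes m: "m \<ge> 1" and w: "w > 0"
  shows "cmod (2 * of_real pi * \<i> * of_real w * moment_int m w + wave w) \<le> real m * (real m + 1) / w"
proof -
  have "w * cmod (moment_int (m - 1) w) \<le> real m + 1"
    using moment_int_bound[of w "m - 1"] m w by (simp add: of_nat_diff)
  then have "cmod (moment_int (m - 1) w) \<le> (real m + 1) / w" using w by (simp add: pos_le_divide_eq mult.commute)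
  then have "real m * cmod (moment_int (m - 1) w) \<le> real m * ((real m + 1) / w)" by (intro mult_left_mono) auto
  then show ?thesis unfolding moment_int_recursion using m by (simp add: norm_mult)
qed

definition cone_int :: "nat \<Rightarrow> real \<Rightarrow> real \<Rightarrow> complex"
  where "cone_int n \<rho> \<tau> = (LINT z|lborel2. cone_kernel n \<rho> \<tau> z)"

lemma cone_int_moment:
  assumes n: "n \<ge> 2"
  shows "cone_int n \<rho> \<tau> = (LINT y|lborel. of_real (1 / jb y ^ n) * moment_int (n - 1) (\<rho> * (y / jb y) + \<tau>))" (is ?eq)
    and "integrable lborel (\<lambda>y. of_real (1 / jb y ^ n) * moment_int (n - 1) (\<rho> * (y / jb y) + \<tau>))" (is ?int)
proof -
  have *: "(LINT r|lborel. cone_kernel n \<rho> \<tau> (y, r)) = of_real (1 / jb y ^ n) * moment_int (n - 1) (\<rho> * (y / jb y) + \<tau>)" for y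
    unfolding moment_int_def integral_mult_right_zero[symmetric]
    by (intro Bochner_Integration.integral_cong)
       (auto simp: cone_kernel_def scaleR_conv_of_real mult_ac)
  show ?eq ?int
    using lborel_pair.integral_fst'[OF integrable_cone_kernel[OF n, of \<rho> \<tau>]]
      lborel_pair.integrable_fst'[OF integrable_cone_kernel[OF n, of \<rho> \<tau>]]
    by (simp_all only: * cone_int_def)
qed


section \<open>Two-sided bounds through the distance to the light cone \<bar>\<tau>\<bar> =
  \<rho>\<close>

abbreviation layers :: "real \<Rightarrow> real \<Rightarrow> real"
  where "layers \<rho> \<tau> \<equiv> 1 / (1 + \<bar>\<rho> + \<tau>\<bar>) + 1 / (1 + \<bar>\<rho> - \<tau>\<bar>)"

text \<open>For \<open>\<rho> \<le> 1\<close> every slope sees a frequency within 1 of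
  \<open>\<tau>\<close>, so the moment bound at fixed slope survives integration over the
  slopes.\<close>

lemma cone_int_upper_small:
  assumes n: "n \<ge> 2"
  obtains C where "C > 0" "\<And>\<rho> \<tau>. 0 \<le> \<rho> \<Longrightarrow> \<rho> \<le> 1 \<Longrightarrow> cmod (cone_int n \<rho> \<tau>) \<le> C / (1 + \<bar>\<tau>\<bar>)"
proof -
  define S where "S = (LINT y|lborel. 1 / jb y ^ n)"
  have S: "S \<ge> 0" unfolding S_def by (intro integral_nonneg_AE AE_I2) auto
  have J: "cmod (moment_int (n - 1) (\<rho> * v + \<tau>)) \<le> 4 * (real n + 1) / (1 + \<bar>\<tau>\<bar>)"
    if "0 \<le> \<rho>" "\<rho> \<le> 1" "\<bar>v\<bar> \<le> 1" for \<rho> \<tau> v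
  proof (cases "\<bar>\<tau>\<bar> \<le> 2")
    case True
    have "cmod (moment_int (n - 1) (\<rho> * v + \<tau>)) * (1 + \<bar>\<tau>\<bar>) \<le> 1 * 3"
      using norm_moment_int_le_1 True by (intro mult_mono) auto
    also have "\<dots> \<le> 4 * (real n + 1)" by simp
    finally show ?thesis by (simp add: pos_le_divide_eq)
  next
    case False
    have "\<bar>\<rho> * v\<bar> \<le> 1" using that by (simp add: abs_mult mult_le_one)
    moreover have "1 + \<bar>\<tau>\<bar> \<le> 4 * \<bar>x + \<tau>\<bar>" if "\<bar>x\<bar> \<le> 1" for x
      using abs_triangle_ineq4[of "x + \<tau>" x] False that by simp
    ultimately have "1 + \<bar>\<tau>\<bar> \<le> 4 * \<bar>\<rho> * v + \<tau>\<bar>" by blast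
    then have "cmod (moment_int (n - 1) (\<rho> * v + \<tau>)) * (1 + \<bar>\<tau>\<bar>) \<le> cmod (moment_int (n - 1) (\<rho> * v + \<tau>)) * (4 * \<bar>\<rho> * v + \<tau>\<bar>)"
      by (intro mult_left_mono) auto
    also have "\<dots> = 4 * (\<bar>\<rho> * v + \<tau>\<bar> * cmod (moment_int (n - 1) (\<rho> * v + \<tau>)))" by simp
    also have "\<dots> \<le> 4 * (real n + 1)" using moment_int_bound[of "\<rho> * v + \<tau>" "n - 1"] n by (simp add: of_nat_diff)
    finally show ?thesis by (simp add: pos_le_divide_eq)
  qed
  have v: "\<bar>y / jb y\<bar> \<le> 1" for y :: real
    by (rule less_imp_le[OF abs_slice_map_less_1])
  show ?thesis
  proof (rule that[of "S * (4 * (real n + 1)) + 1"])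
    show "S * (4 * (real n + 1)) + 1 > 0" using S by (simp add: add_nonneg_pos)
    fix \<rho> \<tau> :: real assume \<rho>: "0 \<le> \<rho>" "\<rho> \<le> 1"
    have "cmod (cone_int n \<rho> \<tau>) \<le> (LINT y|lborel. 1 / jb y ^ n * (4 * (real n + 1) / (1 + \<bar>\<tau>\<bar>)))"
      unfolding cone_int_moment(1)[OF n]
    proof (rule Bochner_Integration.integral_norm_bound_integral[OF cone_int_moment(2)[OF n]])
      show "integrable lborel (\<lambda>y::real. 1 / jb y ^ n * (4 * (real n + 1) / (1 + \<bar>\<tau>\<bar>)))"
        by (intro integrable_mult_left integrable_inverse_sqrt_power n)
      show "cmod (of_real (1 / jb y ^ n) * moment_int (n - 1) (\<rho> * (y / jb y) + \<tau>))
          \<le> 1 / jb y ^ n * (4 * (real n + 1) / (1 + \<bar>\<tau>\<bar>))" for y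
        unfolding norm_mult norm_of_real using J[OF \<rho> v[of y], of \<tau>]
        by (intro mult_mono) (auto simp: add_nonneg_nonneg)
    qed
    also have "\<dots> = S * (4 * (real n + 1) / (1 + \<bar>\<tau>\<bar>))"
      unfolding S_def by (rule integral_mult_left_zero)
    also have "\<dots> = S * (4 * (real n + 1)) / (1 + \<bar>\<tau>\<bar>)" by simp
    also have "\<dots> \<le> (S * (4 * (real n + 1)) + 1) / (1 + \<bar>\<tau>\<bar>)" by (intro divide_right_mono) auto
    finally show "cmod (cone_int n \<rho> \<tau>) \<le> (S * (4 * (real n + 1)) + 1) / (1 + \<bar>\<tau>\<bar>)" .
  qed
qed

lemma cone_int_upper_large:
  assumes n: "n \<ge> 2"
  obtains C where "C > 0" "\<And>\<rho> \<tau>. 1 \<le> \<rho> \<Longrightarrow> cmod (cone_int n \<rho> \<tau>) \<le>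
    C * \<rho> powr (- (real n - 1) / 2) * layers \<rho> \<tau>"
proof -
  obtain C where C: "C > 0" "\<And>eps w. 0 < eps \<Longrightarrow> eps \<le> 1 \<Longrightarrow> cmod (osc_int n eps w) \<le> C / (1 + \<bar>w\<bar>)"
    by (rule osc_int_bound[OF n], rule that)
  show ?thesis
  proof (rule that[OF C(1)])
    fix \<rho> \<tau> :: real assume \<rho>: "1 \<le> \<rho>"
    have "cmod (osc_sum n \<rho> \<tau>)
      \<le> cmod (osc_int n (1 / \<rho>) (\<rho> + \<tau>)) + cmod (osc_int n (1 / \<rho>) (\<rho> - \<tau>))"
      by (rule order_trans[OF norm_triangle_ineq]) (simp add: norm_mult)
    also have "\<dots> \<le> C / (1 + \<bar>\<rho> + \<tau>\<bar>) + C / (1 + \<bar>\<rho> - \<tau>\<bar>)"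
      using C(2)[of "1 / \<rho>"] \<rho> by (intro add_mono) auto
    also have "\<dots> = C * layers \<rho> \<tau>" by (simp add: distrib_left)
    finally show "cmod (cone_int n \<rho> \<tau>) \<le>
      C * \<rho> powr (- (real n - 1) / 2) * layers \<rho> \<tau>"
      unfolding cone_int_def cone_kernel_integral_osc[OF n \<rho>] norm_mult norm_of_real
      by (simp only: abs_of_nonneg[OF powr_ge_zero] mult.assoc mult.left_commute[of C] mult_left_mono powr_ge_zero)
  qed
qed

text \<open>Glues the two ranges of \<open>\<rho>\<close>. For \<open>\<rho> \<le> 1\<close>,
  \<open>1 + \<rho>\<close> is at most 2 and \<open>1 + \<bar>\<rho> - \<tau>\<bar>\<close> at most
  twice \<open>1 + \<bar>\<tau>\<bar>\<close>; for \<open>\<rho> > 1\<close>,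
  \<open>1 + \<rho>\<close> is at most \<open>2 * \<rho>\<close>.\<close>

lemma cone_int_upper:
  assumes n: "n \<ge> 2"
  obtains C where "C > 0" "\<And>\<rho> \<tau>. 0 \<le> \<rho> \<Longrightarrow> cmod (cone_int n \<rho> \<tau>) \<le>
    C * (1 + \<rho>) powr (- (real n - 1) / 2) * layers \<rho> \<tau>"
proof -
  obtain C1 where C1: "C1 > 0" "\<And>\<rho> \<tau>. 0 \<le> \<rho> \<Longrightarrow> \<rho> \<le> 1 \<Longrightarrow> cmod (cone_int n \<rho> \<tau>) \<le> C1 / (1 + \<bar>\<tau>\<bar>)"
    by (rule cone_int_upper_small[OF n], rule that)
  obtain C2 where C2: "C2 > 0" "\<And>\<rho> \<tau>. 1 \<le> \<rho> \<Longrightarrow> cmod (cone_int n \<rho> \<tau>) \<le>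
    C2 * \<rho> powr (- (real n - 1) / 2) * layers \<rho> \<tau>"
    by (rule cone_int_upper_large[OF n], rule that)
  define a where "a = - (real n - 1) / 2"
  have a: "a \<le> 0" using n by (simp add: a_def)
  have two: "2 powr a * 2 powr (- a) = (1::real)" by (simp add: powr_minus)
  define C where "C = 2 powr (- a) * (C1 * 2 + C2)"
  have C: "C > 0" using C1(1) C2(1) by (simp add: C_def)
  have "cmod (cone_int n \<rho> \<tau>) \<le> C * (1 + \<rho>) powr a * layers \<rho> \<tau>" if \<rho>: "0 \<le> \<rho>" for \<rho> \<tau>
  proof -
    define E where "E = 1 / (1 + \<bar>\<rho> + \<tau>\<bar>) + 1 / (1 + \<bar>\<rho> - \<tau>\<bar>)"
    have E: "E \<ge> 0" by (simp add: E_def)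
    show ?thesis
    proof (cases "\<rho> \<le> 1")
      case True
      have "1 + \<bar>\<rho> - \<tau>\<bar> \<le> 2 * (1 + \<bar>\<tau>\<bar>)" using abs_triangle_ineq4[of \<rho> \<tau>] True \<rho> by simp
      then have "1 / (1 + \<bar>\<tau>\<bar>) \<le> 2 / (1 + \<bar>\<rho> - \<tau>\<bar>)"
      proof -
        have "0 < 1 + \<bar>\<rho> - \<tau>\<bar>" by (simp add: add_pos_nonneg)
        then have "(2 * 1) / (2 * (1 + \<bar>\<tau>\<bar>)) \<le> 2 / (1 + \<bar>\<rho> - \<tau>\<bar>)"
          using \<open>1 + \<bar>\<rho> - \<tau>\<bar> \<le> 2 * (1 + \<bar>\<tau>\<bar>)\<close> by (intro frac_le) auto
        then show ?thesis by (subst (asm) mult_divide_mult_cancel_left) auto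
      qed
      also have "\<dots> \<le> 2 * E" by (simp add: E_def)
      finally have "C1 / (1 + \<bar>\<tau>\<bar>) \<le> C1 * (2 * E)" using C1(1) by (simp add: divide_inverse mult_left_mono)
      moreover have "(2::real) powr a \<le> (1 + \<rho>) powr a" using True \<rho> a by (intro powr_mono2') auto
      then have "1 \<le> 2 powr (- a) * (1 + \<rho>) powr a"
        using mult_left_mono[of "2 powr a" "(1 + \<rho>) powr a" "2 powr (- a)"] two by (simp add: mult.commute)
      then have "(C1 * 2 * E) * 1 \<le> (C1 * 2 * E) * (2 powr (- a) * (1 + \<rho>) powr a)"
        using C1(1) E by (intro mult_left_mono) auto
      moreover have "(C1 * 2 * E) * (2 powr (- a) * (1 + \<rho>) powr a) \<le> C * (1 + \<rho>) powr a * E"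
      proof -
        have "0 \<le> 2 powr (- a) * C2 * (1 + \<rho>) powr a * E" using C2(1) E by simp
        then show ?thesis by (simp add: C_def algebra_simps)
      qed
      ultimately show ?thesis unfolding E_def[symmetric] using C1(2)[OF \<rho> True, of \<tau>] by (simp add: mult_ac)
    next
      case False
      have "(2 * \<rho>) powr a \<le> (1 + \<rho>) powr a" using False a by (intro powr_mono2') auto
      then have "2 powr (-a) * (2 powr a * \<rho> powr a) \<le> 2 powr (-a) * (1 + \<rho>) powr a"
        using False by (simp add: powr_mult)
      then have p: "\<rho> powr a \<le> 2 powr (-a) * (1 + \<rho>) powr a"
      proof -
        have "2 powr (-a) * (2 powr a * \<rho> powr a) = (2 powr a * 2 powr (- a)) * \<rho> powr a" by (simp only: mult_ac)
        also have "\<dots> = \<rho> powr a" unfolding two by simp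
        finally show ?thesis using \<open>2 powr (-a) * (2 powr a * \<rho> powr a) \<le> _\<close> by argo
      qed
      have "cmod (cone_int n \<rho> \<tau>) \<le> C2 * \<rho> powr a * E"
        using C2(2)[of \<rho> \<tau>] False by (simp add: a_def E_def)
      also have "\<dots> \<le> C2 * (2 powr (-a) * (1 + \<rho>) powr a) * E"
        using p C2(1) E by (intro mult_right_mono mult_left_mono) auto
      also have "\<dots> \<le> C * (1 + \<rho>) powr a * E"
      proof -
        have "0 \<le> 2 powr (- a) * (C1 * 2) * (1 + \<rho>) powr a * E" using C1(1) E by simp
        then show ?thesis by (simp add: C_def algebra_simps)
      qed
      finally show ?thesis unfolding E_def .
    qed
  qed
  with C that show ?thesis unfolding a_def by blast
qed

text \<open>Near the ridge only the conjugate term of \<open>osc_sum\<close> resonates. In the other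
  one \<open>1 + \<bar>\<rho> + \<tau>\<bar> \<ge> \<rho>\<close>, so it is at most
  \<open>C / \<rho>\<close>, and \<open>\<rho> \<ge> 2 * C / c\<close> makes this at most half of
  the resonant term.\<close>

lemma cone_int_lower_ridge:
  assumes n: "n \<ge> 2"
  obtains c \<rho>0 where "c > 0" "\<rho>0 \<ge> 1" "\<And>\<rho> \<tau>. \<rho> \<ge> \<rho>0 \<Longrightarrow> \<bar>\<rho> - \<tau>\<bar> \<le> c \<Longrightarrow>
    c * \<rho> powr (- (real n - 1) / 2) \<le> cmod (cone_int n \<rho> \<tau>)"
proof -
  obtain C where C: "C > 0" "\<And>eps w. 0 < eps \<Longrightarrow> eps \<le> 1 \<Longrightarrow> cmod (osc_int n eps w) \<le> C / (1 + \<bar>w\<bar>)"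
    by (rule osc_int_bound[OF n], rule that)
  obtain c \<rho>0 where c: "c > 0" "\<rho>0 \<ge> 1" "\<And>\<rho> w. \<rho> \<ge> \<rho>0 \<Longrightarrow> \<bar>w\<bar> \<le> c \<Longrightarrow> c \<le> cmod (osc_int n (1 / \<rho>) w)"
    by (rule osc_int_lower[OF n], rule that)
  define c' where "c' = min (c / 2) 1"
  show ?thesis
  proof (rule that[of c' "max \<rho>0 (2 * C / c)"])
    show "c' > 0" using c by (simp add: c'_def)
    show "1 \<le> max \<rho>0 (2 * C / c)" using c by simp
    fix \<rho> \<tau> assume \<rho>: "max \<rho>0 (2 * C / c) \<le> \<rho>" and \<tau>: "\<bar>\<rho> - \<tau>\<bar> \<le> c'"
    have \<rho>1: "\<rho> \<ge> 1" using \<rho> c by simp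
    have "\<rho> \<le> 1 + \<bar>\<rho> + \<tau>\<bar>" 
    proof -
      have "\<bar>\<rho> - \<tau>\<bar> \<le> 1" using \<tau> by (simp add: c'_def)
      then show ?thesis using \<rho>1 abs_ge_self[of "\<rho> - \<tau>"] abs_ge_self[of "\<rho> + \<tau>"] by linarith
    qed
    then have "C / (1 + \<bar>\<rho> + \<tau>\<bar>) \<le> C / \<rho>" using C(1) \<rho>1 by (intro divide_left_mono) auto
    also have "C / \<rho> \<le> c / 2"
    proof -
      have "2 * C / c \<le> \<rho>" using \<rho> by simp
      then have "2 * C \<le> \<rho> * c" using c(1) by (simp add: pos_divide_le_eq)
      then show ?thesis using \<rho>1 by (simp add: divide_simps mult.commute)
    qed
    finally have "C / (1 + \<bar>\<rho> + \<tau>\<bar>) \<le> c / 2" .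
    have 1: "cmod (osc_int n (1 / \<rho>) (\<rho> + \<tau>)) \<le> c / 2"
    proof -
      have "0 < 1 / \<rho>" "1 / \<rho> \<le> 1" using \<rho>1 by auto
      from order_trans[OF C(2)[OF this]] show ?thesis using \<open>C / (1 + \<bar>\<rho> + \<tau>\<bar>) \<le> c / 2\<close> .
    qed
    have 2: "c \<le> cmod (osc_int n (1 / \<rho>) (\<rho> - \<tau>))"
      using c(3)[of \<rho> "\<rho> - \<tau>"] \<rho> \<tau> c(1) by (simp add: c'_def)
    have "cmod (cnj (\<i> * osc_int n (1 / \<rho>) (\<rho> - \<tau>))) - cmod (\<i> * osc_int n (1 / \<rho>) (\<rho> + \<tau>))
      \<le> cmod (osc_sum n \<rho> \<tau>)"
      by (metis add.commute norm_diff_ineq)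
    then have "c' \<le> cmod (osc_sum n \<rho> \<tau>)"
      using 1 2 by (simp add: norm_mult c'_def del: complex_cnj_mult)
    then have "\<rho> powr (- (real n - 1) / 2) * c' \<le> \<rho> powr (- (real n - 1) / 2) * cmod (osc_sum n \<rho> \<tau>)"
      by (rule mult_left_mono) simp
    then show "c' * \<rho> powr (- (real n - 1) / 2) \<le> cmod (cone_int n \<rho> \<tau>)"
      unfolding cone_int_def cone_kernel_integral_osc[OF n \<rho>1] norm_mult norm_of_real
      by (simp only: abs_of_nonneg[OF powr_ge_zero] mult.commute)
  qed
qed

text \<open>For small \<open>\<rho>\<close> all slopes produce nearly the same rim term, the
  negative of \<open>wave \<tau>\<close> over 2 \<pi> \<i> \<tau>, with relative error at most 1/2.
  The slopes therefore cannot cancel, and the total is at least S / (4 \<pi> \<tau>).\<close>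

lemma cone_int_lower_axis:
  assumes n: "n \<ge> 2"
  obtains c T where "c > 0" "T \<ge> 1" "\<And>\<rho> \<tau>. 0 \<le> \<rho> \<Longrightarrow> \<rho> \<le> c \<Longrightarrow> T \<le> \<tau> \<Longrightarrow> c / \<tau> \<le> cmod (cone_int n \<rho> \<tau>)"
proof -
  define S where "S = (LINT y|lborel. 1 / jb y ^ n)"
  have intS: "integrable lborel (\<lambda>y::real. 1 / jb y ^ n)" by (rule integrable_inverse_sqrt_power[OF n])
  have S: "S > 0"
  proof -
    have "0 < (LINT y|lborel. 1 / sqrt 2 ^ n * indicator {0..1::real} y)" by simp
    also have "\<dots> \<le> S" unfolding S_def
    proof (rule integral_mono[OF _ intS])
      fix y :: real
      show "1 / sqrt 2 ^ n * indicator {0..1} y \<le> 1 / jb y ^ n"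
      proof (cases "y \<in> {0..1}")
        case True
        then have "y\<^sup>2 \<le> 1" by (simp add: power_le_one)
        then have "jb y ^ n \<le> sqrt 2 ^ n" by (intro power_mono) auto
        moreover have "jb y > 0" by (simp add: add_pos_nonneg)
        ultimately show ?thesis using True by (auto intro!: divide_left_mono mult_pos_pos zero_less_power)
      qed auto
    qed auto
    finally show ?thesis .
  qed
  \<comment> \<open>The first bound makes \<open>2 * pi * \<rho> \<le> 1 / 8\<close>, which is spent
    twice; the second is S/2 divided by 2 \<pi>. In \<open>T\<close>, the entry 2 gives
    \<open>w \<ge> \<tau> / 2\<close>, and \<open>8 * real n * real n\<close> brings the error of
    \<open>moment_int_asymp\<close> down to 1/4.\<close>
  define c where "c = min (1 / (16 * pi)) (S / (4 * pi))"
  define T where "T = max 2 (8 * real n * real n)"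
  have c: "c > 0" "c \<le> 1 / (16 * pi)" "c \<le> S / (4 * pi)" using S by (auto simp: c_def)
  have c1: "c \<le> 1"
  proof -
    have "1 / (16 * pi) \<le> 1" using pi_gt3 by simp
    with c(2) show ?thesis by linarith
  qed
  show ?thesis
  proof (rule that[of c T])
    show "1 \<le> T" by (simp add: T_def)
    fix \<rho> \<tau> :: real assume \<rho>: "0 \<le> \<rho>" "\<rho> \<le> c" and \<tau>: "T \<le> \<tau>"
    have \<tau>0: "\<tau> \<ge> 2" "8 * real n * real n \<le> \<tau>" using \<tau> by (auto simp: T_def)
    let ?a = "2 * of_real pi * \<i> :: complex"
    have J: "cmod (?a * of_real \<tau> * moment_int (n - 1) (\<rho> * v + \<tau>) + wave \<tau>) \<le> 1 / 2" if v: "\<bar>v\<bar> \<le> 1" for v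
    proof -
      define w where "w = \<rho> * v + \<tau>"
      have rv: "\<bar>\<rho> * v\<bar> \<le> \<rho>" using \<rho> v by (simp add: abs_mult mult_left_le)
      then have w: "w \<ge> \<tau> / 2" using \<rho> c1 \<tau>0 unfolding w_def by linarith
      have w0: "w > 0" using w \<tau>0 by linarith
      have "real (n - 1) * (real (n - 1) + 1) / w \<le> real n * real n / (\<tau> / 2)"
        using w \<tau>0 n by (intro frac_le mult_mono) (auto simp: of_nat_diff)
      also have "\<dots> = 8 * real n * real n / \<tau> / 4" by simp
      also have "\<dots> \<le> 1 / 4" using \<tau>0 by simp
      finally have "real (n - 1) * (real (n - 1) + 1) / w \<le> 1 / 4" .
      moreover have "1 \<le> n - 1" using n by simp
      ultimately have 1: "cmod (?a * of_real w * moment_int (n - 1) w + wave w) \<le> 1 / 4"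
        using moment_int_asymp[of "n - 1" w] w0 by (meson order_trans)
      have pi\<rho>: "2 * pi * \<bar>\<rho> * v\<bar> \<le> 1 / 8"
      proof -
        have "2 * pi * \<bar>\<rho> * v\<bar> \<le> 2 * pi * (1 / (16 * pi))"
          using rv \<rho> c(2) by (intro mult_left_mono) auto
        then show ?thesis by simp
      qed
      have 2: "cmod (?a * of_real (\<rho> * v) * moment_int (n - 1) w) \<le> 1 / 8"
      proof -
        have "cmod (?a * of_real (\<rho> * v) * moment_int (n - 1) w) = 2 * pi * \<bar>\<rho> * v\<bar> * cmod (moment_int (n - 1) w)"
          by (simp add: norm_mult abs_mult)
        also have "\<dots> \<le> 2 * pi * \<bar>\<rho> * v\<bar> * 1" by (intro mult_left_mono norm_moment_int_le_1) auto
        finally show ?thesis using pi\<rho> by simp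
      qed
      have "cmod (wave \<tau> - wave w) \<le> \<bar>- (2 * pi * \<tau>) - - (2 * pi * w)\<bar>" by (rule norm_cis_diff_le)
      also have "- (2 * pi * \<tau>) - - (2 * pi * w) = 2 * pi * (\<rho> * v)" by (simp add: w_def algebra_simps)
      also have "\<bar>\<dots>\<bar> \<le> 1 / 8" using pi\<rho> by (simp add: abs_mult)
      finally have 3: "cmod (wave \<tau> - wave w) \<le> 1 / 8" .
      \<comment> \<open>\<open>A\<close> is the error at the true frequency \<open>w\<close>;
        \<open>B\<close> and \<open>D\<close> replace \<open>w\<close> by \<open>\<tau>\<close> in
        the factor and in the phase. The bounds 1/4, 1/8 and 1/8 add up to 1/2.\<close>
      define A where "A = ?a * of_real w * moment_int (n - 1) w + wave w"
      define B where "B = ?a * of_real (\<rho> * v) * moment_int (n - 1) w"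
      define D where "D = wave \<tau> - wave w"
      have "?a * of_real \<tau> * moment_int (n - 1) w + wave \<tau> = A - B + D"
        by (simp add: A_def B_def D_def w_def algebra_simps)
      also have "cmod (A - B + D) \<le> 1 / 2"
        using norm_triangle_ineq[of "A - B" D] norm_triangle_ineq4[of A B] 1 2 3
        unfolding A_def[symmetric] B_def[symmetric] D_def[symmetric] by linarith
      finally show ?thesis by (simp add: w_def)
    qed
    let ?W = "\<lambda>y::real. 1 / jb y ^ n"
    let ?M = "\<lambda>y::real. moment_int (n - 1) (\<rho> * (y / jb y) + \<tau>)"
    have v: "\<bar>y / jb y\<bar> \<le> 1" for y :: real
      by (rule less_imp_le[OF abs_slice_map_less_1])
    have i1: "integrable lborel (\<lambda>y. ?a * of_real \<tau> * (of_real (?W y) * ?M y))"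
      using cone_int_moment(2)[OF n] by (rule integrable_mult_right)
    have i2: "integrable lborel (\<lambda>y. wave \<tau> * (of_real (?W y) :: complex))"
      by (intro integrable_mult_right integrable_of_real) (rule intS)
    let ?Y = "\<lambda>y. of_real (?W y) * (?a * of_real \<tau> * ?M y + wave \<tau>)"
    let ?X = "?a * of_real \<tau> * cone_int n \<rho> \<tau> + wave \<tau> * of_real S"
    have eq: "?X
       = (LINT y|lborel. ?Y y)"
    proof -
      have "(LINT y|lborel. ?Y y)
        = (LINT y|lborel. ?a * of_real \<tau> * (of_real (?W y) * ?M y) + wave \<tau> * of_real (?W y))"
        by (intro Bochner_Integration.integral_cong) (simp_all add: algebra_simps)
      also have "\<dots> = ?a * of_real \<tau> * (LINT y|lborel. of_real (?W y) * ?M y) + wave \<tau> * (LINT y|lborel. of_real (?W y))"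
      proof -
        show ?thesis
          unfolding Bochner_Integration.integral_add[OF i1 i2] integral_mult_right_zero ..
      qed
      also have "(LINT y|lborel. of_real (?W y)) = (of_real S :: complex)" unfolding S_def by (rule integral_of_real, rule intS)
      finally show ?thesis unfolding cone_int_moment(1)[OF n] by simp
    qed
    have "cmod (?X) \<le> (LINT y|lborel. ?W y * (1 / 2))"
      unfolding eq
    proof (rule Bochner_Integration.integral_norm_bound_integral)
      have "integrable lborel (\<lambda>y. ?a * of_real \<tau> * (of_real (?W y) * ?M y) + wave \<tau> * of_real (?W y))"
        by (rule Bochner_Integration.integrable_add[OF i1 i2])
      then show "integrable lborel (\<lambda>y. ?Y y)"
        by (rule Bochner_Integration.integrable_cong[THEN iffD1, rotated -1]) (simp_all add: algebra_simps)
      show "integrable lborel (\<lambda>y. ?W y * (1 / 2))" using intS by (rule integrable_mult_left)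
      show "cmod (?Y y) \<le> ?W y * (1 / 2)" for y
        unfolding norm_mult[of "of_real (?W y)"] norm_of_real using J[OF v[of y]]
        by (intro mult_mono) (auto simp: add_nonneg_nonneg)
    qed
    also have "\<dots> = S * (1 / 2)"
      unfolding S_def by (rule integral_mult_left_zero)
    also have "\<dots> = S / 2" by simp
    finally have "cmod (?X) \<le> S / 2" .
    moreover have "cmod (wave \<tau> * of_real S) = S" using S by (simp add: norm_mult)
    ultimately have "S / 2 \<le> cmod (?a * of_real \<tau> * cone_int n \<rho> \<tau>)"
      using norm_diff_ineq[of "wave \<tau> * of_real S" "?a * of_real \<tau> * cone_int n \<rho> \<tau>"]
      by (simp add: add.commute)
    also have "\<dots> = (2 * pi * \<tau>) * cmod (cone_int n \<rho> \<tau>)" using \<tau>0 by (simp add: norm_mult)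
    finally have "S / 2 \<le> (2 * pi * \<tau>) * cmod (cone_int n \<rho> \<tau>)" .
    then have "S / (4 * pi) / \<tau> \<le> cmod (cone_int n \<rho> \<tau>)" using \<tau>0 by (simp add: field_simps)
    moreover have "c / \<tau> \<le> S / (4 * pi) / \<tau>" using c(3) \<tau>0 by (intro divide_right_mono) auto
    ultimately show "c / \<tau> \<le> cmod (cone_int n \<rho> \<tau>)" by linarith
  qed (use c in auto)
qed


section \<open>Convergence and divergence of the energy integrals\<close>

lemma nn_integral_norm:
  fixes g :: "real \<Rightarrow> ennreal"
  assumes [measurable]: "g \<in> borel_measurable borel"
  shows "(\<integral>\<^sup>+x. g (norm (x::'a::euclidean_space)) \<partial>lborel) =
    (\<integral>\<^sup>+r. ennreal (unit_ball_vol (real DIM('a)) * real DIM('a) * r ^ (DIM('a) - 1)) * indicator {0<..} r * g r \<partial>lborel)"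
proof (rule nn_integral_radial)
  fix r :: real assume "r > 0"
  moreover have "{x \<in> space lborel. norm x \<le> r} = cball (0::'a) r" by auto
  ultimately show "emeasure lborel {x \<in> space lborel. norm (x::'a) \<le> r} = ennreal (unit_ball_vol (real DIM('a)) * r ^ DIM('a))"
    by (simp add: emeasure_cball)
qed (auto simp: Suc_le_eq)

text \<open>Enlarging the radial Jacobian to a power of \<open>1 + r\<close> leaves an integrand
  with an explicit primitive.\<close>

lemma nn_integral_one_plus_norm_powr_finite:
  assumes a: "a > real DIM('a)"
  shows "(\<integral>\<^sup>+x. ennreal ((1 + norm (x::'a::euclidean_space)) powr (- a)) \<partial>lborel) < \<infinity>"
proof -
  let ?d = "DIM('a)"
  let ?c = "unit_ball_vol (real ?d) * real ?d"
  have "(\<integral>\<^sup>+x. ennreal ((1 + norm (x::'a)) powr (- a)) \<partial>lborel) =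
    (\<integral>\<^sup>+r. ennreal (?c * r ^ (?d - 1)) * indicator {0<..} r * ennreal ((1 + r) powr (- a)) \<partial>lborel)"
    by (rule nn_integral_norm) measurable
  also have "\<dots> \<le> (\<integral>\<^sup>+r. ennreal ?c * (ennreal ((1 + r) powr (real ?d - 1 - a)) * indicator {0..} r) \<partial>lborel)"
  proof (rule nn_integral_mono)
    fix r :: real
    show "ennreal (?c * r ^ (?d - 1)) * indicator {0<..} r * ennreal ((1 + r) powr (- a)) \<le>
       ennreal ?c * (ennreal ((1 + r) powr (real ?d - 1 - a)) * indicator {0..} r)"
    proof (cases "r > 0")
      case True
      have "r ^ (?d - 1) \<le> (1 + r) ^ (?d - 1)" using True by (intro power_mono) auto
      also have "\<dots> = (1 + r) powr (real ?d - 1)"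
        using True by (subst powr_realpow[symmetric]) (auto simp: of_nat_diff Suc_le_eq)
      finally have "r ^ (?d - 1) * (1 + r) powr (- a) \<le> (1 + r) powr (real ?d - 1) * (1 + r) powr (- a)"
        by (rule mult_right_mono) simp
      also have "\<dots> = (1 + r) powr (real ?d - 1 - a)" by (simp add: powr_add[symmetric])
      finally have "?c * (r ^ (?d - 1) * (1 + r) powr (- a)) \<le> ?c * (1 + r) powr (real ?d - 1 - a)"
        by (rule mult_left_mono) simp
      then show ?thesis using True
        by (simp add: ennreal_mult[symmetric] mult.assoc del: ennreal_mult)
    qed simp
  qed
  also have "\<dots> = ennreal ?c * (\<integral>\<^sup>+r. ennreal ((1 + r) powr (real ?d - 1 - a)) * indicator {0..} r \<partial>lborel)"
    by (rule nn_integral_cmult) measurable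
  also have "(\<integral>\<^sup>+r. ennreal ((1 + r) powr (real ?d - 1 - a)) * indicator {0..} r \<partial>lborel)
     = ennreal (0 - (1 + 0) powr (real ?d - a) / (real ?d - a))"
  proof (rule nn_integral_FTC_atLeast)
    show "((\<lambda>r. (1 + r) powr (real ?d - a) / (real ?d - a)) has_real_derivative (1 + r) powr (real ?d - 1 - a)) (at r)" if "0 \<le> r" for r
    proof -
      have "((\<lambda>r. (1 + r) powr \<beta> / \<beta>) has_real_derivative (1 + r) powr (\<beta> - 1)) (at r)" if "\<beta> \<noteq> 0" for \<beta> :: real
        using that \<open>0 \<le> r\<close> by (auto intro!: derivative_eq_intros)
      from this[of "real ?d - a"] show ?thesis using a by (simp add: diff_diff_eq add.commute)
    qed
    have "((\<lambda>r. (1 + r) powr (real ?d - a)) \<longlongrightarrow> 0) at_top"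
      using a by (intro tendsto_neg_powr filterlim_tendsto_add_at_top[OF tendsto_const filterlim_ident]) auto
    then have "((\<lambda>r. (1 + r) powr (real ?d - a) / (real ?d - a)) \<longlongrightarrow> 0 / (real ?d - a)) at_top"
      using a by (intro tendsto_divide tendsto_const) auto
    then show "((\<lambda>r. (1 + r) powr (real ?d - a) / (real ?d - a)) \<longlongrightarrow> 0) at_top" by simp
  qed auto
  finally show ?thesis
    using ennreal_mult_less_top ennreal_less_top by (metis infinity_ennreal_def le_less_trans)
qed

text \<open>On the unit interval \<open>1 \<le> exp 1 * exp (- r)\<close>, which reduces the radial
  integral to a Gamma integral.\<close>

lemma nn_integral_norm_powr_cball_finite:
  assumes e: "e > - real DIM('a)"
  shows "(\<integral>\<^sup>+x. ennreal (norm (x::'a::euclidean_space) powr e) * indicator (cball 0 1) x \<partial>lborel) < \<infinity>"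
proof -
  let ?d = "DIM('a)"
  let ?c = "unit_ball_vol (real ?d) * real ?d"
  have "(\<integral>\<^sup>+x. ennreal (norm (x::'a) powr e) * indicator (cball 0 1) x \<partial>lborel) =
    (\<integral>\<^sup>+x. ennreal (norm (x::'a) powr e) * indicator {..1} (norm x) \<partial>lborel)"
    by (intro nn_integral_cong) (auto simp: indicator_def)
  also have "\<dots> = (\<integral>\<^sup>+r. ennreal (?c * r ^ (?d - 1)) * indicator {0<..} r * (ennreal (r powr e) * indicator {..1} r) \<partial>lborel)"
    by (rule nn_integral_norm) measurable
  also have "\<dots> \<le> (\<integral>\<^sup>+r. ennreal (?c * exp 1 * (indicator {0<..} r * (r powr (real ?d - 1 + e) * exp (- (1 * r))))) \<partial>lborel)"
  proof (rule nn_integral_mono)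
    fix r :: real
    show "ennreal (?c * r ^ (?d - 1)) * indicator {0<..} r * (ennreal (r powr e) * indicator {..1} r) \<le>
       ennreal (?c * exp 1 * (indicator {0<..} r * (r powr (real ?d - 1 + e) * exp (- (1 * r)))))"
    proof (cases "0 < r \<and> r \<le> 1")
      case True
      have "r ^ (?d - 1) * r powr e = r powr (real ?d - 1) * r powr e"
        using True by (subst powr_realpow[symmetric]) (auto simp: of_nat_diff Suc_le_eq)
      also have "\<dots> = r powr (real ?d - 1 + e) * 1" by (simp add: powr_add)
      also have "\<dots> \<le> r powr (real ?d - 1 + e) * (exp 1 * exp (- r))"
        using True by (intro mult_left_mono) (auto simp: exp_add[symmetric])
      finally have "?c * (r ^ (?d - 1) * r powr e) \<le> ?c * (r powr (real ?d - 1 + e) * (exp 1 * exp (- r)))"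
        by (rule mult_left_mono) simp
      then show ?thesis using True
        by (simp add: ennreal_mult[symmetric] mult_ac del: ennreal_mult)
    qed (auto simp: indicator_def)
  qed
  also have "\<dots> < \<infinity>"
  proof -
    have "integrable lborel (\<lambda>r. ?c * exp 1 * (indicator {0<..} r * (r powr (real ?d - 1 + e) * exp (- (1 * r)))))"
      using e by (intro integrable_mult_right integrable_powr_times_exp) auto
    then show ?thesis by (subst nn_integral_eq_integral) auto
  qed
  finally show ?thesis .
qed

lemma nn_integral_inverse_atLeast:
  assumes R: "R > 0"
  shows "(\<integral>\<^sup>+r. ennreal (1 / r) * indicator {R..} r \<partial>lborel) = \<infinity>"
proof (rule ccontr)
  assume "\<not> ?thesis"
  then obtain B where B: "B \<ge> 0" "(\<integral>\<^sup>+r. ennreal (1 / r) * indicator {R..} r \<partial>lborel) = ennreal B"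
    by (cases "\<integral>\<^sup>+r. ennreal (1 / r) * indicator {R..} r \<partial>lborel") auto
  \<comment> \<open>Chosen so that the logarithmic integral from \<open>R\<close> to
    \<open>N\<close> equals \<open>B + 1\<close>, one more than the assumed total.\<close>
  define N where "N = R * exp (B + 1)"
  have N: "R \<le> N" using R B by (simp add: N_def)
  have "(\<integral>\<^sup>+r. ennreal (1 / r) * indicator {R..N} r \<partial>lborel) = ennreal (ln N - ln R)"
    using R N by (intro nn_integral_FTC_Icc) (auto intro!: derivative_eq_intros simp: divide_inverse)
  also have "ln N - ln R = B + 1" using R by (simp add: N_def ln_mult)
  finally have "ennreal (B + 1) = (\<integral>\<^sup>+r. ennreal (1 / r) * indicator {R..N} r \<partial>lborel)" ..
  also have "\<dots> \<le> (\<integral>\<^sup>+r. ennreal (1 / r) * indicator {R..} r \<partial>lborel)"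
    by (intro nn_integral_mono) (auto simp: indicator_def)
  finally show False using B by simp
qed

text \<open>In radial form the integrand dominates a multiple of \<open>1 / r\<close> beyond
  \<open>max R 1\<close>, the critical exponent included.\<close>

lemma nn_integral_norm_powr_infinite:
  assumes a: "a \<ge> - real DIM('a)" and R: "R > 0"
  shows "(\<integral>\<^sup>+x. ennreal (norm (x::'a::euclidean_space) powr a) * indicator {R..} (norm x) \<partial>lborel) = \<infinity>"
proof -
  let ?d = "DIM('a)"
  let ?c = "unit_ball_vol (real ?d) * real ?d"
  have c: "?c > 0" by simp
  define R1 where "R1 = max R 1"
  have R1: "R1 > 0" "R \<le> R1" "1 \<le> R1" by (auto simp: R1_def)
  have "\<infinity> = ennreal ?c * (\<integral>\<^sup>+r. ennreal (1 / r) * indicator {R1..} r \<partial>lborel)"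
  proof -
    have "ennreal ?c \<noteq> 0" using c by (simp only: ennreal_eq_0_iff not_le)
    then show ?thesis by (simp only: nn_integral_inverse_atLeast[OF R1(1)] infinity_ennreal_def ennreal_mult_top if_False)
  qed
  also have "\<dots> = (\<integral>\<^sup>+r. ennreal ?c * (ennreal (1 / r) * indicator {R1..} r) \<partial>lborel)"
    by (rule nn_integral_cmult[symmetric]) measurable
  also have "\<dots> \<le> (\<integral>\<^sup>+r. ennreal (?c * r ^ (?d - 1)) * indicator {0<..} r * (ennreal (r powr a) * indicator {R..} r) \<partial>lborel)"
  proof (rule nn_integral_mono)
    fix r :: real
    show "ennreal ?c * (ennreal (1 / r) * indicator {R1..} r) \<le>
      ennreal (?c * r ^ (?d - 1)) * indicator {0<..} r * (ennreal (r powr a) * indicator {R..} r)"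
    proof (cases "R1 \<le> r")
      case True
      then have r: "r \<ge> 1" "r > 0" "R \<le> r" using R1 by auto
      have "1 / r = r powr (-1)" using r by (simp add: powr_minus divide_inverse)
      also have "\<dots> \<le> r powr (real ?d - 1 + a)" using r a by (intro powr_mono) auto
      also have "\<dots> = r powr (real ?d - 1) * r powr a" by (simp add: powr_add)
      also have "r powr (real ?d - 1) = r ^ (?d - 1)"
        using r by (subst powr_realpow[symmetric]) (auto simp: of_nat_diff Suc_le_eq)
      finally have "?c * (1 / r) \<le> ?c * (r ^ (?d - 1) * r powr a)" using c by (intro mult_left_mono) auto
      then show ?thesis using True r
        by (simp add: ennreal_mult[symmetric] mult.assoc del: ennreal_mult)
    qed auto
  qed
  also have "\<dots> = (\<integral>\<^sup>+x. ennreal (norm (x::'a) powr a) * indicator {R..} (norm x) \<partial>lborel)"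
    by (rule nn_integral_norm[symmetric]) measurable
  finally show ?thesis by (simp add: top_unique)
qed

text \<open>At fixed \<open>x\<close> the substitution \<open>u = norm x + \<sigma> * t\<close> has
  Jacobian 1 in absolute value, so the integral is a product of one over the base and one over the
  line.\<close>

lemma nn_integral_cone_layers_finite:
  fixes \<sigma> :: real
  assumes a: "a > real DIM('a)" and b: "b > 1" and \<sigma>: "\<sigma> = 1 \<or> \<sigma> = -1"
  shows "(\<integral>\<^sup>+z. ennreal ((1 + norm (fst z :: 'a::euclidean_space)) powr (- a) * (1 + \<bar>norm (fst z) + \<sigma> * snd z\<bar>) powr (- b)) \<partial>lborel) < \<infinity>"
proof -
  define I where "I = (\<integral>\<^sup>+u. ennreal ((1 + \<bar>u::real\<bar>) powr (- b)) \<partial>lborel)"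
  have I: "I < \<infinity>" unfolding I_def
    using nn_integral_one_plus_norm_powr_finite[where 'a=real, of b] b by simp
  have "(\<integral>\<^sup>+z. ennreal ((1 + norm (fst z :: 'a)) powr (- a) * (1 + \<bar>norm (fst z) + \<sigma> * snd z\<bar>) powr (- b)) \<partial>lborel)
     = (\<integral>\<^sup>+x. \<integral>\<^sup>+t. ennreal ((1 + norm (x :: 'a)) powr (- a) * (1 + \<bar>norm x + \<sigma> * t\<bar>) powr (- b)) \<partial>lborel \<partial>lborel)"
    unfolding lborel_prod[symmetric] by (subst lborel.nn_integral_fst[symmetric]) auto
  also have "\<dots> = (\<integral>\<^sup>+x. ennreal ((1 + norm (x :: 'a)) powr (- a)) * I \<partial>lborel)"
  proof (rule nn_integral_cong)
    fix x :: 'a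
    have "(\<integral>\<^sup>+t. ennreal ((1 + norm x) powr (- a) * (1 + \<bar>norm x + \<sigma> * t\<bar>) powr (- b)) \<partial>lborel)
      = ennreal ((1 + norm x) powr (- a)) * (\<integral>\<^sup>+t. ennreal ((1 + \<bar>norm x + \<sigma> * t\<bar>) powr (- b)) \<partial>lborel)"
      by (simp add: ennreal_mult nn_integral_cmult)
    also have "(\<integral>\<^sup>+t. ennreal ((1 + \<bar>norm x + \<sigma> * t\<bar>) powr (- b)) \<partial>lborel) = I"
      unfolding I_def using \<sigma>
      by (subst nn_integral_real_affine[of "\<lambda>u. ennreal ((1 + \<bar>u\<bar>) powr (- b))" \<sigma> "norm x"]) auto
    finally show "(\<integral>\<^sup>+t. ennreal ((1 + norm x) powr (- a) * (1 + \<bar>norm x + \<sigma> * t\<bar>) powr (- b)) \<partial>lborel)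
      = ennreal ((1 + norm x) powr (- a)) * I" .
  qed
  also have "\<dots> = (\<integral>\<^sup>+x. ennreal ((1 + norm (x :: 'a)) powr (- a)) \<partial>lborel) * I"
    by (rule nn_integral_multc) measurable
  also have "\<dots> < \<infinity>" using I nn_integral_one_plus_norm_powr_finite[OF a] by (simp add: ennreal_mult_less_top)
  finally show ?thesis .
qed


lemma borel_measurable_fst_snd [measurable]:
  "(fst :: 'a::euclidean_space \<times> real \<Rightarrow> 'a) \<in> borel_measurable borel"
  "(snd :: 'a::euclidean_space \<times> real \<Rightarrow> real) \<in> borel_measurable borel"
  unfolding borel_prod[symmetric] by measurable

lemma integrable_cone_layers:
  fixes \<sigma> :: real
  assumes a: "a > real DIM('a)" and b: "b > 1" and \<sigma>: "\<sigma> = 1 \<or> \<sigma> = -1"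
  shows "integrable lborel (\<lambda>z. (1 + norm (fst z :: 'a::euclidean_space)) powr (- a) * (1 + \<bar>norm (fst z) + \<sigma> * snd z\<bar>) powr (- b))"
  by (rule integrableI_nonneg[OF _ _ nn_integral_cone_layers_finite[OF assms]]) auto

lemma integrable_norm_powr_cball:
  assumes e: "e > - real DIM('a)"
  shows "integrable lborel (\<lambda>x. norm (x::'a::euclidean_space) powr e * indicator (cball 0 1) x)"
proof (rule integrableI_nonneg)
  show "(\<integral>\<^sup>+x. ennreal (norm (x::'a) powr e * indicator (cball 0 1) x) \<partial>lborel) < \<infinity>"
    using nn_integral_norm_powr_cball_finite[OF e] by (simp add: ennreal_mult' ennreal_indicator)
qed (auto intro!: borel_measurable_times borel_measurable_indicator)

lemma nn_integral_less_top_dominated: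
  assumes "integrable M A" "\<And>z. f z \<le> A z"
  shows "(\<integral>\<^sup>+z. ennreal (f z) \<partial>M) < \<infinity>"
proof -
  have "(\<integral>\<^sup>+z. ennreal (f z) \<partial>M) \<le> (\<integral>\<^sup>+z. ennreal (norm (A z)) \<partial>M)"
    using assms(2) by (intro nn_integral_mono ennreal_leI) (smt (verit) real_norm_def)
  also have "\<dots> < \<infinity>" using assms(1) by (simp add: integrable_iff_bounded)
  finally show ?thesis .
qed

lemma powr_nonpos_le_one:
  fixes x a :: real
  assumes "1 \<le> x" "a \<le> 0"
  shows "x powr a \<le> 1"
  using powr_mono2'[of a 1 x] assms by simp

lemma inverse_powr_eq: "b > 0 \<Longrightarrow> (1 / b) powr p = b powr (- p :: real)"
  by (simp add: powr_divide powr_minus_divide)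

lemma add_powr_le:
  fixes x y p :: real
  assumes "0 \<le> x" "0 \<le> y" "0 \<le> p"
  shows "(x + y) powr p \<le> 2 powr p * (x powr p + y powr p)"
proof -
  have "(x + y) powr p \<le> (2 * max x y) powr p" using assms by (intro powr_mono2) auto
  also have "\<dots> = 2 powr p * max x y powr p" using assms by (simp add: powr_mult)
  also have "\<dots> \<le> 2 powr p * (x powr p + y powr p)"
    by (intro mult_left_mono) (auto simp: max_def)
  finally show ?thesis .
qed

text \<open>If the exponent \<open>e = s q - (d + 1)\<close> of \<open>norm z\<close> is nonnegative, then the hypotheses on \<open>s\<close> give
  \<open>(d - 1) q > d\<close>, so that the weight can be charged to either factor; otherwise only the unit ball
  needs a separate bound.\<close>
lemma cone_layer_energy_dominated:
  fixes \<sigma> q s :: real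
  defines "d \<equiv> real DIM('a::euclidean_space)"
  assumes d: "d \<ge> 2" and q: "q \<ge> 1" and s: "0 < s" "s * q < (d - 1) * q + 1" "s * q < 2 * q + d" and \<sigma>: "\<sigma> = 1 \<or> \<sigma> = -1"
  obtains A where "integrable lborel A"
    "\<And>z :: 'a \<times> real. (1 + norm (fst z)) powr (- (d - 1) * q) * (1 + \<bar>norm (fst z) + \<sigma> * snd z\<bar>) powr (- (2 * q)) * norm z powr (s * q - (d + 1)) \<le> A z"
proof -
  define e where "e = s * q - (d + 1)"
  define L where "L a b z = (1 + norm (fst z :: 'a)) powr (- a) * (1 + \<bar>norm (fst z) + \<sigma> * snd z\<bar>) powr (- b)" for a b z
  have intL: "integrable lborel (L a b)" if "a > d" "b > 1" for a b
    unfolding L_def using that \<sigma> by (intro integrable_cone_layers) (auto simp: d_def)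
  have L0: "L a b z \<ge> 0" for a b z by (simp add: L_def)
  have split: "(1 + norm (fst z)) powr (- (d - 1) * q) * (1 + \<bar>norm (fst z) + \<sigma> * snd z\<bar>) powr (- (2 * q)) = L ((d - 1) * q) (2 * q) z" for z :: "'a \<times> real"
    by (simp only: L_def mult_minus_left)
  have La: "L a b z * (1 + norm (fst z)) powr e = L (a - e) b z" and Lb: "L a b z * (1 + \<bar>norm (fst z) + \<sigma> * snd z\<bar>) powr e = L a (b - e) z" for a b z
    by (simp_all add: L_def powr_diff powr_minus field_simps)
  show ?thesis
  proof (cases "e \<ge> 0")
    case True
    have "d + 1 \<le> s * q" using True by (simp add: e_def)
    then have c1: "(d - 1) * q > d" using s by linarith
    \<comment> \<open>The shifted exponents converge exactly by the hypotheses: the first summand by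
      \<open>s * q < (d - 1) * q + 1\<close> (the ridge), the second by
      \<open>s * q < 2 * q + d\<close> (the axis).\<close>
    have "integrable lborel (\<lambda>z. 4 powr e * (L ((d - 1) * q - e) (2 * q) z + L ((d - 1) * q) (2 * q - e) z))"
      using c1 q s by (intro integrable_mult_right Bochner_Integration.integrable_add intL) (auto simp: e_def)
    moreover have "L ((d - 1) * q) (2 * q) z * norm z powr e \<le> 4 powr e * (L ((d - 1) * q - e) (2 * q) z + L ((d - 1) * q) (2 * q - e) z)" for z
    proof -
      define x where "x = 1 + norm (fst z)"
      define y where "y = 1 + \<bar>norm (fst z) + \<sigma> * snd z\<bar>"
      have xy: "x \<ge> 1" "y \<ge> 1" by (auto simp: x_def y_def)
      have "\<bar>\<sigma> * snd z\<bar> = \<bar>snd z\<bar>" using \<sigma> by auto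
      then have "norm (snd z) \<le> norm (fst z) + \<bar>norm (fst z) + \<sigma> * snd z\<bar>"
        using abs_triangle_ineq4[of "norm (fst z) + \<sigma> * snd z" "norm (fst z)"] by simp
      moreover have "norm z \<le> norm (fst z) + norm (snd z)" using norm_Pair_le[of "fst z" "snd z"] by simp
      \<comment> \<open>The two layer variables together control \<open>z\<close>, so a nonnegative
        power of its norm splits into one power of each.\<close>
      ultimately have "norm z \<le> 2 * (x + y)" 
      proof -
        have "N \<le> 2 * ((1 + \<rho>) + (1 + U))" if "t \<le> \<rho> + U" "N \<le> \<rho> + t" "0 \<le> \<rho>" "0 \<le> U" for N \<rho> U t :: real
          using that by argo
        then show ?thesis
          using \<open>norm (snd z) \<le> _\<close> \<open>norm z \<le> _\<close> norm_ge_zero abs_ge_zero unfolding x_def y_def by blast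
      qed
      then have "norm z powr e \<le> (2 * (x + y)) powr e" using True by (intro powr_mono2) auto
      also have "\<dots> = 2 powr e * (x + y) powr e" using xy by (subst powr_mult) auto
      also have "\<dots> \<le> 2 powr e * (2 powr e * (x powr e + y powr e))"
        using xy True by (intro mult_left_mono add_powr_le) auto
      also have "\<dots> = (2 * 2) powr e * (x powr e + y powr e)" by (simp only: powr_mult mult.assoc)
      finally have "norm z powr e \<le> 4 powr e * (x powr e + y powr e)" by simp
      then have "L ((d - 1) * q) (2 * q) z * norm z powr e \<le> L ((d - 1) * q) (2 * q) z * (4 powr e * (x powr e + y powr e))"
        by (intro mult_left_mono L0)
      also have "\<dots> = 4 powr e * (L ((d - 1) * q) (2 * q) z * x powr e + L ((d - 1) * q) (2 * q) z * y powr e)"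
        by (simp add: algebra_simps)
      finally show ?thesis unfolding x_def y_def La Lb .
    qed
    ultimately show ?thesis using that unfolding split e_def by blast
  next
    case False
    have d1: "real DIM('a \<times> real) = d + 1" by (simp add: d_def)
    have sq0: "s * q > 0" using s q by simp
    have e1: "e > - real DIM('a \<times> real)" using sq0 unfolding e_def d1 by linarith
    have e2: "(d - 1) * q - e > d" using s unfolding e_def by linarith
    have "integrable lborel (\<lambda>z. 2 powr (- e) * L ((d - 1) * q - e) (2 * q) z + norm (z :: 'a \<times> real) powr e * indicator (cball 0 1) z)"
      using q
      by (intro integrable_mult_right Bochner_Integration.integrable_add intL integrable_norm_powr_cball e1 e2) simp
    moreover have "L ((d - 1) * q) (2 * q) z * norm z powr e \<le> 2 powr (- e) * L ((d - 1) * q - e) (2 * q) z + norm z powr e * indicator (cball 0 1) z" for z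
    proof (cases "norm z \<le> 1")
      case True
      have "(1 + norm (fst z)) powr - ((d - 1) * q) \<le> 1" "(1 + \<bar>norm (fst z) + \<sigma> * snd z\<bar>) powr - (2 * q) \<le> 1"
        using d q by (auto intro!: powr_nonpos_le_one)
      then have "L ((d - 1) * q) (2 * q) z \<le> 1 * 1" unfolding L_def by (intro mult_mono) auto
      then have "L ((d - 1) * q) (2 * q) z * norm z powr e \<le> 1 * norm z powr e" by (intro mult_right_mono) auto
      also have "\<dots> \<le> 2 powr (- e) * L ((d - 1) * q - e) (2 * q) z + norm z powr e * indicator (cball 0 1) z"
        using True L0[of "(d - 1) * q - e" "2 * q" z] by simp
      finally show ?thesis .
    next
      case nz: False
      have "norm (fst z) \<le> norm z" using norm_fst_le[of "fst z" "snd z"] by simp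
      \<comment> \<open>For negative \<open>e\<close> a lower bound on \<open>norm z\<close> is
        required; outside the unit ball it is at least the mean of 1 and
        \<open>norm (fst z)\<close>.\<close>
      then have "(1 + norm (fst z)) / 2 \<le> norm z" using nz by argo
      then have "norm z powr e \<le> ((1 + norm (fst z)) / 2) powr e"
        using False by (intro powr_mono2') (simp_all add: add_pos_nonneg)
      also have "\<dots> = 2 powr (- e) * (1 + norm (fst z)) powr e" 
      proof -
        have "((1 + norm (fst z)) / 2) powr e = (1 + norm (fst z)) powr e / 2 powr e"
          by (intro powr_divide)
        then show ?thesis by (simp add: powr_minus_divide)
      qed
      finally have "L ((d - 1) * q) (2 * q) z * norm z powr e \<le> L ((d - 1) * q) (2 * q) z * (2 powr (- e) * (1 + norm (fst z)) powr e)"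
        by (intro mult_left_mono L0)
      also have "\<dots> = 2 powr (- e) * (L ((d - 1) * q) (2 * q) z * (1 + norm (fst z)) powr e)" by simp
      finally show ?thesis unfolding La using nz by simp
    qed
    ultimately show ?thesis using that unfolding split e_def by blast
  qed
qed

text \<open>Here \<open>d\<close> is \<open>DIM('a)\<close>, one less than the \<open>d\<close> of
  the final theorem. With \<open>q = 1 / \<theta>\<close> the conditions on \<open>s\<close> become
  linear in \<open>s * q\<close>, and \<open>add_powr_le\<close> separates the two layers, which are
  then dominated with \<open>\<sigma>\<close> equal to 1 and to -1.\<close>

lemma cone_energy_finite:
  fixes u :: "'a::euclidean_space \<times> real \<Rightarrow> real"
  defines "d \<equiv> real DIM('a)"
  assumes d: "d \<ge> 2" and u0: "\<And>z. 0 \<le> u z" and C: "C > 0"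
    and u: "\<And>z. u z \<le> C * (1 + norm (fst z)) powr (- (d - 1) / 2) * layers (norm (fst z)) (snd z)"
    and \<theta>: "0 < \<theta>" "\<theta> \<le> 1" and s: "0 < s" "s < d - 1 + \<theta>" "s < 2 + d * \<theta>"
  shows "(\<integral>\<^sup>+z. ennreal (u z powr (2 / \<theta>) * norm z powr (s / \<theta> - real DIM('a \<times> real))) \<partial>lborel) < \<infinity>"
proof -
  define q where "q = 1 / \<theta>"
  have q: "q \<ge> 1" using \<theta> by (simp add: q_def)
  have sq: "s * q < (d - 1) * q + 1" "s * q < 2 * q + d"
    using s \<theta> by (simp_all add: q_def field_simps)
  define \<Phi> where "\<Phi> \<sigma> z = (1 + norm (fst z)) powr (- (d - 1) * q) * (1 + \<bar>norm (fst z) + \<sigma> * snd z\<bar>) powr (- (2 * q)) * norm z powr (s * q - (d + 1))" for \<sigma> and z :: "'a \<times> real"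
  obtain A where A: "integrable lborel A" "\<And>z. \<Phi> 1 z \<le> A z"
    using cone_layer_energy_dominated[of q s 1, where 'a='a] d q s(1) sq unfolding d_def \<Phi>_def by blast
  obtain B where B: "integrable lborel B" "\<And>z. \<Phi> (-1) z \<le> B z"
    using cone_layer_energy_dominated[of q s "-1", where 'a='a] d q s(1) sq unfolding d_def \<Phi>_def by blast
  define K where "K = C powr (2 * q) * 2 powr (2 * q)"
  have bound: "u z powr (2 * q) * norm z powr (s * q - (d + 1)) \<le> K * (A z + B z)" for z
  proof -
    define x where "x = 1 / (1 + \<bar>norm (fst z) + snd z\<bar>)"
    define y where "y = 1 / (1 + \<bar>norm (fst z) - snd z\<bar>)"
    define w where "w = (1 + norm (fst z)) powr (- (d - 1) / 2)"
    have xy: "0 \<le> x" "0 \<le> y" "0 \<le> w" by (auto simp: x_def y_def w_def)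
    have "u z \<le> C * w * (x + y)" using u[of z] by (simp add: x_def y_def w_def)
    then have "u z powr (2 * q) \<le> (C * w * (x + y)) powr (2 * q)" using u0 q by (intro powr_mono2) auto
    also have "\<dots> = C powr (2 * q) * w powr (2 * q) * (x + y) powr (2 * q)"
      using xy C by (simp add: powr_mult)
    also have "\<dots> \<le> C powr (2 * q) * w powr (2 * q) * (2 powr (2 * q) * (x powr (2 * q) + y powr (2 * q)))"
      using xy q by (intro mult_left_mono add_powr_le) auto
    also have "\<dots> = K * (w powr (2 * q) * x powr (2 * q) + w powr (2 * q) * y powr (2 * q))"
      by (simp add: K_def algebra_simps)
    also have "w powr (2 * q) = (1 + norm (fst z)) powr (- (d - 1) * q)"
      unfolding w_def powr_powr by simp
    also have "x powr (2 * q) = (1 + \<bar>norm (fst z) + 1 * snd z\<bar>) powr (- (2 * q))"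
      unfolding x_def by (subst inverse_powr_eq) (simp_all add: add_pos_nonneg)
    also have "y powr (2 * q) = (1 + \<bar>norm (fst z) + (-1) * snd z\<bar>) powr (- (2 * q))"
      unfolding y_def by (subst inverse_powr_eq) (simp_all add: add_pos_nonneg)
    finally have "u z powr (2 * q) * norm z powr (s * q - (d + 1)) \<le> K * (\<Phi> 1 z + \<Phi> (-1) z)"
      unfolding \<Phi>_def distrib_right[symmetric] mult.assoc[of K, symmetric] by (rule mult_right_mono) simp
    also have "\<dots> \<le> K * (A z + B z)" using A(2)[of z] B(2)[of z] by (intro mult_left_mono add_mono) (auto simp: K_def)
    finally show ?thesis .
  qed
  have "integrable lborel (\<lambda>z. K * (A z + B z))" using A(1) B(1) by simp
  from nn_integral_less_top_dominated[OF this bound] show ?thesis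
    by (simp add: q_def d_def add.commute)
qed

text \<open>On the ridge tube and on the axis tube, \<open>norm z\<close> lies between its dominant
  component and three times it. The lemma replaces one by the other for an exponent of either
  sign.\<close>

lemma powr_comparable_lower:
  fixes x y e :: real
  assumes "0 < x" "x \<le> y" "y \<le> 3 * x"
  shows "3 powr (- \<bar>e\<bar>) * x powr e \<le> y powr e"
proof (cases "e \<ge> 0")
  case True
  have "3 powr (- \<bar>e\<bar>) * x powr e \<le> 1 * x powr e" by (intro mult_right_mono) (auto intro!: powr_nonpos_le_one)
  also have "\<dots> \<le> y powr e" using assms True by (auto intro!: powr_mono2)
  finally show ?thesis .
next
  case False
  then have "3 powr (- \<bar>e\<bar>) * x powr e = (3 * x) powr e" using assms by (simp add: powr_mult)
  also have "\<dots> \<le> y powr e" using assms False by (intro powr_mono2') auto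
  finally show ?thesis .
qed

text \<open>On the tube the integrand is at least a multiple of \<open>norm x powr a\<close>.
  Multiplying \<open>s > d - 1 + \<theta>\<close> by \<open>q\<close> gives \<open>a > - d\<close>,
  while each fibre of the tube has the fixed length \<open>2 * c1\<close>; so the integral over the
  base diverges.\<close>

lemma cone_energy_infinite_ridge:
  fixes u :: "'a::euclidean_space \<times> real \<Rightarrow> real"
  defines "d \<equiv> real DIM('a)"
  assumes d: "d \<ge> 2" and c: "c > 0" and \<rho>0: "\<rho>0 \<ge> 1"
    and u: "\<And>z. \<rho>0 \<le> norm (fst z) \<Longrightarrow> \<bar>norm (fst z) - snd z\<bar> \<le> c \<Longrightarrow> c * norm (fst z) powr (- (d - 1) / 2) \<le> u z"
    and \<theta>: "0 < \<theta>" and s: "s > d - 1 + \<theta>"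
  shows "(\<integral>\<^sup>+z. ennreal (u z powr (2 / \<theta>) * norm z powr (s / \<theta> - real DIM('a \<times> real))) \<partial>lborel) = \<infinity>"
proof -
  define q where "q = 1 / \<theta>"
  have q: "q > 0" using \<theta> by (simp add: q_def)
  \<comment> \<open>A half-width of at most 1 keeps \<open>norm z\<close> within a factor 3 of
    \<open>norm (fst z)\<close>.\<close>
  define c1 where "c1 = min c 1"
  have c1: "0 < c1" "c1 \<le> c" "c1 \<le> 1" using c by (auto simp: c1_def)
  define e where "e = s * q - (d + 1)"
  define a where "a = - (d - 1) * q + e"
  have "(d - 1 + \<theta>) * q < s * q" using s q by (rule mult_strict_right_mono)
  moreover have "(d - 1 + \<theta>) * q = (d - 1) * q + 1" using \<theta> by (simp add: q_def field_simps)
  moreover have "- (d - 1) * q = - ((d - 1) * q)" by (rule mult_minus_left)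
  ultimately have a: "a \<ge> - real DIM('a)" unfolding a_def e_def d_def[symmetric] by linarith
  define K where "K = c powr (2 * q) * 3 powr (- \<bar>e\<bar>)"
  have K: "K > 0" using c by (simp add: K_def)
  let ?g = "\<lambda>x::'a. ennreal K * (ennreal (norm x powr a) * indicator {\<rho>0..} (norm x))"
  have le: "?g x * indicator {norm x - c1..norm x + c1} t
     \<le> ennreal (u (x, t) powr (2 * q) * norm (x, t) powr e)" for x :: 'a and t
  proof (cases "\<rho>0 \<le> norm x \<and> \<bar>norm x - t\<bar> \<le> c1")
    case True
    have x: "norm x > 0" "norm x \<ge> 1" using True \<rho>0 by auto
    have "norm x \<le> norm (x, t)" using norm_fst_le[of x t] by simp
    moreover have "norm (x, t) \<le> norm x + \<bar>t\<bar>" using norm_Pair_le[of x t] by simp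
    then have "norm (x, t) \<le> 3 * norm x" using True c1 x by linarith
    ultimately have 1: "3 powr (- \<bar>e\<bar>) * norm x powr e \<le> norm (x, t) powr e"
      using x by (intro powr_comparable_lower) auto
    have "c * norm x powr (- (d - 1) / 2) \<le> u (x, t)" using u[of "(x, t)"] True c1 by auto
    then have "(c * norm x powr (- (d - 1) / 2)) powr (2 * q) \<le> u (x, t) powr (2 * q)"
      using c q by (intro powr_mono2) auto
    also have "(c * norm x powr (- (d - 1) / 2)) powr (2 * q) = c powr (2 * q) * norm x powr (- (d - 1) * q)"
      using c by (simp add: powr_mult powr_powr)
    finally have "(c powr (2 * q) * norm x powr (- (d - 1) * q)) * (3 powr (- \<bar>e\<bar>) * norm x powr e) \<le> u (x, t) powr (2 * q) * norm (x, t) powr e"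
      using 1 by (intro mult_mono) auto
    also have "(c powr (2 * q) * norm x powr (- (d - 1) * q)) * (3 powr (- \<bar>e\<bar>) * norm x powr e) = K * norm x powr a"
      by (simp add: K_def a_def powr_add)
    finally have "ennreal (K * norm x powr a) \<le> ennreal (u (x, t) powr (2 * q) * norm (x, t) powr e)" by (rule ennreal_leI)
    then show ?thesis using K by (simp add: ennreal_mult indicator_def)
  next
    case False
    then have "indicator {\<rho>0..} (norm x) * indicator {norm x - c1..norm x + c1} t = (0 :: ennreal)"
      by (auto simp: indicator_def abs_le_iff)
    then have "?g x * indicator {norm x - c1..norm x + c1} t = 0"
      by (simp only: mult.assoc mult_zero_right)
    then show ?thesis by (simp only: zero_le)
  qed
  have "\<infinity> = ennreal K * ennreal (2 * c1) * (\<integral>\<^sup>+x. ennreal (norm (x::'a) powr a) * indicator {\<rho>0..} (norm x) \<partial>lborel)"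
    using K c1 \<rho>0 nn_integral_norm_powr_infinite[OF a, of \<rho>0]
    by (simp add: ennreal_mult_top ennreal_mult[symmetric] ennreal_eq_0_iff not_le)
  also have "\<dots> = (\<integral>\<^sup>+x. ?g x * ennreal (2 * c1) \<partial>lborel)"
    by (subst nn_integral_cmult[symmetric]) (auto intro!: nn_integral_cong simp: mult_ac)
  also have "\<dots> = (\<integral>\<^sup>+x. (\<integral>\<^sup>+t. ?g x * indicator {norm x - c1..norm x + c1} t \<partial>lborel) \<partial>lborel)"
    using c1 by (intro nn_integral_cong, subst nn_integral_cmult_indicator) auto
  also have "\<dots> = (\<integral>\<^sup>+z. ?g (fst z) * indicator {- c1..c1} (snd z - norm (fst z)) \<partial>lborel2)"
    by (subst lborel.nn_integral_fst[symmetric]) (auto intro!: nn_integral_cong simp: indicator_def)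
  also have "\<dots> \<le> (\<integral>\<^sup>+z. ennreal (u z powr (2 * q) * norm z powr e) \<partial>lborel2)"
  proof (rule nn_integral_mono)
    fix z :: "'a \<times> real"
    have "indicator {- c1..c1} (snd z - norm (fst z)) = (indicator {norm (fst z) - c1..norm (fst z) + c1} (snd z) :: ennreal)"
      by (auto simp: indicator_def)
    then show "?g (fst z) * indicator {- c1..c1} (snd z - norm (fst z)) \<le> ennreal (u z powr (2 * q) * norm z powr e)"
      using le[of "fst z" "snd z"] by simp
  qed
  finally show ?thesis by (simp add: lborel_prod q_def e_def d_def top_unique add.commute)
qed

text \<open>The cross sections of the tube are balls of fixed volume, so only the integral along the
  axis matters. Its integrand is at least a multiple of \<open>t powr (- (2 * q) + e)\<close>, and
  the condition on \<open>s\<close> makes this exponent at least -1.\<close>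

lemma cone_energy_infinite_axis:
  fixes u :: "'a::euclidean_space \<times> real \<Rightarrow> real"
  defines "d \<equiv> real DIM('a)"
  assumes c: "c > 0" and T: "T \<ge> 1"
    and u: "\<And>z. norm (fst z) \<le> c \<Longrightarrow> T \<le> snd z \<Longrightarrow> c / snd z \<le> u z"
    and \<theta>: "0 < \<theta>" and s: "s > 2 + d * \<theta>"
  shows "(\<integral>\<^sup>+z. ennreal (u z powr (2 / \<theta>) * norm z powr (s / \<theta> - real DIM('a \<times> real))) \<partial>lborel) = \<infinity>"
proof -
  define q where "q = 1 / \<theta>"
  have q: "q > 0" using \<theta> by (simp add: q_def)
  define c1 where "c1 = min c 1"
  have c1: "0 < c1" "c1 \<le> c" "c1 \<le> 1" using c by (auto simp: c1_def)
  define e where "e = s * q - (d + 1)"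
  have "(2 + d * \<theta>) * q < s * q" using s q by (rule mult_strict_right_mono)
  moreover have "(2 + d * \<theta>) * q = 2 * q + d" using \<theta> by (simp add: q_def field_simps)
  ultimately have a: "- (2 * q) + e \<ge> -1" by (simp add: e_def)
  define K where "K = c powr (2 * q) * 3 powr (- \<bar>e\<bar>)"
  have K: "K > 0" using c by (simp add: K_def)
  have le: "ennreal K * indicator (cball 0 c1) x * (ennreal (1 / t) * indicator {T..} t)
     \<le> ennreal (u (x, t) powr (2 * q) * norm (x, t) powr e)" for x :: 'a and t
  proof (cases "norm x \<le> c1 \<and> T \<le> t")
    case True
    have t: "t \<ge> 1" "t > 0" using True T by auto
    have "t \<le> norm (x, t)" using norm_snd_le[of t x] t by simp
    moreover have "norm (x, t) \<le> norm x + \<bar>t\<bar>" using norm_Pair_le[of x t] by simp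
    then have "norm (x, t) \<le> 3 * t" using True c1 t by linarith
    ultimately have 1: "3 powr (- \<bar>e\<bar>) * t powr e \<le> norm (x, t) powr e"
      using t by (intro powr_comparable_lower) auto
    have "c / t \<le> u (x, t)" using u[of "(x, t)"] True c1 by auto
    then have "(c / t) powr (2 * q) \<le> u (x, t) powr (2 * q)"
      using c q t by (intro powr_mono2) auto
    also have "(c / t) powr (2 * q) = c powr (2 * q) * t powr (- (2 * q))"
      using c t by (simp add: powr_divide powr_minus_divide)
    finally have "(c powr (2 * q) * t powr (- (2 * q))) * (3 powr (- \<bar>e\<bar>) * t powr e) \<le> u (x, t) powr (2 * q) * norm (x, t) powr e"
      using 1 by (intro mult_mono) auto
    also have "(c powr (2 * q) * t powr (- (2 * q))) * (3 powr (- \<bar>e\<bar>) * t powr e) = K * t powr (- (2 * q) + e)"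
      by (simp only: K_def powr_add mult_ac)
    finally have "K * t powr (- (2 * q) + e) \<le> u (x, t) powr (2 * q) * norm (x, t) powr e" .
    moreover have "t powr (-1) \<le> t powr (- (2 * q) + e)" using a t by (intro powr_mono) auto
    then have "K * (1 / t) \<le> K * t powr (- (2 * q) + e)" using K t by (simp add: powr_minus divide_inverse)
    ultimately have "ennreal (K * (1 / t)) \<le> ennreal (u (x, t) powr (2 * q) * norm (x, t) powr e)" by (intro ennreal_leI) linarith
    then show ?thesis using K True t by (simp add: ennreal_mult[symmetric] indicator_def)
  qed (auto simp: indicator_def)
  have ball_meas: "(\<lambda>x::'a. ennreal K * indicator (cball 0 c1) x) \<in> borel_measurable lborel"
    by (intro borel_measurable_times_ennreal borel_measurable_const borel_measurable_indicator) simp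
  have "\<infinity> = ennreal K * emeasure lborel (cball (0::'a) c1) * (\<integral>\<^sup>+t. ennreal (1 / t) * indicator {T..} t \<partial>lborel)"
  proof -
    have "emeasure lborel (cball (0::'a) c1) = ennreal (unit_ball_vol (real DIM('a)) * c1 ^ DIM('a))"
      using c1 by (simp add: emeasure_cball)
    moreover have "unit_ball_vol (real DIM('a)) * c1 ^ DIM('a) > 0" using c1 by simp
    ultimately have "ennreal K * emeasure lborel (cball (0::'a) c1) \<noteq> 0"
      using K by (simp add: ennreal_mult[symmetric] ennreal_eq_0_iff not_le)
    then show ?thesis using T by (subst nn_integral_inverse_atLeast) (auto simp: ennreal_mult_top)
  qed
  also have "\<dots> = (\<integral>\<^sup>+x. ennreal K * indicator (cball (0::'a) c1) x * (\<integral>\<^sup>+t. ennreal (1 / t) * indicator {T..} t \<partial>lborel) \<partial>lborel)"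
    by (subst nn_integral_multc[OF ball_meas]) (subst nn_integral_cmult_indicator, auto)
  also have "\<dots> = (\<integral>\<^sup>+x. (\<integral>\<^sup>+t. ennreal K * indicator (cball (0::'a) c1) x * (ennreal (1 / t) * indicator {T..} t) \<partial>lborel) \<partial>lborel)"
    by (intro nn_integral_cong nn_integral_cmult[symmetric]) measurable
  also have "\<dots> = (\<integral>\<^sup>+z. ennreal K * indicator (cball (0::'a) c1) (fst z) * (ennreal (1 / snd z) * indicator {T..} (snd z)) \<partial>lborel2)"
  proof -
    have [measurable]: "(\<lambda>z::'a \<times> real. ennreal K * indicator (cball 0 c1) (fst z)) \<in> borel_measurable lborel2"
      by (rule measurable_compose[OF measurable_fst ball_meas])
    show ?thesis by (subst lborel.nn_integral_fst[symmetric]) simp_all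
  qed
  also have "\<dots> \<le> (\<integral>\<^sup>+z. ennreal (u z powr (2 * q) * norm z powr e) \<partial>lborel2)"
    by (rule nn_integral_mono) (use le in \<open>metis prod.collapse\<close>)
  finally show ?thesis by (simp add: lborel_prod q_def e_def d_def top_unique add.commute)
qed


section \<open>The spectrum of the cone measure\<close>

lemma norm_measure_fourier_cone:
  fixes z :: "(real ^ 'n) \<times> real"
  assumes n: "CARD('n) \<ge> 2"
  shows "cmod (measure_fourier cone_measure z) = sqrt 2 * slice_const CARD('n) * cmod (cone_int CARD('n) (norm (fst z)) (snd z))"
  using measure_fourier_cone_eq[OF n, of "fst z" "snd z"] slice_const_pos[OF n]
  by (simp add: cone_int_def norm_mult)

text \<open>Since the threshold is positive, the supremum is already decided by positive
  \<open>s\<close>. This keeps nonpositive exponents, where the weight is most singular at the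
  origin, out of the argument.\<close>

lemma Sup_ereal_threshold:
  assumes v: "v > 0" and below: "\<And>s. 0 < s \<Longrightarrow> s < v \<Longrightarrow> P s" and above: "\<And>s. v < s \<Longrightarrow> \<not> P s"
  shows "Sup (ereal ` {s. P s}) = ereal v"
proof (rule antisym)
  show "Sup (ereal ` {s. P s}) \<le> ereal v"
    using above by (intro SUP_least) (auto simp: not_less[symmetric])
  show "ereal v \<le> Sup (ereal ` {s. P s})"
  proof (rule dense_le)
    fix x assume x: "x < ereal v"
    obtain s where s: "max x 0 < ereal s" "ereal s < ereal v"
      using ereal_dense2[of "max x 0" "ereal v"] x v by (auto simp: zero_ereal_def)
    then have "P s" using below by (simp add: zero_ereal_def)
    then have "ereal s \<le> Sup (ereal ` {s. P s})" by (intro SUP_upper) auto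
    moreover have "x \<le> ereal s" using s(1) by (simp add: less_imp_le)
    ultimately show "x \<le> Sup (ereal ` {s. P s})" by (rule order_trans[rotated])
  qed
qed

lemma powr_unbounded:
  fixes a :: real
  assumes a: "a > 0"
  obtains x where "x \<ge> R" "x > 0" "x powr a > B"
proof
  let ?x = "max R ((\<bar>B\<bar> + 1) powr (1 / a))"
  show "?x \<ge> R" by simp
  have "\<bar>B\<bar> + 1 > 0" by (simp add: add_nonneg_pos)
  then show "?x > 0" by (simp add: less_max_iff_disj)
  have "B < \<bar>B\<bar> + 1" by simp
  also have "\<dots> = ((\<bar>B\<bar> + 1) powr (1 / a)) powr a" using a by (simp add: powr_powr)
  also have "\<dots> \<le> ?x powr a" using a by (intro powr_mono2) auto
  finally show "?x powr a > B" .
qed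

text \<open>For the supremum the weight is split multiplicatively:
  \<open>norm z \<le> 2 * (r * x')\<close> for either layer variable \<open>x'\<close>. Then
  \<open>s \<le> d - 1\<close> pays for the power of \<open>r\<close> and \<open>s \<le> 2\<close>
  for that of \<open>x'\<close>, exactly the decay that the square of \<open>u\<close>
  provides.\<close>

lemma cone_sup_finite:
  fixes u :: "'a::euclidean_space \<times> real \<Rightarrow> real"
  defines "d \<equiv> real DIM('a)"
  assumes d: "d \<ge> 2" and u0: "\<And>z. 0 \<le> u z" and C: "C > 0"
    and u: "\<And>z. u z \<le> C * (1 + norm (fst z)) powr (- (d - 1) / 2) * layers (norm (fst z)) (snd z)"
    and s: "0 < s" "s \<le> d - 1" "s \<le> 2"
  shows "(u z)\<^sup>2 * norm z powr s \<le> C\<^sup>2 * 4 * 2 powr s"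
proof -
  define r where "r = 1 + norm (fst z)"
  define x where "x = 1 + \<bar>norm (fst z) + snd z\<bar>"
  define y where "y = 1 + \<bar>norm (fst z) - snd z\<bar>"
  have rxy: "1 \<le> r" "1 \<le> x" "1 \<le> y" by (auto simp: r_def x_def y_def)
  have N: "norm z \<le> 2 * (r * x')" if x': "x' = x \<or> x' = y" for x'
  proof -
    have x1: "x' \<ge> 1" using x' rxy by auto
    have "\<bar>snd z\<bar> \<le> norm (fst z) + (x' - 1)"
      using x' abs_triangle_ineq4[of "norm (fst z) + snd z" "norm (fst z)"] abs_triangle_ineq4[of "norm (fst z) - snd z" "norm (fst z)"]
      by (auto simp: x_def y_def)
    moreover have "norm z \<le> norm (fst z) + \<bar>snd z\<bar>" using norm_Pair_le[of "fst z" "snd z"] by simp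
    ultimately have "norm z \<le> 2 * (r - 1) + (x' - 1)" by (simp add: r_def)
    also have "\<dots> \<le> 2 * (r * x')"
    proof -
      have "0 \<le> (r - 1) * (x' - 1)" using rxy x1 by simp
      then have "r + x' - 1 \<le> r * x'" by (simp add: algebra_simps)
      then show ?thesis using x1 by simp
    qed
    finally show ?thesis .
  qed
  have key: "r powr (- (d - 1)) * (1 / x')\<^sup>2 * norm z powr s \<le> 2 powr s" if x': "x' = x \<or> x' = y" for x'
  proof -
    have x1: "x' \<ge> 1" using x' rxy by auto
    have "norm z powr s \<le> (2 * (r * x')) powr s" using N[OF x'] s by (intro powr_mono2) auto
    also have "\<dots> = 2 powr s * (r powr s * x' powr s)" using rxy x1 by (simp add: powr_mult)
    also have "\<dots> \<le> 2 powr s * (r powr (d - 1) * x' powr 2)"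
      using s rxy x1 by (intro mult_left_mono mult_mono powr_mono) auto
    finally have "r powr (- (d - 1)) * (1 / x')\<^sup>2 * norm z powr s \<le> r powr (- (d - 1)) * (1 / x')\<^sup>2 * (2 powr s * (r powr (d - 1) * x' powr 2))"
      by (intro mult_left_mono) auto
    also have "\<dots> = 2 powr s * (r powr (- (d - 1)) * r powr (d - 1)) * ((1 / x')\<^sup>2 * x' powr 2)" by (simp only: mult_ac)
    also have "(1 / x')\<^sup>2 * x' powr 2 = 1" using x1 by (simp add: power_divide)
    also have "r powr (- (d - 1)) * r powr (d - 1) = 1" using rxy by (simp add: powr_add[symmetric])
    finally show ?thesis by simp
  qed
  have "u z \<le> C * r powr (- (d - 1) / 2) * (1 / x + 1 / y)" using u[of z] by (simp add: r_def x_def y_def)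
  then have "(u z)\<^sup>2 \<le> (C * r powr (- (d - 1) / 2) * (1 / x + 1 / y))\<^sup>2" using u0 by (intro power_mono)
  also have "\<dots> = C\<^sup>2 * r powr (- (d - 1)) * (1 / x + 1 / y)\<^sup>2"
  proof -
    have "(r powr (- (d - 1) / 2))\<^sup>2 = r powr (- (d - 1) / 2 + - (d - 1) / 2)"
      unfolding powr_add power2_eq_square ..
    also have "- (d - 1) / 2 + - (d - 1) / 2 = - (d - 1)" by argo
    finally show ?thesis by (simp only: power_mult_distrib)
  qed
  also have "\<dots> \<le> C\<^sup>2 * r powr (- (d - 1)) * (2 * ((1 / x)\<^sup>2 + (1 / y)\<^sup>2))"
  proof (intro mult_left_mono)
    have "0 \<le> (1 / x - 1 / y)\<^sup>2" by simp
    then show "(1 / x + 1 / y)\<^sup>2 \<le> 2 * ((1 / x)\<^sup>2 + (1 / y)\<^sup>2)" unfolding power2_sum power2_diff by argo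
  qed simp
  finally have "(u z)\<^sup>2 * norm z powr s \<le> C\<^sup>2 * r powr (- (d - 1)) * (2 * ((1 / x)\<^sup>2 + (1 / y)\<^sup>2)) * norm z powr s"
    by (intro mult_right_mono) auto
  also have "\<dots> = C\<^sup>2 * (2 * (r powr (- (d - 1)) * (1 / x)\<^sup>2 * norm z powr s + r powr (- (d - 1)) * (1 / y)\<^sup>2 * norm z powr s))"
    by (simp add: algebra_simps)
  also have "\<dots> \<le> C\<^sup>2 * (2 * (2 powr s + 2 powr s))"
    using key by (intro mult_left_mono add_mono) auto
  finally show ?thesis by simp
qed

text \<open>The pointwise bounds feed the energy lemmas. The case \<open>\<theta> = 0\<close> is
  separate because the energy is a supremum there, so divergence is tested along points of the ridge
  and of the axis instead of on tubes.\<close>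

theorem fourier_spectrum_cone:
  assumes n: "CARD('n) \<ge> 2" and \<theta>: "0 \<le> \<theta>" "\<theta> \<le> 1"
  shows "fourier_spectrum (cone_measure :: ((real ^ 'n) \<times> real) measure) \<theta> =
    ereal (min (2 + real CARD('n) * \<theta>) (real CARD('n) - 1 + \<theta>))"
proof -
  let ?\<nu> = "cone_measure :: ((real ^ 'n) \<times> real) measure"
  define d where "d = real CARD('n)"
  define u where "u z = cmod (measure_fourier cone_measure z)" for z :: "(real ^ 'n) \<times> real"
  define K where "K = sqrt 2 * slice_const CARD('n)"
  have K: "K > 0" using slice_const_pos[OF n] by (simp add: K_def)
  have u_eq: "u z = K * cmod (cone_int CARD('n) (norm (fst z)) (snd z))" for z
    unfolding u_def K_def by (rule norm_measure_fourier_cone[OF n])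
  have u0: "0 \<le> u z" for z by (simp add: u_def)
  have d: "d \<ge> 2" using n by (simp add: d_def)
  obtain C0 where C0: "C0 > 0" "\<And>\<rho> \<tau>. 0 \<le> \<rho> \<Longrightarrow> cmod (cone_int CARD('n) \<rho> \<tau>) \<le>
    C0 * (1 + \<rho>) powr (- (real CARD('n) - 1) / 2) * layers \<rho> \<tau>"
    by (rule cone_int_upper[OF n], rule that)
  define C where "C = K * C0"
  have C: "C > 0" using K C0(1) by (simp add: C_def)
  have up: "u z \<le> C * (1 + norm (fst z)) powr (- (d - 1) / 2) * layers (norm (fst z)) (snd z)" for z
    using mult_left_mono[OF C0(2)[of "norm (fst z)" "snd z"], of K] K by (simp only: u_eq C_def d_def mult.assoc norm_ge_zero less_imp_le)
  obtain c0 \<rho>0 where c0: "c0 > 0" "\<rho>0 \<ge> 1" "\<And>\<rho> \<tau>. \<rho> \<ge> \<rho>0 \<Longrightarrow> \<bar>\<rho> - \<tau>\<bar> \<le> c0 \<Longrightarrow>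
    c0 * \<rho> powr (- (real CARD('n) - 1) / 2) \<le> cmod (cone_int CARD('n) \<rho> \<tau>)"
    by (rule cone_int_lower_ridge[OF n], rule that)
  \<comment> \<open>One constant serves both as width of the ridge neighbourhood and as amplitude,
    the latter after the factor \<open>K\<close>.\<close>
  define c where "c = min c0 (K * c0)"
  have c: "c > 0" "c \<le> c0" "c \<le> K * c0" using c0(1) K by (auto simp: c_def)
  have ridge: "c * norm (fst z) powr (- (d - 1) / 2) \<le> u z" if "\<rho>0 \<le> norm (fst z)" "\<bar>norm (fst z) - snd z\<bar> \<le> c" for z
  proof -
    have "c * norm (fst z) powr (- (d - 1) / 2) \<le> (K * c0) * norm (fst z) powr (- (d - 1) / 2)"
      using c by (intro mult_right_mono) auto
    also have "\<dots> = K * (c0 * norm (fst z) powr (- (real CARD('n) - 1) / 2))" by (simp add: d_def)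
    also have "\<dots> \<le> u z" unfolding u_eq using c0(3)[of "norm (fst z)" "snd z"] that c K by (intro mult_left_mono) auto
    finally show ?thesis .
  qed
  obtain c2 T where c2: "c2 > 0" "T \<ge> 1" "\<And>\<rho> \<tau>. 0 \<le> \<rho> \<Longrightarrow> \<rho> \<le> c2 \<Longrightarrow> T \<le> \<tau> \<Longrightarrow> c2 / \<tau> \<le> cmod (cone_int CARD('n) \<rho> \<tau>)"
    by (rule cone_int_lower_axis[OF n], rule that)
  define c' where "c' = min c2 (K * c2)"
  have c': "c' > 0" "c' \<le> c2" "c' \<le> K * c2" using c2(1) K by (auto simp: c'_def)
  have axis: "c' / snd z \<le> u z" if "norm (fst z) \<le> c'" "T \<le> snd z" for z
  proof -
    have "c' / snd z \<le> (K * c2) / snd z" using c' c2(2) that by (intro divide_right_mono) auto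
    also have "\<dots> = K * (c2 / snd z)" by simp
    also have "\<dots> \<le> u z" unfolding u_eq using c2(3)[of "norm (fst z)" "snd z"] that c' K by (intro mult_left_mono) auto
    finally show ?thesis .
  qed
  define v where "v = min (2 + d * \<theta>) (d - 1 + \<theta>)"
  have v: "v > 0" using d \<theta> by (simp add: v_def add_pos_nonneg)
  have dim: "real DIM(real ^ 'n) = d" by (simp add: d_def)
  have "Sup (ereal ` {s. fourier_energy s \<theta> ?\<nu> < \<infinity>}) = ereal v"
  proof (cases "\<theta> = 0")
    case False
    then have \<theta>0: "0 < \<theta>" using \<theta> by simp
    \<comment> \<open>\<open>ennreal_powr\<close> takes the value \<open>\<infinity>\<close> only at
      \<open>\<infinity>\<close>, so the outer power does not affect finiteness.\<close>
    have energy: "fourier_energy s \<theta> ?\<nu> < \<infinity> \<longleftrightarrow>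
      (\<integral>\<^sup>+z. ennreal (u z powr (2 / \<theta>) * norm z powr (s / \<theta> - real DIM((real ^ 'n) \<times> real))) \<partial>lborel) < \<infinity>" for s
      using False by (simp add: fourier_energy_def ennreal_powr_def u_def less_top)
    show ?thesis
    proof (rule Sup_ereal_threshold[OF v])
      fix s assume "0 < s" "s < v"
      then show "fourier_energy s \<theta> ?\<nu> < \<infinity>"
        unfolding energy using d u0 C up \<theta>0 \<theta>
        by (intro cone_energy_finite[where C=C and u=u, unfolded dim]) (auto simp: v_def)
    next
      fix s assume "v < s"
      then consider "s > d - 1 + \<theta>" | "s > 2 + d * \<theta>" by (auto simp: v_def min_def split: if_splits)
      then show "\<not> fourier_energy s \<theta> ?\<nu> < \<infinity>"
      proof cases
        case 1
        show ?thesis unfolding energy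
          by (subst cone_energy_infinite_ridge[where u=u and c=c and ?\<rho>0.0=\<rho>0, unfolded dim])
             (use 1 d c(1) c0(2) ridge \<theta>0 in auto)
      next
        case 2
        show ?thesis unfolding energy
          by (subst cone_energy_infinite_axis[where u=u and c=c' and T=T, unfolded dim])
             (use 2 c'(1) c2(2) axis \<theta>0 in auto)
      qed
    qed
  next
    case True
    have energy: "fourier_energy s \<theta> ?\<nu> = (SUP z. ennreal ((u z)\<^sup>2 * norm z powr s))" for s
      using True by (simp add: fourier_energy_def u_def)
    have v0: "v = min 2 (d - 1)" by (simp add: v_def True)
    show ?thesis
    proof (rule Sup_ereal_threshold[OF v])
      fix s assume s: "0 < s" "s < v"
      have "(u z)\<^sup>2 * norm z powr s \<le> C\<^sup>2 * 4 * 2 powr s" for z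
        using d u0 C up s by (intro cone_sup_finite[where u=u, unfolded dim]) (auto simp: v0)
      then have "(SUP z. ennreal ((u z)\<^sup>2 * norm z powr s)) \<le> ennreal (C\<^sup>2 * 4 * 2 powr s)"
        by (intro SUP_least ennreal_leI)
      then show "fourier_energy s \<theta> ?\<nu> < \<infinity>"
        unfolding energy by (rule le_less_trans) simp
    next
      fix s assume sv: "v < s"
      then have s0: "s > 0" using v by simp
      show "\<not> fourier_energy s \<theta> ?\<nu> < \<infinity>"
      proof
        assume "fourier_energy s \<theta> ?\<nu> < \<infinity>"
        then obtain B where B: "B \<ge> 0" "(SUP z. ennreal ((u z)\<^sup>2 * norm z powr s)) = ennreal B"
          unfolding energy by (cases "SUP z. ennreal ((u z)\<^sup>2 * norm z powr s)") auto
        have ub: "(u z)\<^sup>2 * norm z powr s \<le> B" for z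
        proof -
          have "ennreal ((u z)\<^sup>2 * norm z powr s) \<le> ennreal B" unfolding B(2)[symmetric] by (rule SUP_upper) simp
          then show ?thesis using B(1) by (simp add: ennreal_le_iff)
        qed
        consider "s > d - 1" | "s > 2" using sv by (auto simp: v0 min_def split: if_splits)
        then show False
        proof cases
          case 1
          obtain x where x: "x \<ge> \<rho>0" "x > 0" "x powr (s - (d - 1)) > B / c\<^sup>2"
            using powr_unbounded[of "s - (d - 1)" \<rho>0 "B / c\<^sup>2"] 1 by auto
          obtain b :: "real ^ 'n" where b: "b \<in> Basis" using nonempty_Basis by blast
          \<comment> \<open>A point exactly on the ridge: both \<open>norm (fst z)\<close> and
            \<open>snd z\<close> equal \<open>x\<close>.\<close>
          define z where "z = (x *\<^sub>R b, x)"
          have nf: "norm (fst z) = x" using x b by (simp add: z_def)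
          have "x powr s \<le> norm z powr s" using norm_snd_le[of x "x *\<^sub>R b"] x s0 by (intro powr_mono2) (auto simp: z_def)
          moreover have "(c * x powr (- (d - 1) / 2))\<^sup>2 \<le> (u z)\<^sup>2"
            using ridge[of z] nf x c by (intro power_mono) (auto simp: z_def)
          ultimately have "(c * x powr (- (d - 1) / 2))\<^sup>2 * x powr s \<le> (u z)\<^sup>2 * norm z powr s"
            by (intro mult_mono) auto
          also have "\<dots> \<le> B" by (rule ub)
          also have "(c * x powr (- (d - 1) / 2))\<^sup>2 * x powr s = c\<^sup>2 * x powr (s - (d - 1))"
          proof -
            have "x powr (s - (d - 1)) = x powr (- (d - 1) / 2) * x powr (- (d - 1) / 2) * x powr s"
              unfolding powr_add[symmetric] by (rule arg_cong[where f="\<lambda>e. x powr e"]) (simp add: field_simps)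
            then show ?thesis by (simp add: power2_eq_square mult_ac)
          qed
          finally show False using x c by (simp add: pos_divide_less_eq mult.commute)
        next
          case 2
          obtain x where x: "x \<ge> T" "x > 0" "x powr (s - 2) > B / c'\<^sup>2"
            using powr_unbounded[of "s - 2" T "B / c'\<^sup>2"] 2 by auto
          define z where "z = (0 :: real ^ 'n, x)"
          have nz: "norm z = x" using x by (simp add: z_def)
          have "(c' / x)\<^sup>2 \<le> (u z)\<^sup>2"
            using axis[of z] x c' by (intro power_mono) (auto simp: z_def)
          then have "(c' / x)\<^sup>2 * x powr s \<le> (u z)\<^sup>2 * norm z powr s"
            unfolding nz by (intro mult_right_mono) auto
          also have "\<dots> \<le> B" by (rule ub)
          also have "(c' / x)\<^sup>2 * x powr s = c'\<^sup>2 * x powr (s - 2)"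
            using x by (simp add: powr_diff power_divide)
          finally show False using x c' by (simp add: pos_divide_less_eq mult.commute)
        qed
      qed
    qed
  qed
  then show ?thesis by (simp add: fourier_spectrum_def v_def d_def)
qed

section \<open>Frostman dimension, the kink of the spectrum and the conclusion\<close>

lemma emeasure_cone_measure:
  assumes A: "A \<in> sets borel"
  shows "emeasure (cone_measure :: ('a::euclidean_space \<times> real) measure) A =
    ennreal (sqrt 2) * emeasure lborel (cball 0 1 \<inter> (\<lambda>t. (t, norm t)) -` A)"
proof -
  let ?\<gamma> = "\<lambda>t::'a. (t, norm t)"
  let ?g = "\<lambda>t::'a. ennreal (sqrt 2) * indicator (cball 0 1) t"
  have [measurable]: "?\<gamma> \<in> borel_measurable borel"
    by (intro borel_measurable_continuous_onI continuous_intros)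
  have pre: "?\<gamma> -` A \<in> sets borel"
    using measurable_sets_borel[OF _ A, of ?\<gamma>] by (simp add: vimage_def)
  have ind: "?g \<in> borel_measurable lborel"
    by (intro borel_measurable_times_ennreal borel_measurable_const borel_measurable_indicator) simp
  have "emeasure (cone_measure :: ('a \<times> real) measure) A =
    emeasure (density lborel ?g) (?\<gamma> -` A)"
    unfolding cone_measure_eq using A by (subst emeasure_distr) auto
  also have "\<dots> = (\<integral>\<^sup>+t. ennreal (sqrt 2) * indicator (cball 0 1) t * indicator (?\<gamma> -` A) t \<partial>lborel)"
    using pre ind by (intro emeasure_density) auto
  also have "\<dots> = (\<integral>\<^sup>+t. ennreal (sqrt 2) * indicator (cball 0 1 \<inter> ?\<gamma> -` A) t \<partial>lborel)"
    by (intro nn_integral_cong) (auto simp: indicator_def)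
  also have "\<dots> = ennreal (sqrt 2) * emeasure lborel (cball 0 1 \<inter> ?\<gamma> -` A)"
    using pre by (intro nn_integral_cmult_indicator) auto
  finally show ?thesis .
qed

text \<open>Projection to the base does not increase distances, so a ball meets the cone over at
  most a base ball of the same radius. Conversely the apex ball of radius \<open>r\<close> contains
  the cone over the base ball of radius \<open>r / 2\<close>, since a point over \<open>t\<close>
  has norm at most \<open>2 * norm t\<close>.\<close>

theorem frostman_dim_cone: "frostman_dim (cone_measure :: ('a::euclidean_space \<times> real) measure) = ereal (real DIM('a))"
proof -
  let ?\<nu> = "cone_measure :: ('a \<times> real) measure"
  let ?d = "DIM('a)"
  let ?S = "{\<alpha>. \<exists>C>0. \<forall>r>0. \<forall>x. emeasure ?\<nu> (cball x r) \<le> ennreal (C * r powr \<alpha>)}"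
  define V where "V = sqrt 2 * unit_ball_vol (real ?d)"
  have V: "V > 0" by (simp add: V_def)
  have upper: "emeasure ?\<nu> (cball x r) \<le> ennreal (V * r powr real ?d)" if r: "r > 0" for x r
  proof -
    have "emeasure ?\<nu> (cball x r) \<le> ennreal (sqrt 2) * emeasure lborel (cball (fst x) r)"
      unfolding emeasure_cone_measure[OF borel_closed[OF closed_cball]]
    proof (intro mult_left_mono emeasure_mono)
      show "cball 0 1 \<inter> (\<lambda>t. (t, norm t)) -` cball x r \<subseteq> cball (fst x) r"
        using dist_fst_le[of x] by (force intro: order_trans)
    qed auto
    also have "\<dots> = ennreal (V * r powr real ?d)"
      using r by (simp add: emeasure_cball V_def powr_realpow ennreal_mult[symmetric] mult.assoc)
    finally show ?thesis .
  qed
  have lower: "ennreal (V * (r / 2) powr real ?d) \<le> emeasure ?\<nu> (cball 0 r)" if r: "0 < r" "r \<le> 1" for r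
  proof -
    have "ennreal (V * (r / 2) powr real ?d) = ennreal (sqrt 2) * emeasure lborel (cball (0::'a) (r / 2))"
      using r by (simp add: emeasure_cball V_def powr_realpow ennreal_mult[symmetric] mult.assoc)
    also have "\<dots> \<le> emeasure ?\<nu> (cball 0 r)"
      unfolding emeasure_cone_measure[OF borel_closed[OF closed_cball]]
    proof (intro mult_left_mono emeasure_mono)
      show "cball (0::'a) (r / 2) \<subseteq> cball 0 1 \<inter> (\<lambda>t. (t, norm t)) -` cball 0 r"
      proof
        fix t :: 'a assume t: "t \<in> cball 0 (r / 2)"
        have "norm (t, norm t) \<le> norm t + norm (norm t)" by (rule norm_Pair_le)
        then show "t \<in> cball 0 1 \<inter> (\<lambda>t. (t, norm t)) -` cball 0 r" using t r by auto
      qed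
      have "(\<lambda>t::'a. (t, norm t)) \<in> borel_measurable borel"
        by (intro borel_measurable_continuous_onI continuous_intros)
      then show "cball 0 1 \<inter> (\<lambda>t::'a. (t, norm t)) -` cball 0 r \<in> sets lborel"
        using measurable_sets_borel[of "\<lambda>t::'a. (t, norm t)" borel "cball 0 r"] by (simp add: vimage_def)
    qed auto
    finally show ?thesis .
  qed
  show ?thesis
    unfolding frostman_dim_def
  proof (rule antisym)
    show "ereal (real ?d) \<le> Sup (ereal ` ?S)"
      using V upper by (intro SUP_upper) auto
    show "Sup (ereal ` ?S) \<le> ereal (real ?d)"
    proof (rule SUP_least)
      fix \<alpha> assume "\<alpha> \<in> ?S"
      then obtain C where C: "C > 0" "\<And>r x. r > 0 \<Longrightarrow> emeasure ?\<nu> (cball x r) \<le> ennreal (C * r powr \<alpha>)" by auto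
      show "ereal \<alpha> \<le> ereal (real ?d)"
      proof (rule ccontr)
        assume "\<not> ?thesis"
        then have \<alpha>: "\<alpha> - real ?d > 0" by simp
        \<comment> \<open>The contradiction comes from the apex ball of radius \<open>1 / x\<close>,
          which is too heavy for an exponent above the dimension of the base.\<close>
        obtain x where x: "x \<ge> 1" "x > 0" "x powr (\<alpha> - real ?d) > C * 2 powr real ?d / V"
          using powr_unbounded[OF \<alpha>, of 1 "C * 2 powr real ?d / V"] by auto
        have "ennreal (V * (1 / x / 2) powr real ?d) \<le> ennreal (C * (1 / x) powr \<alpha>)"
          using lower[of "1 / x"] C(2)[of "1 / x" 0] x by (auto intro: order_trans)
        then have "V * (1 / x / 2) powr real ?d \<le> C * (1 / x) powr \<alpha>" using C by (simp add: ennreal_le_iff)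
        then have "V / (x powr real ?d * 2 powr real ?d) \<le> C / x powr \<alpha>"
          using x by (simp add: powr_divide powr_mult)
        then have "V * x powr \<alpha> \<le> C * (x powr real ?d * 2 powr real ?d)" using x by (simp add: divide_simps mult.commute)
        then have "x powr \<alpha> / x powr real ?d \<le> C * 2 powr real ?d / V" using x V by (simp add: field_simps)
        then show False using x by (simp add: powr_diff)
      qed
    qed
  qed
qed

text \<open>A derivative within the interval restricts to both one-sided derivatives, which by
  uniqueness of limits are the two slopes.\<close>

lemma not_differentiable_kink:
  fixes f :: "real \<Rightarrow> real"
  assumes c: "a < c" "c < b" and left: "\<And>t. a \<le> t \<Longrightarrow> t \<le> c \<Longrightarrow> f t = p1 + m1 * t"
    and right: "\<And>t. c \<le> t \<Longrightarrow> t \<le> b \<Longrightarrow> f t = p2 + m2 * t" and m: "m1 \<noteq> m2"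
  shows "\<not> f differentiable (at c within {a..b})"
proof
  assume "f differentiable (at c within {a..b})"
  then obtain D where D: "(f has_real_derivative D) (at c within {a..b})"
    by (auto simp: real_differentiable_def)
  have "(f has_real_derivative D) (at c within {a..c})" using D by (rule DERIV_subset) (use c in auto)
  then have "(f has_real_derivative D) (at_left c)" using c by (simp add: at_within_Icc_at_left)
  moreover have "((\<lambda>t. p1 + m1 * t) has_real_derivative m1) (at c within {a..c})" by (auto intro!: derivative_eq_intros)
  then have "(f has_real_derivative m1) (at c within {a..c})"
    by (rule has_field_derivative_transform_within[where d=1]) (use c left in auto)
  then have "(f has_real_derivative m1) (at_left c)" using c by (simp add: at_within_Icc_at_left)
  ultimately have "D = m1" unfolding has_field_derivative_iff
    by (rule tendsto_unique[OF trivial_limit_at_left_real])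
  have "(f has_real_derivative D) (at c within {c..b})" using D by (rule DERIV_subset) (use c in auto)
  then have "(f has_real_derivative D) (at_right c)" using c by (simp add: at_within_Icc_at_right)
  moreover have "((\<lambda>t. p2 + m2 * t) has_real_derivative m2) (at c within {c..b})" by (auto intro!: derivative_eq_intros)
  then have "(f has_real_derivative m2) (at c within {c..b})"
    by (rule has_field_derivative_transform_within[where d=1]) (use c right in auto)
  then have "(f has_real_derivative m2) (at_right c)" using c by (simp add: at_within_Icc_at_right)
  ultimately have "D = m2" unfolding has_field_derivative_iff
    by (rule tendsto_unique[OF trivial_limit_at_right_real])
  with \<open>D = m1\<close> m show False by simp
qed

theorem proposition7p2:
  fixes d :: nat and \<nu> :: "((real ^ 'n) \<times> real) measure"
  assumes "d \<ge> 3"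
    and "CARD('n) = d - 1"
    and "\<nu> = cone_measure"
  shows "(\<forall>\<theta>\<in>{0..1}. fourier_spectrum \<nu> \<theta> =
           ereal (min (2 + (real d - 1) * \<theta>) ((real d - 2) + \<theta>)))
    \<and> (d \<ge> 5 \<longrightarrow> phase_transition \<nu> ((real d - 4) / (real d - 2)))
    \<and> (d = 3 \<or> d = 4 \<longrightarrow>
         (\<exists>a b::real. \<forall>\<theta>\<in>{0..1}. fourier_spectrum \<nu> \<theta> = ereal (a + b * \<theta>)))
    \<and> fourier_dim \<nu> = ereal (min 2 (real d - 2))
    \<and> sobolev_dim \<nu> = ereal (real d - 1)
    \<and> frostman_dim \<nu> = ereal (real d - 1)"
proof -
  have n: "CARD('n) \<ge> 2" and nd: "real CARD('n) = real d - 1" using assms by (auto simp: of_nat_diff)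
  have spec: "fourier_spectrum \<nu> \<theta> = ereal (min (2 + (real d - 1) * \<theta>) ((real d - 2) + \<theta>))" if "\<theta> \<in> {0..1}" for \<theta>
    using fourier_spectrum_cone[OF n, of \<theta>] that unfolding assms(3) nd by simp
  have "phase_transition \<nu> ((real d - 4) / (real d - 2))" if d5: "d \<ge> 5"
  proof -
    \<comment> \<open>The two branches of the minimum cross where (d - 2) t = d - 4; for d \<ge> 5
      this point is interior to the unit interval.\<close>
    define c where "c = (real d - 4) / (real d - 2)"
    have d: "real d \<ge> 5" using d5 by simp
    have c: "0 < c" "c < 1" using d by (auto simp: c_def)
    have cd: "(real d - 2) * c = real d - 4" using d by (simp add: c_def)
    have "\<not> (\<lambda>t. real_of_ereal (fourier_spectrum \<nu> t)) differentiable (at c within {0..1})"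
    proof (rule not_differentiable_kink[where ?p1.0 = 2 and ?m1.0 = "real d - 1" and ?p2.0 = "real d - 2" and ?m2.0 = 1])
      fix t assume t: "0 \<le> t" "t \<le> c"
      have "(real d - 2) * t \<le> (real d - 2) * c" using t d by (intro mult_left_mono) auto
      then have "2 + (real d - 1) * t \<le> (real d - 2) + t" unfolding cd by (simp add: algebra_simps)
      then show "real_of_ereal (fourier_spectrum \<nu> t) = 2 + (real d - 1) * t" using t c spec[of t] by simp
    next
      fix t assume t: "c \<le> t" "t \<le> 1"
      have "(real d - 2) * c \<le> (real d - 2) * t" using t d by (intro mult_left_mono) auto
      then have "(real d - 2) + t \<le> 2 + (real d - 1) * t" unfolding cd by (simp add: algebra_simps)
      then show "real_of_ereal (fourier_spectrum \<nu> t) = real d - 2 + 1 * t" using t c spec[of t] by simp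
    qed (use c d in auto)
    then show ?thesis using c unfolding phase_transition_def c_def by auto
  qed
  moreover have "\<exists>a b::real. \<forall>\<theta>\<in>{0..1}. fourier_spectrum \<nu> \<theta> = ereal (a + b * \<theta>)" if d34: "d = 3 \<or> d = 4"
  proof (intro exI ballI)
    fix \<theta> :: real assume \<theta>: "\<theta> \<in> {0..1}"
    \<comment> \<open>For these d the crossing value (d - 4) / (d - 2) is at most 0, so the second
      branch is the minimum on the whole interval.\<close>
    have "(real d - 2) + \<theta> \<le> 2 + (real d - 1) * \<theta>" using d34 \<theta> by auto
    then show "fourier_spectrum \<nu> \<theta> = ereal ((real d - 2) + 1 * \<theta>)" using spec[OF \<theta>] by simp
  qed
  moreover have "fourier_dim \<nu> = ereal (min 2 (real d - 2))"
    using spec[of 0] by (simp add: fourier_dim_def)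
  moreover have "sobolev_dim \<nu> = ereal (real d - 1)"
    using spec[of 1] assms(1) by (simp add: sobolev_dim_def)
  moreover have "frostman_dim \<nu> = ereal (real d - 1)"
    unfolding assms(3) frostman_dim_cone by (simp add: nd)
  ultimately show ?thesis using spec by blast
qed

end
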